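(* Let $W=x_1^{d_1}+\dots+x_N^{d_N}$ (with integers $d_i\ge 2$) be an invertible Fermat polynomial, and let $G\subseteq G_W^{\max}$ be an admissible group (i.e. $j_W\in G$) of the form $G=H\cdot K$, where $K\le G$ is the subgroup of pure even permutations and $H\le G$ is the subgroup of diagonal symmetries, $H=G\cap G_W^{\mathrm{diag}}$. Let $G^\star=H^T\cdot K$ be the non-abelian dual group. Let $\mathcal{A}_0\subseteq\mathcal{A}_{W,G}$ and $\mathcal{B}_0\subseteq\mathcal{B}_{W^T,G^\star}$ be the untwisted broad sectors, and let $\mathcal{A}_{nar'}\subseteq \mathcal{A}_{W,G}$ and $\mathcal{B}_{nar'}\subseteq\mathcal{B}_{W^T,G^\star}$ be the subspaces indexed by the narrow diagonal symmetries in $H$ and in $H^T$ respectively. Then there exist isomorphisms of bigraded vector spaces $$\mathcal{A}_0\xrightarrow{\ \sim\ }\mathcal{B}_{nar'}\qquad\text{and}\qquad \mathcal{A}_{nar'}\xrightarrow{\ \sim\ }\mathcal{B}_0,$$ where $\mathcal{A}_0,\mathcal{A}_{nar'}$ carry the A-model bigrading and $\mathcal{B}_0,\mathcal{B}_{nar'}$ carry the B-model bigrading.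
   Context: Polynomials and symmetry groups. A polynomial $W:\mathbb{C}^N\to\mathbb{C}$ is quasihomogeneous with weights $q_1,\dots,q_N\in\mathbb{Q}_{>0}$ if $W(c^{q_1}x_1,\dots,c^{q_N}x_N)=cW(x_1,\dots,x_N)$ for all $c\in\mathbb{C}^*$; it is nondegenerate if it has an isolated critical point at the origin and contains no monomial $x_ix_j$ with $i\neq j$; it is invertible if it is quasihomogeneous, nondegenerate and has as many monomials as variables. Coefficients are scaled to be $1$. For $W=\sum_i x_i^{d_i}$ one has $q_i=1/d_i$. $G_W^{\max}=\{g\in \mathrm{GL}_N(\mathbb{C}) : W(gx)=W(x),\ g_{ij}=0 \text{ if } q_i\ne q_j\}$. $G_W^{\mathrm{diag}}$ is its subgroup of diagonal matrices; its elements have entries that are roots of unity and are written additively: $(a_1,\dots,a_N)\in(\mathbb{Q}/\mathbb{Z})^N$ stands for $\mathrm{diag}(e^{2\pi i a_1},\dots,e^{2\pi i a_N})$. The exponential grading operator is $j_W=(q_1,\dots,q_N)\in G_W^{\mathrm{diag}}$. A pure permutation is an element of $G_W^{\max}$ that acts by permuting the variables (a permutation matrix); it is even if the permutation is even. Duals. If $W=\sum_{i=1}^N\prod_{j=1}^N x_j^{a_{ij}}$, set $A_W=(a_{ij})$; the dual polynomial $W^T$ is the invertible polynomial with exponent matrix $A_W^T$ (for Fermat $W$, $A_W=\mathrm{diag}(d_1,\dots,d_N)$ and $W^T=W$). For $H\le G_W^{\mathrm{diag}}$, the dual group is $H^T=\{g\in G_{W^T}^{\mathrm{diag}} : gA_Wh^{T}\in\mathbb{Z}\text{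 for all }h\in H\}$, with $g,h$ regarded as row vectors in additive form. For $G=H\cdot K$ as in the claim, $G^\star=H^T\cdot K\le\mathrm{GL}_N(\mathbb{C})$, where $K$ is also regarded as a group of symmetries of $W^T$. State spaces. For a polynomial $V$ (here $V=W$ or $W^T$) and a symmetry $g$ of $V$, let $\mathrm{Fix}(g)\subseteq\mathbb{C}^N$ be the fixed subspace, $N_g=\dim\mathrm{Fix}(g)$, $V_g=V|_{\mathrm{Fix}(g)}$, $\mathcal{Q}_{V_g}$ the Milnor ring (polynomial functions on $\mathrm{Fix}(g)$ modulo the ideal generated by the partial derivatives of $V_g$), and $\omega_g$ a volume form on $\mathrm{Fix}(g)$ (the exterior product of the differentials of linear coordinates). If $\mathrm{Fix}(g)=\{0\}$ then $g$ is called narrow and $\mathcal{Q}_{V_g}\cdot\omega_g\cong\mathbb{C}$. Write $\lfloor P,g\rceil$ for an element of the summand $\mathcal{Q}_{V_g}\cdot\omega_g$, where $P$ includes the volume form. An element $\gamma$ of the group acts on $\bigoplus_g\mathcal{Q}_{V_g}\cdot\omega_g$ by $\gamma\cdot\lfloor P,g\rceil=\lfloor\gamma\cdot P,\gamma g\gamma^{-1}\rceil$, where $\gamma\cdot P$ is the pullback of the form $P$ along $\gamma^{-1}:\mathrm{Fix}(\gamma g\gamma^{-1})\to\mathrm{Fix}(g)$; in particular a permutation $\sigma$ acts by $\sigma\cdot x_i=x_{\sigma^{-1}(i)}$, and on narrow summands $\gamma\cdot\lfloor1,g\rceil=\lfloor1,\gamma g\gamma^{-1}\rceil$. The A-model and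 B-model state spaces are $$\mathcal{A}_{W,G}=\Big(\bigoplus_{g\in G}\mathcal{Q}_{W_g}\cdot\omega_g\Big)^{G},\qquad \mathcal{B}_{W^T,G^\star}=\Big(\bigoplus_{g\in G^\star}\mathcal{Q}_{W^T_g}\cdot\omega_g\Big)^{G^\star}.$$ The untwisted broad sectors are the invariants in the identity summand: $\mathcal{A}_0=(\mathcal{Q}_W\cdot\omega)^G$ and $\mathcal{B}_0=(\mathcal{Q}_{W^T}\cdot\omega)^{G^\star}$ with $\omega=dx_1\wedge\dots\wedge dx_N$. The narrow diagonal subspaces are $$\mathcal{A}_{nar'}=\Big(\bigoplus_{g\in H,\ \mathrm{Fix}(g)=\{0\}}\mathcal{Q}_{W_g}\cdot\omega_g\Big)^G,\qquad \mathcal{B}_{nar'}=\Big(\bigoplus_{g\in H^T,\ \mathrm{Fix}(g)=\{0\}}\mathcal{Q}_{W^T_g}\cdot\omega_g\Big)^{G^\star}.$$ Bigradings. For $g$ of finite order with eigenvalues $\lambda_1,\dots,\lambda_N$, $\mathrm{age}\,g=\frac{1}{2\pi i}\sum_j\log\lambda_j$ with the branch of $\log$ satisfying $0\le \frac1i\log\lambda_j<2\pi$. Let $\deg P$ be the weighted degree of a weighted-homogeneous $P$, where $x_i$ and $dx_i$ have degree $q_i$ (so the volume form contributes). The A-model bidegree of $\lfloor P,g\rceil$ is $$(\deg P+\mathrm{age}\,g-\mathrm{age}\,j_W,\ N_g-\deg P+\mathrm{age}\,g-\mathrm{age}\,j_W),$$ and the B-model bidegree of $\lfloor P,g\rceil$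 (for $W^T$) is $$(\deg P+\mathrm{age}\,g-\mathrm{age}\,j_{W^T},\ \deg P+\mathrm{age}\,g^{-1}-\mathrm{age}\,j_{W^T}).$$ The group actions preserve these bidegrees, so the state spaces and the four subspaces above inherit bigradings. *)

theory Defs
  imports
    "HOL-Analysis.Analysis"
    "HOL-Library.Function_Algebras"
    "HOL-Library.Set_Algebras"
    "HOL-Computational_Algebra.Computational_Algebra"
    "HOL-Algebra.Coset"
begin

text \<open>The number $N$ of variables is the cardinality of the index type \<open>'n\<close>.
  A polynomial with all coefficients $1$ and as many monomials as variables is given by its
  exponent matrix, one row per monomial.\<close>

definition polynomial_of :: "nat^'n^'n \<Rightarrow> complex^'n \<Rightarrow> complex" where
  "polynomial_of A x = (\<Sum>i\<in>UNIV. \<Prod>j\<in>UNIV. (x $ j) ^ (A $ i $ j))"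

definition fermat_exponents :: "('n \<Rightarrow> nat) \<Rightarrow> nat^'n^'n" where
  "fermat_exponents d = (\<chi> i j. if i = j then d i else 0)"

definition dilation :: "('n \<Rightarrow> rat) \<Rightarrow> complex \<Rightarrow> complex^'n \<Rightarrow> complex^'n" where
  "dilation q t x = (\<chi> i. exp (of_rat (q i) * t) * x $ i)"

text \<open>Writing $c = e^t$, the vector \<open>dilation q t x\<close> is $(c^{q_i} x_i)_i$;
  letting \<open>t\<close> range over all complex numbers accounts for every nonzero \<open>c\<close> and every
  choice of $\log c$ in the definition of its rational powers.\<close>

definition quasihomogeneous :: "(complex^'n \<Rightarrow> complex) \<Rightarrow> ('n \<Rightarrow> rat) \<Rightarrow> bool" where
  "quasihomogeneous V q \<longleftrightarrow>
     (\<forall>i. q i > 0) \<and> (\<forall>t x. V (dilation q t x) = exp t * V x)"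

text \<open>For an invertible polynomial the weights are unique; see \<open>weights_fermat\<close> below
  for the Fermat case.\<close>

definition weights :: "(complex^'n \<Rightarrow> complex) \<Rightarrow> 'n \<Rightarrow> rat" where
  "weights V = (THE q. quasihomogeneous V q)"

definition general_linear :: "(complex^'n^'n) monoid" where
  "general_linear = \<lparr>carrier = {g. invertible g}, mult = (**), one = mat 1\<rparr>"

definition max_symmetries :: "(complex^'n \<Rightarrow> complex) \<Rightarrow> (complex^'n^'n) set" where
  "max_symmetries V = {g. invertible g \<and> (\<forall>x. V (g *v x) = V x) \<and>
     (\<forall>i j. weights V i \<noteq> weights V j \<longrightarrow> g $ i $ j = 0)}"

definition diagonal_symmetries :: "(complex^'n \<Rightarrow> complex) \<Rightarrow> (complex^'n^'n) set" where
  "diagonal_symmetries V = {g \<in> max_symmetries V. \<forall>i j. i \<noteq> j \<longrightarrow> g $ i $ j = 0}"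

text \<open>The diagonal matrix denoted additively by $(a_1,\dots,a_N)$.\<close>

definition additive :: "('n \<Rightarrow> rat) \<Rightarrow> complex^'n^'n" where
  "additive a = (\<chi> i j. if i = j then exp (2 * of_real pi * \<i> * of_rat (a i)) else 0)"

definition grading_operator :: "(complex^'n \<Rightarrow> complex) \<Rightarrow> complex^'n^'n" where
  "grading_operator V = additive (weights V)"

definition even_permutations :: "(complex^'n^'n) set" where
  "even_permutations =
     {(\<chi> i j. if j = p i then 1 else 0) | p. p permutes UNIV \<and> evenperm p}"

text \<open>The dual $H^T$ of a group of diagonal symmetries of \<open>polynomial_of A\<close>. The integrality
  condition does not depend on the representatives modulo the integers.\<close>

definition dual_group :: "nat^'n^'n \<Rightarrow> (complex^'n^'n) set \<Rightarrow> (complex^'n^'n) set" where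
  "dual_group A H =
     {additive a | a.
        additive a \<in> diagonal_symmetries (polynomial_of (Finite_Cartesian_Product.transpose A)) \<and>
        (\<forall>b. additive b \<in> H \<longrightarrow>
           (\<Sum>i\<in>UNIV. \<Sum>j\<in>UNIV. a i * of_nat (A $ i $ j) * b j) \<in> \<int>)}"

definition fixed_space :: "complex^'n^'n \<Rightarrow> (complex^'n) set" where
  "fixed_space g = {x. g *v x = x}"

inductive_set polynomial_functions :: "(complex^'n \<Rightarrow> complex) set" where
  const: "(\<lambda>x. c) \<in> polynomial_functions"
| coord: "(\<lambda>x. x $ i) \<in> polynomial_functions"
| add: "\<lbrakk>f \<in> polynomial_functions; h \<in> polynomial_functions\<rbrakk>
          \<Longrightarrow> (\<lambda>x. f x + h x) \<in> polynomial_functions"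
| mult: "\<lbrakk>f \<in> polynomial_functions; h \<in> polynomial_functions\<rbrakk>
          \<Longrightarrow> (\<lambda>x. f x * h x) \<in> polynomial_functions"

text \<open>A differential form of degree $k$ is a function of a point and of a list of \<open>k\<close> tangent
  vectors. A form on a subspace $E$ is extended by zero, so that equality of forms is equality
  on $E$.\<close>

type_synonym 'n form = "complex^'n \<Rightarrow> (complex^'n) list \<Rightarrow> complex"

definition linear_coordinates ::
    "(complex^'n) set \<Rightarrow> (complex^'n \<Rightarrow> complex) list \<Rightarrow> bool" where
  "linear_coordinates E ls \<longleftrightarrow>
     (\<forall>l\<in>set ls. Vector_Spaces.linear (*s) (*) l) \<and>
     bij_betw (\<lambda>x. map (\<lambda>l. l x) ls) E {cs. length cs = vec.dim E}"

text \<open>The value of $dl_1 \wedge \dots \wedge dl_k$ on $(v_1,\dots,v_k)$ is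
  $\det (l_i(v_j))_{i,j}$.\<close>

definition wedge :: "(complex^'n \<Rightarrow> complex) list \<Rightarrow> (complex^'n) list \<Rightarrow> complex" where
  "wedge ls vs = (\<Sum>p | p permutes {..<length ls}.
     of_int (sign p) * (\<Prod>i<length ls. (ls ! i) (vs ! p i)))"

definition volume_forms :: "(complex^'n) set \<Rightarrow> ((complex^'n) list \<Rightarrow> complex) set" where
  "volume_forms E = {wedge ls | ls. linear_coordinates E ls}"

definition form_on ::
    "(complex^'n) set \<Rightarrow> (complex^'n \<Rightarrow> complex) \<Rightarrow> ((complex^'n) list \<Rightarrow> complex) \<Rightarrow> 'n form" where
  "form_on E f \<omega> = (\<lambda>x vs.
     if x \<in> E \<and> set vs \<subseteq> E \<and> length vs = vec.dim E then f x * \<omega> vs else 0)"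

text \<open>Volume forms on \<open>E\<close> are unique up to a nonzero scalar, so the next sets are the multiples
  of any single volume form by the polynomial functions, and by the Jacobian ideal,
  respectively.\<close>

definition top_forms :: "(complex^'n) set \<Rightarrow> 'n form set" where
  "top_forms E = {form_on E f \<omega> | f \<omega>. f \<in> polynomial_functions \<and> \<omega> \<in> volume_forms E}"

definition derivative_along ::
    "(complex^'n \<Rightarrow> complex) \<Rightarrow> complex^'n \<Rightarrow> complex^'n \<Rightarrow> complex" where
  "derivative_along V e x = deriv (\<lambda>t. V (x + t *s e)) 0"

text \<open>The ideal generated by the partial derivatives of the restriction of \<open>V\<close> to \<open>E\<close>. The
  derivative along any direction \<open>e \<in> E\<close> is a linear combination of the partial derivatives
  with respect to any linear coordinates on \<open>E\<close>, so no coordinates need to be chosen.\<close>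

definition jacobian_ideal ::
    "(complex^'n \<Rightarrow> complex) \<Rightarrow> (complex^'n) set \<Rightarrow> (complex^'n \<Rightarrow> complex) set" where
  "jacobian_ideal V E = {(\<lambda>x. \<Sum>e\<in>S. f e x * derivative_along V e x) | S f.
     finite S \<and> S \<subseteq> E \<and> (\<forall>e\<in>S. f e \<in> polynomial_functions)}"

definition jacobian_forms :: "(complex^'n \<Rightarrow> complex) \<Rightarrow> (complex^'n) set \<Rightarrow> 'n form set" where
  "jacobian_forms V E =
     {form_on E f \<omega> | f \<omega>. f \<in> jacobian_ideal V E \<and> \<omega> \<in> volume_forms E}"

text \<open>The summand of \<open>g\<close>, i.e. the Milnor ring of the restriction of \<open>V\<close> to the fixed space of
  \<open>g\<close>, times the volume form; its elements are cosets of \<open>jacobian_forms V (fixed_space g)\<close>.\<close>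

definition sector :: "(complex^'n \<Rightarrow> complex) \<Rightarrow> complex^'n^'n \<Rightarrow> 'n form set set" where
  "sector V g =
     {\<eta> +o jacobian_forms V (fixed_space g) | \<eta>. \<eta> \<in> top_forms (fixed_space g)}"

definition pullback :: "complex^'n^'n \<Rightarrow> 'n form \<Rightarrow> 'n form" where
  "pullback m \<eta> = (\<lambda>x vs. \<eta> (m *v x) (map (\<lambda>v. m *v v) vs))"

text \<open>\<open>weighted_degree q \<eta> r\<close>: the form \<open>\<eta>\<close> is homogeneous of degree \<open>r\<close> when
  $x_i$ and $dx_i$ have degree $q_i$.\<close>

definition weighted_degree :: "('n::finite \<Rightarrow> rat) \<Rightarrow> 'n form \<Rightarrow> real \<Rightarrow> bool" where
  "weighted_degree q \<eta> r \<longleftrightarrow>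
     (\<forall>t x vs. \<eta> (dilation q t x) (map (dilation q t) vs) = exp (of_real r * t) * \<eta> x vs)"

definition characteristic_polynomial :: "complex^'n^'n \<Rightarrow> complex poly" where
  "characteristic_polynomial g = det (mat [:0, 1:] - map_matrix (\<lambda>c. [:c:]) g)"

definition age :: "complex^'n^'n \<Rightarrow> real" where
  "age g = (\<Sum>z\<in>#proots (characteristic_polynomial g). Arg2pi z / (2 * pi))"

definition A_bidegree ::
    "(complex^'n \<Rightarrow> complex) \<Rightarrow> complex^'n^'n \<Rightarrow> real \<Rightarrow> real \<times> real" where
  "A_bidegree V g r =
     (r + age g - age (grading_operator V),
      real (vec.dim (fixed_space g)) - r + age g - age (grading_operator V))"

definition B_bidegree ::
    "(complex^'n \<Rightarrow> complex) \<Rightarrow> complex^'n^'n \<Rightarrow> real \<Rightarrow> real \<times> real" where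
  "B_bidegree V g r =
     (r + age g - age (grading_operator V),
      r + age (matrix_inv g) - age (grading_operator V))"

record 'a bigraded_space = "'a partial_object" +
  vadd :: "'a \<Rightarrow> 'a \<Rightarrow> 'a"
  vscale :: "complex \<Rightarrow> 'a \<Rightarrow> 'a"
  component :: "real \<times> real \<Rightarrow> 'a set"

definition bigraded_iso ::
    "('a \<Rightarrow> 'b) \<Rightarrow> 'a bigraded_space \<Rightarrow> 'b bigraded_space \<Rightarrow> bool" where
  "bigraded_iso \<phi> M N \<longleftrightarrow>
     bij_betw \<phi> (carrier M) (carrier N) \<and>
     (\<forall>s\<in>carrier M. \<forall>t\<in>carrier M. \<phi> (vadd M s t) = vadd N (\<phi> s) (\<phi> t)) \<and>
     (\<forall>c. \<forall>s\<in>carrier M. \<phi> (vscale M c s) = vscale N c (\<phi> s)) \<and>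
     (\<forall>ab. \<phi> ` component M ab = component N ab)"

text \<open>An element of the direct sum of the sectors over \<open>g \<in> G\<close> is a family of cosets indexed by
  matrices, with the (non-coset) value \<open>{}\<close> outside \<open>G\<close>.\<close>

type_synonym 'n state = "complex^'n^'n \<Rightarrow> 'n form set"

definition sector_sum ::
    "(complex^'n \<Rightarrow> complex) \<Rightarrow> (complex^'n^'n) set \<Rightarrow> 'n state set" where
  "sector_sum V G = {s. (\<forall>g\<in>G. s g \<in> sector V g) \<and> (\<forall>g. g \<notin> G \<longrightarrow> s g = {}) \<and>
     finite {g \<in> G. s g \<noteq> jacobian_forms V (fixed_space g)}}"

text \<open>\<open>act \<gamma>\<close> sends the coset of \<open>\<eta>\<close> in the sector of \<open>g\<close> to the coset of the pullback of \<open>\<eta>\<close>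
  along $\gamma^{-1}$ in the sector of $\gamma g \gamma^{-1}$.\<close>

definition act :: "complex^'n^'n \<Rightarrow> 'n state \<Rightarrow> 'n state" where
  "act \<gamma> s = (\<lambda>g. pullback (matrix_inv \<gamma>) ` s (matrix_inv \<gamma> ** g ** \<gamma>))"

definition invariant_states ::
    "(complex^'n \<Rightarrow> complex) \<Rightarrow> (complex^'n^'n) set \<Rightarrow> 'n state set" where
  "invariant_states V G = {s \<in> sector_sum V G. \<forall>\<gamma>\<in>G. act \<gamma> s = s}"

text \<open>The zero class belongs to the component of every bidegree.\<close>

definition sector_component ::
    "(complex^'n^'n \<Rightarrow> real \<Rightarrow> real \<times> real) \<Rightarrow> (complex^'n \<Rightarrow> complex) \<Rightarrow> complex^'n^'n \<Rightarrow>
     real \<times> real \<Rightarrow> 'n form set set" where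
  "sector_component bideg V g ab = insert (jacobian_forms V (fixed_space g))
     {\<eta> +o jacobian_forms V (fixed_space g) | \<eta> r.
        \<eta> \<in> top_forms (fixed_space g) \<and> weighted_degree (weights V) \<eta> r \<and> bideg g r = ab}"

text \<open>Addition is addition of cosets, lifted pointwise by \<open>HOL-Library.Function_Algebras\<close> and
  \<open>HOL-Library.Set_Algebras\<close>. In the scalar multiplication, adding the Jacobian forms matters
  only for the scalar $0$.\<close>

definition state_space ::
    "(complex^'n^'n \<Rightarrow> real \<Rightarrow> real \<times> real) \<Rightarrow> (complex^'n \<Rightarrow> complex) \<Rightarrow> (complex^'n^'n) set \<Rightarrow>
     'n state bigraded_space" where
  "state_space bideg V G =
     \<lparr>carrier = invariant_states V G,
      vadd = (\<lambda>s t. s + t),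
      vscale = (\<lambda>c s g. (\<lambda>\<eta> x vs. c * \<eta> x vs) ` s g + jacobian_forms V (fixed_space g)),
      component = (\<lambda>ab. {s \<in> invariant_states V G. \<forall>g\<in>G. s g \<in> sector_component bideg V g ab})\<rparr>"

definition A_model ::
    "(complex^'n \<Rightarrow> complex) \<Rightarrow> (complex^'n^'n) set \<Rightarrow> 'n state bigraded_space" where
  "A_model V G = state_space (A_bidegree V) V G"

definition B_model ::
    "(complex^'n \<Rightarrow> complex) \<Rightarrow> (complex^'n^'n) set \<Rightarrow> 'n state bigraded_space" where
  "B_model V G = state_space (B_bidegree V) V G"

text \<open>The subspace of the states all of whose components outside \<open>S\<close> are zero.\<close>

definition supported_on ::
    "(complex^'n \<Rightarrow> complex) \<Rightarrow> (complex^'n^'n) set \<Rightarrow> (complex^'n^'n) set \<Rightarrow>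
     'n state bigraded_space \<Rightarrow> 'n state bigraded_space" where
  "supported_on V G S M =
     (let U = {s. \<forall>g\<in>G - S. s g = jacobian_forms V (fixed_space g)}
      in M\<lparr>carrier := carrier M \<inter> U, component := (\<lambda>ab. component M ab \<inter> U)\<rparr>)"

definition narrow :: "(complex^'n^'n) set \<Rightarrow> (complex^'n^'n) set" where
  "narrow H = {g \<in> H. fixed_space g = {0}}"

definition A_untwisted where "A_untwisted V G = supported_on V G {mat 1} (A_model V G)"
definition B_untwisted where "B_untwisted V G = supported_on V G {mat 1} (B_model V G)"
definition A_narrow where "A_narrow V G H = supported_on V G (narrow H) (A_model V G)"
definition B_narrow where "B_narrow V G H = supported_on V G (narrow H) (B_model V G)"

lemma polynomial_of_fermat:
  "polynomial_of (fermat_exponents d) x = (\<Sum>i\<in>UNIV. (x $ i) ^ d i)"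
proof -
  have "(\<Prod>j\<in>UNIV. (x $ j) ^ (if i = j then d i else 0)) = (x $ i) ^ d i" for i
    by (subst prod.remove[of _ i]) auto
  then show ?thesis
    by (simp add: polynomial_of_def fermat_exponents_def)
qed

lemma transpose_fermat:
  "Finite_Cartesian_Product.transpose (fermat_exponents d) = fermat_exponents d"
  by (simp add: Finite_Cartesian_Product.transpose_def fermat_exponents_def vec_eq_iff)

lemma quasihomogeneous_fermat_iff:
  assumes d: "\<And>i. d i > 0"
  shows "quasihomogeneous (polynomial_of (fermat_exponents d)) q \<longleftrightarrow> q = (\<lambda>i. 1 / of_nat (d i))"
proof
  assume q: "quasihomogeneous (polynomial_of (fermat_exponents d)) q"
  show "q = (\<lambda>i. 1 / of_nat (d i))"
  proof
    fix i
    let ?W = "polynomial_of (fermat_exponents d)"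
    have val: "?W (\<chi> j. if j = i then c else 0) = c ^ d i" for c
      unfolding polynomial_of_fermat using d
      by (subst sum.remove[of _ i]) (auto intro!: sum.neutral)
    have "?W (dilation q 1 (\<chi> j. if j = i then 1 else 0)) = exp 1"
      using q val[of 1] by (simp add: quasihomogeneous_def)
    moreover have "dilation q 1 (\<chi> j. if j = i then 1 else 0)
        = (\<chi> j. if j = i then exp (of_rat (q i)) else 0)"
      by (auto simp: dilation_def vec_eq_iff)
    ultimately have "exp (of_rat (q i)) ^ d i = exp (1::complex)"
      using val by simp
    moreover have "of_rat (q i) = complex_of_real (of_rat (q i))"
      by (cases "q i") (simp add: of_rat_rat)
    ultimately have "norm (exp (complex_of_real (of_rat (q i))) ^ d i)
        = norm (exp (complex_of_real 1))"
      by simp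
    then have "exp (of_rat (q i) :: real) ^ d i = exp 1"
      by (simp only: norm_power norm_exp_eq_Re Re_complex_of_real)
    then have "real (d i) * of_rat (q i) = 1"
      by (simp flip: exp_of_nat_mult)
    then have "of_rat (of_nat (d i) * q i) = (1::real)"
      by (simp add: of_rat_mult)
    then have "of_nat (d i) * q i = 1"
      by (simp only: of_rat_eq_1_iff)
    then show "q i = 1 / of_nat (d i)"
      using d[of i] by (simp add: field_simps)
  qed
next
  assume q: "q = (\<lambda>i. 1 / of_nat (d i))"
  have "(exp (of_rat (q i) * t) * y) ^ d i = exp t * y ^ d i" for i t and y :: complex
    using d[of i] by (simp add: q power_mult_distrib of_rat_divide flip: exp_of_nat_mult)
  then show "quasihomogeneous (polynomial_of (fermat_exponents d)) q"
    using d by (simp add: quasihomogeneous_def polynomial_of_fermat dilation_def sum_distrib_left)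
      (simp add: q)
qed

lemma weights_fermat:
  assumes "\<And>i. d i > 0"
  shows "weights (polynomial_of (fermat_exponents d)) = (\<lambda>i. 1 / of_nat (d i))"
  by (simp add: weights_def quasihomogeneous_fermat_iff[of d] assms)

end

theory Submission
  imports "Jordan_Normal_Form.Determinant" Defs
begin

text \<open>
  Both isomorphisms hold because all four spaces are spaces of functions on exponent vectors.
  Let $q_i = 1/d_i$ and let $b$ range over the exponents with $0 \le b_i \le d_i - 2$.

  In the untwisted sector, the partial derivatives of $W$ are multiples of $x_i^{d_i - 1}$, so
  the monomials $x^b$ form a basis of the Milnor ring (\<open>jacobian_ideal_fermat\<close>). A diagonal
  symmetry $(h_1,\dots,h_N)$ multiplies $x^b\,dx_1 \wedge \dots \wedge dx_N$ by the root of unity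
  with exponent $\sum_i (b_i + 1) h_i$, where the summand $1$ comes from $dx_i$; this is the pairing
  of $h$ with $((b_1 + 1)/d_1, \dots, (b_N + 1)/d_N)$ that defines the dual group. An even
  permutation fixes the volume form and permutes the monomials. Hence the invariants under
  $H \cdot K$ are the $K$-invariant functions on the set of those $b$ for which
  $((b_i + 1)/d_i)_i$ lies in $H^T$ (\<open>untwisted_iso\<close>).

  In the narrow sectors, a diagonal symmetry without eigenvalue $1$ is $((b_i + 1)/d_i)_i$ for a
  unique such $b$ (\<open>narrow_eq\<close>). Its sector is a line on which the diagonal symmetries act
  trivially, and permutations act by permuting the lines. Hence the invariants are the
  $K$-invariant functions on the set of those $b$ for which $((b_i + 1)/d_i)_i$ lies in the
  diagonal subgroup (\<open>narrow_iso\<close>).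

  The group $G^\star = H^T \cdot K$ satisfies the same hypotheses as $G = H \cdot K$ and has $H^T$ as
  its diagonal subgroup (\<open>dual_split_symmetry_group\<close>, \<open>dual_\<Gamma>_diagonal\<close>), so both descriptions
  apply to both groups. For $\mathcal{A}_0$ and $\mathcal{B}_{nar'}$ they give the same set of
  exponents at once. For $\mathcal{A}_{nar'}$ and $\mathcal{B}_0$ the sets are given by $H$ and by
  $(H^T)^T$; these groups are equal by orthogonality of characters (\<open>double_dual\<close>).

  The bidegrees agree because the weighted degree of $x^b\,dx_1 \wedge \dots \wedge dx_N$ is
  $\sum_i (b_i + 1)/d_i$, which is the age of the corresponding narrow symmetry, while the age of
  its inverse is $N$ minus this number (\<open>mirror_bidegree\<close>).

  A state has a component in every sector, also in those that it does not really involve. For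
  these sectors one needs that the zero class is a subspace preserved by the action, which rests
  on existence and uniqueness up to scalars of volume forms on the fixed spaces
  (\<open>ex_linear_coordinates\<close>, \<open>wedge_proportional\<close>, \<open>pullback_zero_class\<close>).
\<close>

\<comment> \<open>The symbol is left to the components of vectors.\<close>
no_notation Matrix.vec_index (infixl "$" 100)
no_notation fps_nth (infixl "$" 75)

section \<open>Volume forms on a subspace\<close>

lemma wedge_eq_det:
  assumes "length ls = k"
  shows "wedge ls vs = Determinant.det (Matrix.mat k k (\<lambda>(i, j). (ls ! i) (vs ! j)))"
  using assms by (subst det_def'[of _ k])
    (auto simp: wedge_def lessThan_atLeast0 permutes_in_image intro!: sum.cong prod.cong)

lemma length_linear_coordinates:
  assumes "linear_coordinates E ls"
  shows "length ls = vec.dim E"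
proof -
  have "replicate (vec.dim E) 0 \<in> (\<lambda>x. map (\<lambda>l. l x) ls) ` E"
    using assms unfolding linear_coordinates_def bij_betw_def by force
  then show ?thesis
    by (metis (no_types, lifting) imageE length_map length_replicate)
qed

lemma linear_form_sum:
  assumes "Vector_Spaces.linear (*s) (*) l"
  shows "l (\<Sum>a\<in>A. c a *s e a) = (\<Sum>a\<in>A. c a * l (e a))"
proof -
  interpret l: Vector_Spaces.linear "(*s)" "(*)" l by fact
  show ?thesis by (simp add: l.sum l.scale)
qed

text \<open>A basis of \<open>E\<close> is extended to a basis of the whole space, because the coordinate functions
  have to be linear on the whole space and not only on \<open>E\<close>.\<close>

lemma ex_linear_coordinates:
  fixes E :: "(complex^'n) set"
  assumes E: "vec.subspace E"
  obtains ls where "linear_coordinates E ls"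
proof -
  obtain B where B: "B \<subseteq> E" "vec.independent B" "E \<subseteq> vec.span B" "card B = vec.dim E"
    using vec.basis_exists by blast
  have span_B: "vec.span B = E"
    using B E by (simp add: vec.span_minimal subset_antisym)
  obtain bs where bs: "set bs = B" "distinct bs"
    using finite_distinct_list[OF vec.finiteI_independent[OF B(2)]] by blast
  have len: "length bs = vec.dim E"
    using bs B(4) distinct_card by fastforce
  define R where "R = vec.representation (vec.extend_basis B)"
  define ls where "ls = map (\<lambda>b x. R x b) bs"
  have R: "R x = vec.representation B x" if "x \<in> E" for x
    unfolding R_def using that B span_B
    by (intro vec.representation_extend vec.extend_basis_superset vec.independent_extend_basis) auto
  have lin: "Vector_Spaces.linear (*s) (*) l" if "l \<in> set ls" for l
    using that B unfolding ls_def R_def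
    by (auto intro!: vec.linear_representation vec.independent_extend_basis)
  have "bij_betw (\<lambda>x. map (\<lambda>l. l x) ls) E {cs. length cs = vec.dim E}"
  proof (intro bij_betw_imageI)
    show "inj_on (\<lambda>x. map (\<lambda>l. l x) ls) E"
    proof
      fix x y assume xy: "x \<in> E" "y \<in> E" "map (\<lambda>l. l x) ls = map (\<lambda>l. l y) ls"
      then have "\<forall>b\<in>B. R x b = R y b"
        by (auto simp: ls_def bs)
      then have "(\<Sum>b\<in>B. R x b *s b) = (\<Sum>b\<in>B. R y b *s b)"
        by (intro sum.cong) auto
      moreover have "(\<Sum>b\<in>B. R z b *s b) = z" if "z \<in> E" for z
        using that B span_B by (simp add: R vec.sum_representation_eq vec.finiteI_independent)
      ultimately show "x = y" using xy by simp
    qed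
  next
    show "(\<lambda>x. map (\<lambda>l. l x) ls) ` E = {cs. length cs = vec.dim E}"
    proof (intro subset_antisym subsetI)
      fix cs assume "cs \<in> {cs :: complex list. length cs = vec.dim E}"
      then have cs: "length cs = length bs" using len by simp
      define x where "x = (\<Sum>i<length bs. cs ! i *s bs ! i)"
      have x: "x \<in> E"
        unfolding x_def using B bs E
        by (auto intro!: vec.subspace_sum vec.subspace_scale)
      have "R x (bs ! j) = cs ! j" if j: "j < length bs" for j
      proof -
        have "Vector_Spaces.linear (*s) (*) (\<lambda>x. R x (bs ! j))"
          using lin j by (auto simp: ls_def)
        then have "R x (bs ! j) = (\<Sum>i<length bs. cs ! i * R (bs ! i) (bs ! j))"
          unfolding x_def by (rule linear_form_sum)
        also have "\<dots> = (\<Sum>i<length bs. if i = j then cs ! i else 0)"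
        proof (rule sum.cong)
          fix i assume i: "i \<in> {..<length bs}"
          have "R (bs ! i) = (\<lambda>v. if v = bs ! i then 1 else 0)"
            using i bs B by (subst R) (auto intro!: vec.representation_basis)
          then show "cs ! i * R (bs ! i) (bs ! j) = (if i = j then cs ! i else 0)"
            using i j bs by (auto simp: nth_eq_iff_index_eq)
        qed simp
        finally show ?thesis using j by simp
      qed
      then have "map (\<lambda>l. l x) ls = cs"
        using cs by (auto simp: ls_def list_eq_iff_nth_eq)
      then show "cs \<in> (\<lambda>x. map (\<lambda>l. l x) ls) ` E" using x by blast
    qed (auto simp: ls_def len)
  qed
  with lin that show thesis by (auto simp: linear_coordinates_def)
qed

text \<open>The coordinates \<open>ls'\<close> are linear combinations of the coordinates \<open>ls\<close>, so the matrix
  whose determinant is \<open>wedge ls'\<close> is a constant matrix times the one for \<open>wedge ls\<close>.\<close>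

lemma wedge_proportional:
  fixes E :: "(complex^'n) set"
  assumes E: "vec.subspace E" and ls: "linear_coordinates E ls" and ls': "linear_coordinates E ls'"
  obtains c where "\<And>vs. set vs \<subseteq> E \<Longrightarrow> length vs = vec.dim E \<Longrightarrow> wedge ls' vs = c * wedge ls vs"
proof -
  define k where "k = vec.dim E"
  have len: "length ls = k" "length ls' = k"
    using length_linear_coordinates ls ls' by (auto simp: k_def)
  have inj: "inj_on (\<lambda>x. map (\<lambda>l. l x) ls) E"
    and im: "(\<lambda>x. map (\<lambda>l. l x) ls) ` E = {cs. length cs = k}"
    using ls by (auto simp: linear_coordinates_def bij_betw_def k_def)
  have "\<exists>x\<in>E. \<forall>j<k. (ls ! j) x = (if j = a then 1 else 0)" for a
  proof -
    have "map (\<lambda>j. if j = a then 1 else 0) [0..<k] \<in> (\<lambda>x. map (\<lambda>l. l x) ls) ` E"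
      by (simp add: im)
    then obtain x where "x \<in> E" "map (\<lambda>l. l x) ls = map (\<lambda>j. if j = a then 1 else 0) [0..<k]"
      by force
    then show ?thesis
      using len by (intro bexI[of _ x]) (auto simp: list_eq_iff_nth_eq)
  qed
  then obtain e where e: "\<And>a. e a \<in> E" "\<And>a j. j < k \<Longrightarrow> (ls ! j) (e a) = (if j = a then 1 else 0)"
    by metis
  have lin: "Vector_Spaces.linear (*s) (*) (ls ! i)" "Vector_Spaces.linear (*s) (*) (ls' ! i)"
    if "i < k" for i
    using that len ls ls' by (auto simp: linear_coordinates_def)
  have expand: "(\<Sum>a<k. (ls ! a) x *s e a) = x" if x: "x \<in> E" for x
  proof (rule inj_onD[OF inj])
    show "(\<Sum>a<k. (ls ! a) x *s e a) \<in> E"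
      using E e by (auto intro!: vec.subspace_sum vec.subspace_scale)
    have "(ls ! j) (\<Sum>a<k. (ls ! a) x *s e a) = (ls ! j) x" if "j < k" for j
    proof -
      have "(ls ! j) (\<Sum>a<k. (ls ! a) x *s e a) = (\<Sum>a<k. (ls ! a) x * (if j = a then 1 else 0))"
        using that e(2)[of j] by (simp add: linear_form_sum[OF lin(1)[OF that]])
      also have "\<dots> = (\<Sum>a<k. if j = a then (ls ! a) x else 0)" by (intro sum.cong) auto
      also have "\<dots> = (ls ! j) x" using that by simp
      finally show ?thesis .
    qed
    then show "map (\<lambda>l. l (\<Sum>a<k. (ls ! a) x *s e a)) ls = map (\<lambda>l. l x) ls"
      using len by (auto simp: list_eq_iff_nth_eq)
  qed (fact x)
  define M where "M = Matrix.mat k k (\<lambda>(i, a). (ls' ! i) (e a))"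
  show thesis
  proof
    fix vs assume vs: "set vs \<subseteq> E" "length vs = vec.dim E"
    let ?N = "Matrix.mat k k (\<lambda>(i, j). (ls ! i) (vs ! j))"
    have "(ls' ! i) (vs ! j) = (\<Sum>a<k. (ls' ! i) (e a) * (ls ! a) (vs ! j))"
      if "i < k" "j < k" for i j
    proof -
      have "vs ! j \<in> E" using vs that by (auto simp: k_def)
      from expand[OF this] have "(ls' ! i) (vs ! j) = (ls' ! i) (\<Sum>a<k. (ls ! a) (vs ! j) *s e a)"
        by simp
      also have "\<dots> = (\<Sum>a<k. (ls ! a) (vs ! j) * (ls' ! i) (e a))"
        by (rule linear_form_sum[OF lin(2)[OF that(1)]])
      finally show ?thesis by (simp add: mult.commute)
    qed
    then have "Matrix.mat k k (\<lambda>(i, j). (ls' ! i) (vs ! j)) = M * ?N"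
      by (intro eq_matI) (auto simp: M_def scalar_prod_def lessThan_atLeast0)
    then show "wedge ls' vs = Determinant.det M * wedge ls vs"
      unfolding wedge_eq_det[OF len(1)] wedge_eq_det[OF len(2)]
      by (simp add: det_mult[OF mat_carrier mat_carrier] M_def)
  qed
qed

section \<open>Jacobian forms\<close>

lemma polynomial_functions_scale:
  "f \<in> polynomial_functions \<Longrightarrow> (\<lambda>x. c * f x) \<in> polynomial_functions"
  by (intro polynomial_functions.mult polynomial_functions.const)

lemma polynomial_functions_sum:
  "(\<And>i. i \<in> I \<Longrightarrow> f i \<in> polynomial_functions) \<Longrightarrow> (\<lambda>x. \<Sum>i\<in>I. f i x) \<in> polynomial_functions"
  by (induction I rule: infinite_finite_induct)
    (auto intro: polynomial_functions.const polynomial_functions.add)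

lemma polynomial_functions_matrix:
  assumes "f \<in> polynomial_functions"
  shows "(\<lambda>x. f (m *v x)) \<in> polynomial_functions"
  using assms
proof induction
  case (coord i)
  show ?case
    unfolding matrix_vector_mult_def
    by (simp add: polynomial_functions_sum polynomial_functions_scale polynomial_functions.coord)
qed (auto intro: polynomial_functions.intros)

lemma jacobian_ideal_add:
  assumes "f \<in> jacobian_ideal V E" "g \<in> jacobian_ideal V E"
  shows "(\<lambda>x. f x + g x) \<in> jacobian_ideal V E"
proof -
  obtain S a where S: "finite S" "S \<subseteq> E" "\<forall>e\<in>S. a e \<in> polynomial_functions"
    and f: "f = (\<lambda>x. \<Sum>e\<in>S. a e x * derivative_along V e x)"
    using assms(1) unfolding jacobian_ideal_def by blast
  obtain T b where T: "finite T" "T \<subseteq> E" "\<forall>e\<in>T. b e \<in> polynomial_functions"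
    and g: "g = (\<lambda>x. \<Sum>e\<in>T. b e x * derivative_along V e x)"
    using assms(2) unfolding jacobian_ideal_def by blast
  define h where "h e x = (if e \<in> S then a e x else 0) + (if e \<in> T then b e x else 0)" for e x
  have h: "h e \<in> polynomial_functions" for e
    unfolding h_def[abs_def] using S(3) T(3)
    by (cases "e \<in> S"; cases "e \<in> T") (auto intro: polynomial_functions.intros)
  have "(\<Sum>e\<in>S \<union> T. (if e \<in> S then a e x else 0) * derivative_along V e x) = f x" for x
    unfolding f using S T by (intro sum.mono_neutral_cong_right) auto
  moreover have "(\<Sum>e\<in>S \<union> T. (if e \<in> T then b e x else 0) * derivative_along V e x) = g x" for x
    unfolding g using S T by (intro sum.mono_neutral_cong_right) auto
  ultimately have "(\<lambda>x. f x + g x) = (\<lambda>x. \<Sum>e\<in>S \<union> T. h e x * derivative_along V e x)"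
    by (simp add: h_def algebra_simps sum.distrib fun_eq_iff)
  then show ?thesis
    unfolding jacobian_ideal_def using S T h by blast
qed

lemma jacobian_ideal_mult:
  assumes "f \<in> jacobian_ideal V E" "p \<in> polynomial_functions"
  shows "(\<lambda>x. p x * f x) \<in> jacobian_ideal V E"
proof -
  obtain S a where S: "finite S" "S \<subseteq> E" "\<forall>e\<in>S. a e \<in> polynomial_functions"
    and f: "f = (\<lambda>x. \<Sum>e\<in>S. a e x * derivative_along V e x)"
    using assms(1) unfolding jacobian_ideal_def by blast
  have "(\<lambda>x. p x * f x) = (\<lambda>x. \<Sum>e\<in>S. (p x * a e x) * derivative_along V e x)"
    unfolding f by (simp add: sum_distrib_left mult.assoc)
  moreover have "\<forall>e\<in>S. (\<lambda>x. p x * a e x) \<in> polynomial_functions"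
    using S assms(2) by (auto intro: polynomial_functions.mult)
  ultimately show ?thesis
    unfolding jacobian_ideal_def using S(1,2)
    by (intro CollectI exI[of _ S] exI[of _ "\<lambda>e x. p x * a e x"]) auto
qed

lemmas jacobian_ideal_scale = jacobian_ideal_mult[OF _ polynomial_functions.const]

lemma jacobian_ideal_zero: "(\<lambda>x. 0) \<in> jacobian_ideal V E"
  unfolding jacobian_ideal_def by (intro CollectI exI[of _ "{}"]) auto

lemma jacobian_ideal_sum:
  "(\<And>i. i \<in> I \<Longrightarrow> f i \<in> jacobian_ideal V E) \<Longrightarrow> (\<lambda>x. \<Sum>i\<in>I. f i x) \<in> jacobian_ideal V E"
  by (induction I rule: infinite_finite_induct) (auto intro: jacobian_ideal_zero jacobian_ideal_add)

lemma form_on_volume_form: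
  assumes E: "vec.subspace E" and ls: "linear_coordinates E ls" and \<omega>: "\<omega> \<in> volume_forms E"
  obtains c where "\<And>f. form_on E f \<omega> = form_on E (\<lambda>x. c * f x) (wedge ls)"
proof -
  obtain ls' where \<omega>': "\<omega> = wedge ls'" and ls': "linear_coordinates E ls'"
    using \<omega> by (auto simp: volume_forms_def)
  obtain c where "\<And>vs. set vs \<subseteq> E \<Longrightarrow> length vs = vec.dim E \<Longrightarrow> wedge ls' vs = c * wedge ls vs"
    using wedge_proportional[OF E ls ls'] by blast
  then have "form_on E f \<omega> = form_on E (\<lambda>x. c * f x) (wedge ls)" for f
    by (auto simp: form_on_def \<omega>' fun_eq_iff)
  then show thesis by (rule that)
qed

text \<open>One system of coordinates on \<open>E\<close> is enough to write all forms of top degree.\<close>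

lemma top_forms_eq:
  assumes E: "vec.subspace E" and ls: "linear_coordinates E ls"
  shows "top_forms E = {form_on E f (wedge ls) | f. f \<in> polynomial_functions}"
proof (intro subset_antisym subsetI)
  fix \<eta> assume "\<eta> \<in> top_forms E"
  then obtain f \<omega> where \<eta>: "\<eta> = form_on E f \<omega>" "f \<in> polynomial_functions" and \<omega>: "\<omega> \<in> volume_forms E"
    unfolding top_forms_def by blast
  obtain c where "form_on E f \<omega> = form_on E (\<lambda>x. c * f x) (wedge ls)"
    using form_on_volume_form[OF E ls \<omega>] by metis
  moreover have "(\<lambda>x. c * f x) \<in> polynomial_functions"
    using \<eta>(2) by (rule polynomial_functions_scale)
  ultimately show "\<eta> \<in> {form_on E f (wedge ls) | f. f \<in> polynomial_functions}"
    using \<eta>(1) by blast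
next
  fix \<eta> assume "\<eta> \<in> {form_on E f (wedge ls) | f. f \<in> polynomial_functions}"
  moreover have "wedge ls \<in> volume_forms E"
    using ls unfolding volume_forms_def by blast
  ultimately show "\<eta> \<in> top_forms E"
    unfolding top_forms_def by blast
qed

lemma jacobian_forms_eq:
  assumes E: "vec.subspace E" and ls: "linear_coordinates E ls"
  shows "jacobian_forms V E = {form_on E f (wedge ls) | f. f \<in> jacobian_ideal V E}"
proof (intro subset_antisym subsetI)
  fix \<eta> assume "\<eta> \<in> jacobian_forms V E"
  then obtain f \<omega> where \<eta>: "\<eta> = form_on E f \<omega>" "f \<in> jacobian_ideal V E" and \<omega>: "\<omega> \<in> volume_forms E"
    unfolding jacobian_forms_def by blast
  obtain c where "form_on E f \<omega> = form_on E (\<lambda>x. c * f x) (wedge ls)"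
    using form_on_volume_form[OF E ls \<omega>] by metis
  moreover have "(\<lambda>x. c * f x) \<in> jacobian_ideal V E"
    using \<eta>(2) by (rule jacobian_ideal_scale)
  ultimately show "\<eta> \<in> {form_on E f (wedge ls) | f. f \<in> jacobian_ideal V E}"
    using \<eta>(1) by blast
next
  fix \<eta> assume "\<eta> \<in> {form_on E f (wedge ls) | f. f \<in> jacobian_ideal V E}"
  moreover have "wedge ls \<in> volume_forms E"
    using ls unfolding volume_forms_def by blast
  ultimately show "\<eta> \<in> jacobian_forms V E"
    unfolding jacobian_forms_def by blast
qed

lemma form_on_add: "form_on E f \<omega> + form_on E g \<omega> = form_on E (\<lambda>x. f x + g x) \<omega>"
  by (auto simp: form_on_def fun_eq_iff algebra_simps)

lemma form_on_scale: "(\<lambda>x vs. c * form_on E f \<omega> x vs) = form_on E (\<lambda>x. c * f x) \<omega>"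
  by (auto simp: form_on_def fun_eq_iff algebra_simps)

lemma form_on_zero: "form_on E (\<lambda>x. 0) \<omega> = 0"
  by (auto simp: form_on_def fun_eq_iff)

lemma zero_jacobian_form:
  assumes "vec.subspace E"
  shows "0 \<in> jacobian_forms V E"
proof -
  obtain ls where ls: "linear_coordinates E ls" using ex_linear_coordinates assms by blast
  have "form_on E (\<lambda>x. 0) (wedge ls) \<in> jacobian_forms V E"
    unfolding jacobian_forms_eq[OF assms ls] using jacobian_ideal_zero by blast
  then show ?thesis by (simp add: form_on_zero)
qed

lemma zero_top_form:
  assumes "vec.subspace E"
  shows "0 \<in> top_forms E"
proof -
  obtain ls where ls: "linear_coordinates E ls" using ex_linear_coordinates assms by blast
  have "form_on E (\<lambda>x. 0) (wedge ls) \<in> top_forms E"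
    unfolding top_forms_eq[OF assms ls] using polynomial_functions.const[of 0] by blast
  then show ?thesis by (simp add: form_on_zero)
qed

text \<open>Two forms in \<open>jacobian_forms V E\<close> may be written with different volume forms, so closure under
  addition depends on \<open>jacobian_forms_eq\<close>.\<close>

lemma jacobian_forms_add:
  assumes "vec.subspace E" "\<eta> \<in> jacobian_forms V E" "\<theta> \<in> jacobian_forms V E"
  shows "\<eta> + \<theta> \<in> jacobian_forms V E"
proof -
  obtain ls where ls: "linear_coordinates E ls" using ex_linear_coordinates assms(1) by blast
  show ?thesis
    using assms unfolding jacobian_forms_eq[OF assms(1) ls]
    by (auto simp: form_on_add intro: jacobian_ideal_add)
qed

lemma jacobian_forms_scale:
  assumes "vec.subspace E" "\<eta> \<in> jacobian_forms V E"
  shows "(\<lambda>x vs. c * \<eta> x vs) \<in> jacobian_forms V E"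
proof -
  obtain ls where ls: "linear_coordinates E ls" using ex_linear_coordinates assms(1) by blast
  show ?thesis
    using assms unfolding jacobian_forms_eq[OF assms(1) ls]
    by (auto simp: form_on_scale intro: jacobian_ideal_scale)
qed

lemma jacobian_forms_plus:
  assumes "vec.subspace E"
  shows "jacobian_forms V E + jacobian_forms V E = jacobian_forms V E"
proof
  show "jacobian_forms V E + jacobian_forms V E \<subseteq> jacobian_forms V E"
    using assms jacobian_forms_add by (auto elim!: set_plus_elim)
  show "jacobian_forms V E \<subseteq> jacobian_forms V E + jacobian_forms V E"
    using zero_jacobian_form[OF assms] set_zero_plus2 by blast
qed

lemma coset_plus:
  assumes "vec.subspace E"
  shows "(\<eta> +o jacobian_forms V E) + (\<theta> +o jacobian_forms V E) = (\<eta> + \<theta>) +o jacobian_forms V E"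
  by (simp add: set_plus_rearrange jacobian_forms_plus[OF assms])

lemma coset_scale:
  fixes \<eta> :: "('n::finite) form"
  assumes "vec.subspace E"
  shows "(\<lambda>\<eta> x vs. c * \<eta> x vs) ` (\<eta> +o jacobian_forms V E) + jacobian_forms V E
    = (\<lambda>x vs. c * \<eta> x vs) +o jacobian_forms V E"
proof -
  let ?J = "jacobian_forms V E"
  define m :: "'n form \<Rightarrow> 'n form" where "m = (\<lambda>\<eta> x vs. c * \<eta> x vs)"
  have m_add: "m (\<theta> + \<zeta>) = m \<theta> + m \<zeta>" for \<theta> \<zeta>
    by (simp add: m_def fun_eq_iff algebra_simps)
  have m_zero: "m 0 = 0"
    by (simp add: m_def fun_eq_iff)
  have m_jacobian: "m \<theta> \<in> ?J" if "\<theta> \<in> ?J" for \<theta>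
    unfolding m_def by (rule jacobian_forms_scale[OF assms that])
  have "m ` (\<eta> +o ?J) = (\<lambda>\<theta>. m (\<eta> + \<theta>)) ` ?J"
    by (auto simp: elt_set_plus_def image_iff)
  also have "\<dots> = m \<eta> +o m ` ?J"
    by (auto simp: elt_set_plus_def image_iff m_add)
  finally have "m ` (\<eta> +o ?J) = m \<eta> +o m ` ?J" .
  moreover have "m ` ?J + ?J = ?J"
  proof
    have "m ` ?J \<subseteq> ?J" using m_jacobian by blast
    then have "m ` ?J + ?J \<subseteq> ?J + ?J" by (rule set_plus_mono2) simp
    then show "m ` ?J + ?J \<subseteq> ?J" by (simp only: jacobian_forms_plus[OF assms])
    have "0 \<in> m ` ?J"
      using imageI[OF zero_jacobian_form[OF assms], of m] by (simp only: m_zero)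
    then show "?J \<subseteq> m ` ?J + ?J" by (rule set_zero_plus2)
  qed
  ultimately have "m ` (\<eta> +o ?J) + ?J = m \<eta> +o ?J"
    by (simp only: set_plus_rearrange3)
  then show ?thesis unfolding m_def .
qed

lemma coset_eq_iff:
  assumes "vec.subspace E"
  shows "\<eta> +o jacobian_forms V E = \<theta> +o jacobian_forms V E \<longleftrightarrow> \<eta> - \<theta> \<in> jacobian_forms V E"
proof -
  let ?J = "jacobian_forms V E"
  have le: "a +o ?J \<subseteq> b +o ?J" if "a - b \<in> ?J" for a b
  proof
    fix x assume "x \<in> a +o ?J"
    then have "(x - a) + (a - b) \<in> ?J"
      unfolding set_minus_plus[symmetric] using jacobian_forms_add[OF assms] that by blast
    then show "x \<in> b +o ?J"
      unfolding set_minus_plus[symmetric] by simp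
  qed
  have "\<theta> - \<eta> \<in> ?J" if "\<eta> - \<theta> \<in> ?J"
  proof -
    have eq: "(\<lambda>x vs. (-1) * (\<eta> - \<theta>) x vs) = \<theta> - \<eta>" by (simp add: fun_eq_iff)
    show ?thesis
      using jacobian_forms_scale[OF assms that, of "-1"] by (simp only: eq)
  qed
  then have "\<eta> +o ?J = \<theta> +o ?J" if "\<eta> - \<theta> \<in> ?J"
    using le[OF that] le[of \<theta> \<eta>] that by (intro subset_antisym) simp_all
  moreover have "\<eta> - \<theta> \<in> ?J" if "\<eta> +o ?J = \<theta> +o ?J"
  proof -
    have "\<eta> \<in> \<eta> +o ?J"
      using zero_jacobian_form[OF assms] unfolding set_minus_plus[symmetric] by simp
    then show ?thesis
      unfolding that set_minus_plus[symmetric] .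
  qed
  ultimately show ?thesis by (rule iffI[rotated])
qed

section \<open>Pulling back along linear automorphisms\<close>

lemma pullback_mult: "pullback (a ** b) \<eta> = pullback b (pullback a \<eta>)"
  by (simp add: pullback_def matrix_vector_mul_assoc[symmetric] o_def)

lemma pullback_one: "pullback (mat 1) \<eta> = \<eta>"
  by (simp add: pullback_def)

lemma inj_invertible: "invertible m \<Longrightarrow> inj_on ((*v) (m :: complex^'n^'n)) S"
  using inj_matrix_vector_mult inj_on_subset by blast

lemma wedge_map_matrix:
  assumes "length vs = length ls"
  shows "wedge ls (map ((*v) m) vs) = wedge (map (\<lambda>l x. l (m *v x)) ls) vs"
  unfolding wedge_def using assms
  by (auto intro!: sum.cong prod.cong simp: permutes_in_image)
    (metis lessThan_iff nth_map permutes_in_image)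

lemma linear_coordinates_matrix:
  fixes m :: "complex^'n^'n"
  assumes m: "invertible m" and ls: "linear_coordinates ((*v) m ` E) ls"
  shows "linear_coordinates E (map (\<lambda>l x. l (m *v x)) ls)"
proof -
  have dim: "vec.dim ((*v) m ` E) = vec.dim E"
    using m by (intro vec.dim_image_eq matrix_vector_mul_linear_gen inj_invertible)
  have "bij_betw ((*v) m) E ((*v) m ` E)"
    using inj_invertible[OF m] by (simp add: bij_betw_def)
  then have "bij_betw ((\<lambda>x. map (\<lambda>l. l x) ls) \<circ> (*v) m) E {cs. length cs = vec.dim E}"
    using ls unfolding linear_coordinates_def dim by (blast intro: bij_betw_trans)
  moreover have "Vector_Spaces.linear (*s) (*) (\<lambda>x. l (m *v x))" if "l \<in> set ls" for l
    using that ls Vector_Spaces.linear_compose[OF matrix_vector_mul_linear_gen, of "(*)" l m]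
    by (auto simp: linear_coordinates_def o_def)
  ultimately show ?thesis
    by (auto simp: linear_coordinates_def o_def)
qed

lemma pullback_form_on:
  fixes m :: "complex^'n^'n"
  assumes m: "invertible m" and ls: "linear_coordinates ((*v) m ` E) ls"
  shows "pullback m (form_on ((*v) m ` E) f (wedge ls))
    = form_on E (\<lambda>x. f (m *v x)) (wedge (map (\<lambda>l x. l (m *v x)) ls))"
proof -
  have dim: "vec.dim ((*v) m ` E) = vec.dim E"
    using m by (intro vec.dim_image_eq matrix_vector_mul_linear_gen inj_invertible)
  have mem: "m *v x \<in> (*v) m ` E \<longleftrightarrow> x \<in> E" for x
    using inj_invertible[OF m, of UNIV] by (auto dest: injD)
  have "(*v) m ` set vs \<subseteq> (*v) m ` E \<longleftrightarrow> set vs \<subseteq> E" for vs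
    using inj_invertible[OF m, of UNIV] by (simp add: inj_image_subset_iff)
  then show ?thesis
    using wedge_map_matrix[of _ ls m] length_linear_coordinates[OF ls]
    by (auto simp: pullback_def form_on_def fun_eq_iff mem dim)
qed

text \<open>The chain rule for a linear symmetry of \<open>V\<close>.\<close>

lemma derivative_along_matrix:
  assumes "\<And>x. V (m *v x) = V x"
  shows "derivative_along V (m *v e) (m *v x) = derivative_along V e x"
proof -
  have "V (m *v x + t *s (m *v e)) = V (x + t *s e)" for t
    using assms[of "x + t *s e"] by (simp add: matrix_vector_right_distrib vector_scalar_commute)
  then show ?thesis by (simp add: derivative_along_def)
qed

lemma jacobian_ideal_matrix:
  fixes m :: "complex^'n^'n"
  assumes m: "invertible m" and V: "\<And>x. V (m *v x) = V x"
    and f: "f \<in> jacobian_ideal V ((*v) m ` E)"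
  shows "(\<lambda>x. f (m *v x)) \<in> jacobian_ideal V E"
proof -
  obtain S a where S: "finite S" "S \<subseteq> (*v) m ` E" "\<forall>e\<in>S. a e \<in> polynomial_functions"
    and f: "f = (\<lambda>x. \<Sum>e\<in>S. a e x * derivative_along V e x)"
    using f unfolding jacobian_ideal_def by blast
  obtain T where T: "T \<subseteq> E" "finite T" "S = (*v) m ` T"
    using finite_subset_image[OF S(1,2)] by blast
  have "f (m *v x) = (\<Sum>e\<in>T. a (m *v e) (m *v x) * derivative_along V e x)" for x
    unfolding f T(3) by (simp add: sum.reindex[OF inj_invertible[OF m]] derivative_along_matrix[of V m] V)
  moreover have "\<forall>e\<in>T. (\<lambda>x. a (m *v e) (m *v x)) \<in> polynomial_functions"
    using S(3) T by (auto intro: polynomial_functions_matrix)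
  ultimately show ?thesis
    unfolding jacobian_ideal_def using T
    by (intro CollectI exI[of _ T] exI[of _ "\<lambda>e x. a (m *v e) (m *v x)"]) auto
qed

lemma subspace_matrix_image:
  "vec.subspace E \<Longrightarrow> vec.subspace ((*v) (m :: complex^'n^'n) ` E)"
  by (rule vec.linear_subspace_image[OF matrix_vector_mul_linear_gen])

lemma pullback_jacobian_forms_subset:
  fixes m :: "complex^'n^'n"
  assumes m: "invertible m" and V: "\<And>x. V (m *v x) = V x" and E: "vec.subspace E"
  shows "pullback m ` jacobian_forms V ((*v) m ` E) \<subseteq> jacobian_forms V E"
proof -
  obtain ls where ls: "linear_coordinates ((*v) m ` E) ls"
    using ex_linear_coordinates subspace_matrix_image[OF E] by blast
  show ?thesis
    unfolding jacobian_forms_eq[OF subspace_matrix_image[OF E] ls]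
      jacobian_forms_eq[OF E linear_coordinates_matrix[OF m ls]]
    using jacobian_ideal_matrix[of m V _ E] m V by (auto simp: pullback_form_on[OF m ls])
qed

text \<open>One inclusion is the chain rule; the other one is the same inclusion for the inverse of \<open>m\<close>.\<close>

lemma pullback_jacobian_forms:
  fixes m :: "complex^'n^'n"
  assumes m: "invertible m" and V: "\<And>x. V (m *v x) = V x" and E: "vec.subspace E"
  shows "pullback m ` jacobian_forms V ((*v) m ` E) = jacobian_forms V E"
proof
  show "pullback m ` jacobian_forms V ((*v) m ` E) \<subseteq> jacobian_forms V E"
    using assms by (rule pullback_jacobian_forms_subset)
next
  obtain m' where m': "m ** m' = mat 1" "m' ** m = mat 1"
    using m by (auto simp: invertible_def)
  have "V (m' *v x) = V x" for x
    using V[of "m' *v x"] by (simp add: matrix_vector_mul_assoc m')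
  moreover have "invertible m'" using m' by (auto simp: invertible_def)
  moreover have "(*v) m' ` (*v) m ` E = E"
    by (simp add: image_image matrix_vector_mul_assoc m')
  ultimately have sub: "pullback m' ` jacobian_forms V E \<subseteq> jacobian_forms V ((*v) m ` E)"
    using pullback_jacobian_forms_subset[of m' V "(*v) m ` E"] subspace_matrix_image[OF E] by simp
  show "jacobian_forms V E \<subseteq> pullback m ` jacobian_forms V ((*v) m ` E)"
  proof
    fix \<eta> assume "\<eta> \<in> jacobian_forms V E"
    moreover have "pullback m (pullback m' \<eta>) = \<eta>"
      by (simp add: pullback_mult[symmetric] m' pullback_one)
    ultimately show "\<eta> \<in> pullback m ` jacobian_forms V ((*v) m ` E)"
      using sub by (metis image_eqI image_subset_iff)
  qed
qed

lemma subspace_fixed_space: "vec.subspace (fixed_space g)"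
  by (auto simp: vec.subspace_def fixed_space_def matrix_vector_right_distrib vector_scalar_commute)

lemma matrix_inv:
  fixes m :: "complex^'n^'n"
  assumes "invertible m"
  shows "m ** matrix_inv m = mat 1" "matrix_inv m ** m = mat 1"
  using assms unfolding invertible_def matrix_inv_def by (metis (mono_tags, lifting) someI_ex)+

lemma invertible_matrix_inv: "invertible m \<Longrightarrow> invertible (matrix_inv (m :: complex^'n^'n))"
  using matrix_inv[of m] by (auto simp: invertible_def)

lemma fixed_space_conjugate:
  fixes m :: "complex^'n^'n"
  assumes m: "invertible m"
  shows "fixed_space (matrix_inv m ** g ** m) = (*v) (matrix_inv m) ` fixed_space g"
proof (intro subset_antisym subsetI)
  fix x assume "x \<in> fixed_space (matrix_inv m ** g ** m)"
  then have "matrix_inv m *v (g *v (m *v x)) = x"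
    by (simp add: fixed_space_def matrix_vector_mul_assoc matrix_mul_assoc)
  then have "m *v (matrix_inv m *v (g *v (m *v x))) = m *v x" by simp
  then have "g *v (m *v x) = m *v x"
    by (simp only: matrix_vector_mul_assoc matrix_mul_assoc) (simp add: matrix_inv[OF m])
  moreover have "x = matrix_inv m *v (m *v x)"
    by (simp add: matrix_vector_mul_assoc matrix_inv[OF m])
  ultimately show "x \<in> (*v) (matrix_inv m) ` fixed_space g"
    by (auto simp: fixed_space_def)
next
  fix x assume "x \<in> (*v) (matrix_inv m) ` fixed_space g"
  then obtain y where y: "g *v y = y" "x = matrix_inv m *v y"
    by (auto simp: fixed_space_def)
  have "m *v x = y"
    unfolding y by (simp add: matrix_vector_mul_assoc matrix_inv[OF m])
  then show "x \<in> fixed_space (matrix_inv m ** g ** m)"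
    by (simp add: fixed_space_def y flip: matrix_vector_mul_assoc)
qed

text \<open>The action sends zero classes to zero classes, including those of the sectors in which a state of
  interest has no other component.\<close>

lemma pullback_zero_class:
  fixes m :: "complex^'n^'n"
  assumes m: "invertible m" and V: "\<And>x. V (m *v x) = V x"
  shows "pullback (matrix_inv m) ` jacobian_forms V (fixed_space (matrix_inv m ** g ** m))
    = jacobian_forms V (fixed_space g)"
proof -
  have "V (matrix_inv m *v x) = V x" for x
    using V[of "matrix_inv m *v x"] by (simp add: matrix_vector_mul_assoc matrix_inv[OF m])
  then show ?thesis
    unfolding fixed_space_conjugate[OF m]
    by (intro pullback_jacobian_forms invertible_matrix_inv m subspace_fixed_space)
qed

section \<open>The standard volume form\<close>

definition enumeration :: "nat \<Rightarrow> 'n::finite" where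
  "enumeration = (SOME e. bij_betw e {..<CARD('n)} UNIV)"

lemma bij_enumeration: "bij_betw (enumeration :: nat \<Rightarrow> 'n::finite) {..<CARD('n)} UNIV"
proof -
  obtain e :: "nat \<Rightarrow> 'n" where "bij_betw e {0..<CARD('n)} UNIV"
    using ex_bij_betw_nat_finite[OF finite_class.finite_UNIV] by blast
  then show ?thesis
    unfolding enumeration_def atLeast0LessThan
    by (rule someI[of "\<lambda>e. bij_betw e {..<CARD('n)} UNIV"])
qed

definition coordinates :: "(complex^'n \<Rightarrow> complex) list" where
  "coordinates = map (\<lambda>i x. x $ enumeration i) [0..<CARD('n)]"

lemma length_coordinates [simp]: "length (coordinates :: (complex^'n \<Rightarrow> complex) list) = CARD('n)"
  by (simp add: coordinates_def)

lemma linear_coordinates_UNIV: "linear_coordinates (UNIV :: (complex^'n) set) coordinates"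
proof -
  have lin: "Vector_Spaces.linear (*s) (*) (\<lambda>x :: complex^'n. x $ i)" for i
    unfolding Vector_Spaces.linear_iff
    by (intro conjI allI vec.vector_space_axioms vector_space_over_itself.vector_space_axioms
        vector_add_component vector_smult_component)
  have "bij_betw (\<lambda>x :: complex^'n. map (\<lambda>l. l x) coordinates) UNIV {cs. length cs = CARD('n)}"
  proof (intro bij_betw_imageI)
    show "inj (\<lambda>x :: complex^'n. map (\<lambda>l. l x) coordinates)"
    proof
      fix x y :: "complex^'n"
      assume "map (\<lambda>l. l x) coordinates = map (\<lambda>l. l y) coordinates"
      then have "x $ enumeration i = y $ enumeration i" if "i < CARD('n)" for i
        using that by (auto simp: coordinates_def)
      moreover have "\<exists>i<CARD('n). enumeration i = a" for a :: 'n
      proof -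
        have "a \<in> enumeration ` {..<CARD('n)}"
          by (simp add: bij_betw_imp_surj_on[OF bij_enumeration])
        then show ?thesis by blast
      qed
      ultimately show "x = y" by (metis vec_eq_iff)
    qed
    show "range (\<lambda>x :: complex^'n. map (\<lambda>l. l x) coordinates) = {cs. length cs = CARD('n)}"
    proof (intro subset_antisym subsetI)
      fix cs :: "complex list" assume "cs \<in> {cs. length cs = CARD('n)}"
      then have cs: "length cs = CARD('n)" by simp
      define x :: "complex^'n" where "x = (\<chi> a. cs ! inv_into {..<CARD('n)} enumeration a)"
      have "x $ enumeration i = cs ! i" if "i < CARD('n)" for i
        using bij_betw_inv_into_left[OF bij_enumeration[where 'n='n], of i] that by (simp add: x_def)
      then have "map (\<lambda>l. l x) coordinates = cs"
        using cs by (simp add: coordinates_def list_eq_iff_nth_eq)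
      then show "cs \<in> range (\<lambda>x :: complex^'n. map (\<lambda>l. l x) coordinates)" by blast
    qed auto
  qed
  moreover have "\<forall>l\<in>set (coordinates :: (complex^'n \<Rightarrow> complex) list). Vector_Spaces.linear (*s) (*) l"
    using lin by (auto simp: coordinates_def)
  ultimately show ?thesis
    unfolding linear_coordinates_def vec_dim_card by blast
qed

text \<open>The permutations of the positions in a list and of the index type \<open>'n\<close> correspond along
  \<open>enumeration\<close> with the same sign. The determinant over \<open>'n\<close> then makes pulling back along a matrix
  multiplication by its determinant.\<close>

lemma wedge_coordinates_eq_det:
  fixes vs :: "(complex^'n) list"
  shows "wedge coordinates vs
    = det (\<chi> a b. vs ! inv_into {..<CARD('n)} enumeration b $ a)"
proof -
  let ?N = "CARD('n)"
  let ?e = "enumeration :: nat \<Rightarrow> 'n"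
  let ?e' = "inv_into {..<?N} ?e"
  have e: "bij_betw ?e {..<?N} UNIV" by (rule bij_enumeration)
  have e': "bij_betw ?e' UNIV {..<?N}" by (rule bij_betw_inv_into[OF e])
  have e'e: "?e' (?e i) = i" if "i < ?N" for i
    using bij_betw_inv_into_left[OF e] that by simp
  have ee': "?e (?e' a) = a" for a
    using bij_betw_inv_into_right[OF e] by simp
  have inj: "inj_on ?e {..<?N}" using e by (rule bij_betw_imp_inj_on)
  have "wedge (coordinates :: (complex^'n \<Rightarrow> complex) list) vs
      = (\<Sum>p | p permutes {..<?N}. of_int (sign p) * (\<Prod>i<?N. vs ! p i $ ?e i))"
    unfolding wedge_def by (simp add: coordinates_def)
  also have "\<dots> = (\<Sum>p | p permutes (UNIV :: 'n set). of_int (sign p) * (\<Prod>a\<in>UNIV. vs ! ?e' (p a) $ a))"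
  proof (rule sum.reindex_bij_witness[where j = "map_permutation {..<?N} ?e" and i = "map_permutation UNIV ?e'"])
    fix p assume p: "p \<in> {p. p permutes {..<?N}}"
    show "map_permutation UNIV ?e' (map_permutation {..<?N} ?e p) = p"
      using p e e'e by (intro map_permutation_compose_inv) auto
    show "map_permutation {..<?N} ?e p \<in> {p. p permutes UNIV}"
      using p e by (auto intro: map_permutation_permutes)
    have "(\<Prod>a\<in>UNIV. vs ! ?e' (map_permutation {..<?N} ?e p a) $ a)
        = (\<Prod>i<?N. vs ! ?e' (map_permutation {..<?N} ?e p (?e i)) $ ?e i)"
      using prod.reindex_bij_betw[OF e, of "\<lambda>a. vs ! ?e' (map_permutation {..<?N} ?e p a) $ a"] by simp
    also have "\<dots> = (\<Prod>i<?N. vs ! p i $ ?e i)"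
    proof (rule prod.cong)
      fix i assume i: "i \<in> {..<?N}"
      then have "p i < ?N" using p permutes_in_image by fastforce
      then show "vs ! ?e' (map_permutation {..<?N} ?e p (?e i)) $ ?e i = vs ! p i $ ?e i"
        using i by (simp add: map_permutation_apply[OF inj] e'e)
    qed simp
    finally show "of_int (sign (map_permutation {..<?N} ?e p)) *
        (\<Prod>a\<in>UNIV. vs ! ?e' (map_permutation {..<?N} ?e p a) $ a)
      = of_int (sign p) * (\<Prod>i<?N. vs ! p i $ ?e i)"
      using p by (simp add: sign_map_permutation[OF inj])
  next
    fix p :: "'n \<Rightarrow> 'n" assume p: "p \<in> {p. p permutes UNIV}"
    show "map_permutation {..<?N} ?e (map_permutation UNIV ?e' p) = p"
      using p e' ee' by (intro map_permutation_compose_inv) auto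
    show "map_permutation UNIV ?e' p \<in> {p. p permutes {..<?N}}"
      using p e' by (auto intro: map_permutation_permutes)
  qed
  also have "\<dots> = det (\<chi> a b. vs ! ?e' b $ a)"
    by (simp add: Determinants.det_def)
  finally show ?thesis .
qed

lemma wedge_coordinates_matrix:
  fixes vs :: "(complex^'n) list"
  assumes "length vs = CARD('n)"
  shows "wedge coordinates (map ((*v) m) vs) = det m * wedge coordinates vs"
proof -
  let ?e' = "inv_into {..<CARD('n)} enumeration :: 'n \<Rightarrow> nat"
  have "?e' b < CARD('n)" for b
    using bij_betw_inv_into[OF bij_enumeration[where 'n='n]] by (metis UNIV_I bij_betwE lessThan_iff)
  then have "(\<chi> a b. map ((*v) m) vs ! ?e' b $ a) = m ** (\<chi> a b. vs ! ?e' b $ a)"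
    using assms by (simp add: vec_eq_iff matrix_matrix_mult_def matrix_vector_mult_def)
  then show ?thesis
    by (simp add: wedge_coordinates_eq_det det_mul)
qed

lemma wedge_coordinates_axes:
  obtains vs :: "(complex^'n) list" where "length vs = CARD('n)" "wedge coordinates vs = 1"
proof
  let ?vs = "map (\<lambda>i. axis (enumeration i) 1) [0..<CARD('n)] :: (complex^'n) list"
  show "length ?vs = CARD('n)" by simp
  have "(\<chi> a b. ?vs ! inv_into {..<CARD('n)} enumeration b $ a) = (mat 1 :: complex^'n^'n)"
    using bij_betw_inv_into[OF bij_enumeration[where 'n='n], THEN bij_betwE]
      bij_betw_inv_into_right[OF bij_enumeration[where 'n='n]]
    by (auto simp: vec_eq_iff mat_def axis_def)
  then show "wedge coordinates ?vs = 1"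
    unfolding wedge_coordinates_eq_det by simp
qed

definition volume :: "(complex^'n \<Rightarrow> complex) \<Rightarrow> 'n form" where
  "volume f = form_on UNIV f (wedge coordinates)"

lemma volume_eq_iff: "volume f = volume g \<longleftrightarrow> f = (g :: complex^'n \<Rightarrow> complex)"
proof
  assume eq: "volume f = volume g"
  obtain vs :: "(complex^'n) list" where vs: "length vs = CARD('n)" "wedge coordinates vs = 1"
    by (rule wedge_coordinates_axes)
  have "f x = g x" for x
    using fun_cong[OF fun_cong[OF eq, of x], of vs] vs
    by (simp add: volume_def form_on_def vec_dim_card del: vec.dim_UNIV)
  then show "f = g" by blast
qed simp

lemma pullback_volume: "pullback m (volume f) = volume (\<lambda>x. det m * f (m *v x))"
  using wedge_coordinates_matrix[of _ m]
  by (auto simp: pullback_def volume_def form_on_def vec_dim_card fun_eq_iff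
      simp del: vec.dim_UNIV)

lemma top_forms_UNIV: "top_forms (UNIV :: (complex^'n) set) = volume ` polynomial_functions"
  using top_forms_eq[OF vec.subspace_UNIV linear_coordinates_UNIV] by (auto simp: volume_def)

lemma jacobian_forms_UNIV: "jacobian_forms V (UNIV :: (complex^'n) set) = volume ` jacobian_ideal V UNIV"
  using jacobian_forms_eq[OF vec.subspace_UNIV linear_coordinates_UNIV] by (auto simp: volume_def)

lemma volume_add: "volume f + volume g = volume (\<lambda>x. f x + g x)"
  by (simp add: volume_def form_on_add)

lemma volume_diff: "volume f - volume g = volume (\<lambda>x. f x - g x)"
  by (auto simp: volume_def form_on_def fun_eq_iff algebra_simps)

lemma volume_scale: "(\<lambda>x vs. c * volume f x vs) = volume (\<lambda>x. c * f x)"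
  by (simp add: volume_def form_on_scale)

section \<open>Sums over roots of unity\<close>

lemma cis_eq_one_iff: "cis a = 1 \<longleftrightarrow> (\<exists>m::int. a = 2 * pi * of_int m)"
  unfolding cis_conv_exp exp_eq_1 by (auto simp: mult_ac)

lemma cis_two_pi_div_eq_one_iff:
  assumes "d > 0"
  shows "cis (2 * pi * of_int n / of_nat d) = 1 \<longleftrightarrow> int d dvd n"
proof -
  have "2 * pi * of_int n / of_nat d = 2 * pi * of_int m \<longleftrightarrow> n = int d * m" for m
  proof -
    have "2 * pi * of_int n / of_nat d = 2 * pi * of_int m \<longleftrightarrow> (of_int n :: real) = of_int (int d * m)"
      using assms by (simp add: field_simps)
    then show ?thesis by (simp only: of_int_eq_iff)
  qed
  then show ?thesis unfolding cis_eq_one_iff dvd_def by blast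
qed

lemma sum_roots_of_unity:
  assumes "d > 0"
  shows "(\<Sum>k<d. cis (2 * pi * of_int (int k * n) / of_nat d)) = (if int d dvd n then of_nat d else 0)"
proof -
  define z where "z = cis (2 * pi * of_int n / of_nat d)"
  have pow: "cis (2 * pi * of_int (int k * n) / of_nat d) = z ^ k" for k
    by (simp add: z_def Complex.DeMoivre mult_ac)
  show ?thesis
  proof (cases "int d dvd n")
    case True
    then have "z = 1" using assms by (simp add: z_def cis_two_pi_div_eq_one_iff)
    then show ?thesis using True unfolding pow by simp
  next
    case False
    then have "z \<noteq> 1" using assms by (simp add: z_def cis_two_pi_div_eq_one_iff)
    moreover have "z ^ d = 1"
      unfolding pow[symmetric] using assms by (subst cis_two_pi_div_eq_one_iff) auto
    ultimately show ?thesis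
      using False geometric_sum[of z d] unfolding pow by simp
  qed
qed

text \<open>Orthogonality of the characters of $\prod_i \mathbb{Z}/d_i$. It serves twice: to separate the monomials,
  and to prove that the double dual of a group of diagonal symmetries is the group itself.\<close>

lemma sum_characters:
  fixes d :: "'n::finite \<Rightarrow> nat"
  assumes "\<And>i. d i > 0"
  shows "(\<Sum>k | \<forall>i. k i < d i. \<Prod>i\<in>UNIV. cis (2 * pi * of_int (int (k i) * n i) / of_nat (d i)))
    = (if \<forall>i. int (d i) dvd n i then of_nat (\<Prod>i\<in>UNIV. d i) else 0)"
proof -
  have "{k. \<forall>i. k i < d i} = Pi\<^sub>E UNIV (\<lambda>i. {..<d i})"
    by (auto simp: PiE_UNIV_domain)
  then have "(\<Sum>k | \<forall>i. k i < d i. \<Prod>i\<in>UNIV. cis (2 * pi * of_int (int (k i) * n i) / of_nat (d i)))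
      = (\<Prod>i\<in>UNIV. \<Sum>k<d i. cis (2 * pi * of_int (int k * n i) / of_nat (d i)))"
    by (subst prod_sum_PiE) simp_all
  also have "\<dots> = (\<Prod>i\<in>UNIV. if int (d i) dvd n i then of_nat (d i) else 0)"
    by (simp only: sum_roots_of_unity[OF assms])
  also have "\<dots> = (if \<forall>i. int (d i) dvd n i then of_nat (\<Prod>i\<in>UNIV. d i) else 0)"
    by auto
  finally show ?thesis .
qed

section \<open>Coefficients of polynomial functions\<close>

definition monomial :: "('n::finite \<Rightarrow> nat) \<Rightarrow> complex^'n \<Rightarrow> complex" where
  "monomial b x = (\<Prod>i\<in>UNIV. x $ i ^ b i)"

text \<open>Averaging against a character over the vectors of \<open>M\<close>-th roots of unity isolates a single
  coefficient once \<open>M\<close> exceeds all exponents that occur.\<close>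

lemma monomial_unique:
  fixes c :: "('n::finite \<Rightarrow> nat) \<Rightarrow> complex"
  assumes S: "finite S" and zero: "\<And>x. (\<Sum>m\<in>S. c m * monomial m x) = 0" and b: "b \<in> S"
  shows "c b = 0"
proof -
  have "finite ((\<lambda>(m, i). m i) ` (S \<times> (UNIV :: 'n set)))" using S by simp
  then obtain M where M: "\<forall>n \<in> (\<lambda>(m, i). m i) ` (S \<times> (UNIV :: 'n set)). n < M"
    unfolding finite_nat_set_iff_bounded by blast
  \<comment> \<open>Exponents below \<open>M\<close> that are congruent modulo \<open>M\<close> are equal.\<close>
  then have less: "m i < M" if "m \<in> S" for m i using that by force
  then have M0: "M > 0" using b by fastforce
  let ?K = "{k :: 'n \<Rightarrow> nat. \<forall>i. k i < M}"
  let ?e = "\<lambda>k n. cis (2 * pi * of_int (int k * n) / of_nat M)"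
  have "0 = (\<Sum>k\<in>?K. (\<Prod>i\<in>UNIV. ?e (k i) (- int (b i))) *
      (\<Sum>m\<in>S. c m * monomial m (\<chi> i. ?e (k i) 1)))"
    by (simp add: zero)
  also have "\<dots> = (\<Sum>k\<in>?K. \<Sum>m\<in>S. c m * (\<Prod>i\<in>UNIV. ?e (k i) (int (m i) - int (b i))))"
  proof (intro sum.cong refl)
    fix k
    have "?e (k i) (int (m i) - int (b i)) = ?e (k i) (- int (b i)) * ?e (k i) 1 ^ m i" for m i
      by (simp add: Complex.DeMoivre cis_mult add_divide_distrib diff_divide_distrib algebra_simps)
    then show "(\<Prod>i\<in>UNIV. ?e (k i) (- int (b i))) * (\<Sum>m\<in>S. c m * monomial m (\<chi> i. ?e (k i) 1))
      = (\<Sum>m\<in>S. c m * (\<Prod>i\<in>UNIV. ?e (k i) (int (m i) - int (b i))))"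
      by (simp only: prod.distrib) (simp add: monomial_def sum_distrib_left mult_ac)
  qed
  also have "\<dots> = (\<Sum>m\<in>S. c m * (\<Sum>k\<in>?K. \<Prod>i\<in>UNIV. ?e (k i) (int (m i) - int (b i))))"
    unfolding sum_distrib_left by (rule sum.swap)
  also have "\<dots> = (\<Sum>m\<in>S. c m * (if m = b then of_nat (\<Prod>i\<in>(UNIV :: 'n set). M) else 0))"
  proof (intro sum.cong refl arg_cong2[where f = "(*)"])
    fix m assume m: "m \<in> S"
    have "int M dvd int (m i) - int (b i) \<longleftrightarrow> m i = b i" for i
      using less[OF m, of i] less[OF b, of i] zdvd_not_zless[of "int (m i) - int (b i)" "int M"]
        zdvd_not_zless[of "int (b i) - int (m i)" "int M"] dvd_diff_commute[of "int M" "int (m i)" "int (b i)"]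
      by (cases "m i" "b i" rule: linorder_cases) auto
    then have "(\<forall>i. int M dvd int (m i) - int (b i)) \<longleftrightarrow> m = b"
      by (simp add: fun_eq_iff)
    then show "(\<Sum>k\<in>?K. \<Prod>i\<in>UNIV. ?e (k i) (int (m i) - int (b i)))
      = (if m = b then of_nat (\<Prod>i\<in>(UNIV :: 'n set). M) else 0)"
      by (subst sum_characters[OF M0]) simp
  qed
  also have "\<dots> = c b * of_nat (\<Prod>i\<in>(UNIV :: 'n set). M)"
    using S b by (simp add: if_distrib cong: if_cong)
  finally show ?thesis using M0 by simp
qed

lemma inj_monomial: "inj monomial"
proof
  fix m m' :: "'n::finite \<Rightarrow> nat"
  assume eq: "monomial m = monomial m'"
  show "m = m'"
  proof (rule ccontr)
    assume ne: "m \<noteq> m'"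
    have "(\<Sum>n\<in>{m, m'}. (if n = m then 1 else - 1) * monomial n x) = 0" for x
      using ne eq by simp
    from monomial_unique[OF _ this, of m] show False by simp
  qed
qed

interpretation fn: vector_space "\<lambda>(c :: complex) (f :: complex^'n \<Rightarrow> complex) x. c * f x"
  by unfold_locales (auto simp: fun_eq_iff algebra_simps)

lemma sum_fun_apply: "(\<Sum>i\<in>I. f i) x = (\<Sum>i\<in>I. f i x)"
  by (induction I rule: infinite_finite_induct) auto

lemma independent_monomials: "fn.independent (range (monomial :: ('n::finite \<Rightarrow> nat) \<Rightarrow> _))"
proof
  assume "fn.dependent (range (monomial :: ('n \<Rightarrow> nat) \<Rightarrow> _))"
  then obtain S u v where S: "finite S" "S \<subseteq> range (monomial :: ('n \<Rightarrow> nat) \<Rightarrow> _)"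
    and v: "v \<in> S" "u v \<noteq> 0" and zero: "(\<Sum>v\<in>S. (\<lambda>x. u v * v x)) = 0"
    unfolding fn.dependent_explicit by blast
  obtain T where T: "finite T" "S = monomial ` T"
    using finite_subset_image[OF S] by blast
  have "(\<Sum>m\<in>T. u (monomial m) * monomial m x) = 0" for x
    using fun_cong[OF zero, of x] inj_on_subset[OF inj_monomial, of T]
    by (simp add: T sum.reindex sum_fun_apply)
  from monomial_unique[OF T(1) this] v T(2) show False by auto
qed

lemma monomial_add: "monomial (\<lambda>i. a i + b i) x = monomial a x * monomial b x"
  by (simp add: monomial_def power_add prod.distrib)

lemma coordinate_power_eq_monomial: "x $ i ^ n = monomial (\<lambda>j. if j = i then n else 0) x"
proof -
  have "monomial (\<lambda>j. if j = i then n else 0) x = (\<Prod>j\<in>UNIV. if j = i then x $ i ^ n else 1)"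
    unfolding monomial_def by (intro prod.cong) auto
  then show ?thesis by simp
qed

lemma monomial_zero: "monomial (\<lambda>i. 0) x = 1"
  by (simp add: monomial_def)

lemma monomial_polynomial: "monomial (b :: 'n::finite \<Rightarrow> nat) \<in> polynomial_functions"
proof -
  have pow: "(\<lambda>x. x $ i ^ n) \<in> polynomial_functions" for i :: 'n and n
    by (induction n) (auto intro: polynomial_functions.intros)
  have "(\<lambda>x. \<Prod>i\<in>I. x $ i ^ b i) \<in> polynomial_functions" for I
    by (induction I rule: infinite_finite_induct) (auto intro: polynomial_functions.intros pow)
  then show ?thesis unfolding monomial_def[abs_def] .
qed

lemma span_monomials_mult:
  assumes f: "f \<in> fn.span (range monomial)" and h: "h \<in> fn.span (range monomial)"
  shows "(\<lambda>x. f x * h x) \<in> fn.span (range monomial)"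
proof -
  have 1: "(\<lambda>x. f x * monomial m x) \<in> fn.span (range monomial)" for m
    using f
  proof (induction rule: fn.span_induct_alt)
    case base
    then show ?case using fn.span_zero[of "range monomial"] by (simp add: zero_fun_def)
  next
    case (step c g y)
    then obtain b where b: "g = monomial b" by blast
    have "(\<lambda>x. c * monomial (\<lambda>i. b i + m i) x) \<in> fn.span (range monomial)"
      by (intro fn.span_scale fn.span_base) blast
    from fn.span_add[OF this step(2)] show ?case
      by (simp add: b plus_fun_def monomial_add algebra_simps)
  qed
  show ?thesis
    using h
  proof (induction rule: fn.span_induct_alt)
    case base
    then show ?case using fn.span_zero[of "range monomial"] by (simp add: zero_fun_def)
  next
    case (step c g y)
    then obtain b where b: "g = monomial b" by blast
    have "(\<lambda>x. c * (f x * monomial b x)) \<in> fn.span (range monomial)"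
      by (intro fn.span_scale 1)
    from fn.span_add[OF this step(2)] show ?case
      by (simp add: b plus_fun_def algebra_simps)
  qed
qed

lemma polynomial_functions_eq_span: "polynomial_functions = fn.span (range (monomial :: ('n::finite \<Rightarrow> nat) \<Rightarrow> _))"
proof
  show "polynomial_functions \<subseteq> fn.span (range (monomial :: ('n \<Rightarrow> nat) \<Rightarrow> _))"
  proof
    fix f :: "complex^'n \<Rightarrow> complex" assume "f \<in> polynomial_functions"
    then show "f \<in> fn.span (range monomial)"
    proof induction
      case (const c)
      have "(\<lambda>x. c * monomial (\<lambda>i. 0) x) \<in> fn.span (range monomial)"
        by (intro fn.span_scale fn.span_base) blast
      then show ?case by (simp add: monomial_zero)
    next
      case (coord i)
      have "monomial (\<lambda>j. if j = i then 1 else 0) \<in> fn.span (range monomial)"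
        by (intro fn.span_base) blast
      then show ?case
        using coordinate_power_eq_monomial[of _ i 1] by (simp add: fun_eq_iff[symmetric])
    next
      case (add f h)
      then show ?case using fn.span_add[of f _ h] by (simp add: plus_fun_def)
    next
      case (mult f h)
      then show ?case by (intro span_monomials_mult)
    qed
  qed
  have "fn.subspace polynomial_functions"
    unfolding fn.subspace_def
    by (auto intro: polynomial_functions.add polynomial_functions_scale polynomial_functions.const
        simp: plus_fun_def zero_fun_def)
  then show "fn.span (range (monomial :: ('n \<Rightarrow> nat) \<Rightarrow> _)) \<subseteq> polynomial_functions"
    using monomial_polynomial by (intro fn.span_minimal) auto
qed

text \<open>The coordinates with respect to the basis of monomials of the space of polynomial functions; the
  value is $0$ for functions that are not polynomial.\<close>

definition coefficient :: "(complex^'n \<Rightarrow> complex) \<Rightarrow> ('n \<Rightarrow> nat) \<Rightarrow> complex" where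
  "coefficient f b = fn.representation (range monomial) f (monomial b)"

lemma coefficient_sum:
  assumes "\<And>i. i \<in> I \<Longrightarrow> f i \<in> polynomial_functions"
  shows "coefficient (\<lambda>x. \<Sum>i\<in>I. f i x) b = (\<Sum>i\<in>I. coefficient (f i) b)"
proof -
  have "(\<lambda>x. \<Sum>i\<in>I. f i x) = (\<Sum>i\<in>I. f i)" by (simp add: fun_eq_iff sum_fun_apply)
  then show ?thesis
    using fn.representation_sum[OF independent_monomials, of I f] assms
    by (simp add: coefficient_def polynomial_functions_eq_span)
qed

lemma coefficient_scale:
  assumes "f \<in> polynomial_functions"
  shows "coefficient (\<lambda>x. c * f x) b = c * coefficient f b"
  using fn.representation_scale[OF independent_monomials, of f c] assms
  by (simp add: coefficient_def polynomial_functions_eq_span)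

lemma coefficient_diff:
  assumes "f \<in> polynomial_functions" "h \<in> polynomial_functions"
  shows "coefficient (\<lambda>x. f x - h x) b = coefficient f b - coefficient h b"
  using fn.representation_diff[OF independent_monomials, of h f] assms
  by (simp add: coefficient_def polynomial_functions_eq_span fun_diff_def)

lemma coefficient_monomial: "coefficient (monomial m) b = (if m = b then 1 else 0)"
  using fn.representation_basis[OF independent_monomials, of "monomial m"]
  by (auto simp: coefficient_def inj_eq[OF inj_monomial])

lemma coefficient_monomial_sum:
  assumes "finite S"
  shows "coefficient (\<lambda>x. \<Sum>m\<in>S. c m * monomial m x) b = (if b \<in> S then c b else 0)"
proof -
  have "coefficient (\<lambda>x. \<Sum>m\<in>S. c m * monomial m x) b = (\<Sum>m\<in>S. c m * (if m = b then 1 else 0))"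
    by (subst coefficient_sum)
      (auto intro: polynomial_functions_scale monomial_polynomial
        simp: coefficient_scale monomial_polynomial coefficient_monomial)
  then show ?thesis using assms by (simp add: if_distrib cong: if_cong)
qed

lemma polynomial_expansion:
  assumes "f \<in> polynomial_functions"
  shows "finite {b. coefficient f b \<noteq> 0}"
    and "f = (\<lambda>x. \<Sum>b | coefficient f b \<noteq> 0. coefficient f b * monomial b x)"
proof -
  let ?R = "fn.representation (range monomial) f"
  have supp: "{v. ?R v \<noteq> 0} = monomial ` {b. coefficient f b \<noteq> 0}"
    using fn.representation_ne_zero[of "range monomial" f] by (auto simp: coefficient_def)
  have inj: "inj_on monomial {b. coefficient f b \<noteq> 0}"
    using inj_monomial inj_on_subset by blast
  show "finite {b. coefficient f b \<noteq> 0}"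
    using fn.finite_representation[of "range monomial" f] finite_imageD[OF _ inj]
    by (simp add: supp)
  have "(\<Sum>v | ?R v \<noteq> 0. (\<lambda>x. ?R v * v x)) = f"
    using assms by (intro fn.sum_nonzero_representation_eq independent_monomials)
      (simp add: polynomial_functions_eq_span)
  then show "f = (\<lambda>x. \<Sum>b | coefficient f b \<noteq> 0. coefficient f b * monomial b x)"
    by (simp add: supp sum.reindex[OF inj] fun_eq_iff sum_fun_apply coefficient_def[symmetric])
qed

lemma coefficient_scale_variables:
  assumes f: "f \<in> polynomial_functions"
  shows "coefficient (\<lambda>x. f (\<chi> i. u i * x $ i)) b = (\<Prod>i\<in>UNIV. u i ^ b i) * coefficient f b"
proof -
  let ?S = "{b. coefficient f b \<noteq> 0}"
  have "f (\<chi> i. u i * x $ i) = (\<Sum>m\<in>?S. ((\<Prod>i\<in>UNIV. u i ^ m i) * coefficient f m) * monomial m x)" for x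
    by (subst polynomial_expansion(2)[OF f])
      (simp add: monomial_def power_mult_distrib prod.distrib mult_ac)
  then show ?thesis
    using coefficient_monomial_sum[OF polynomial_expansion(1)[OF f]] by simp
qed

lemma monomial_permute:
  assumes p: "p permutes (UNIV :: 'n::finite set)"
  shows "monomial (m \<circ> p) (\<chi> i. x $ p i) = monomial m x"
  using prod.permute[OF p, of "\<lambda>i. x $ i ^ m i"] by (simp add: monomial_def o_def)

lemma coefficient_permute:
  fixes f :: "complex^'n \<Rightarrow> complex"
  assumes f: "f \<in> polynomial_functions" and p: "p permutes UNIV"
  shows "coefficient (\<lambda>x. f (\<chi> i. x $ p i)) b = coefficient f (b \<circ> p)"
proof -
  let ?S = "{b. coefficient f b \<noteq> 0}" and ?q = "inv_into UNIV p"
  have pq: "p \<circ> ?q = id" "?q \<circ> p = id" using permutes_inv_o[OF p] by auto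
  have inj: "inj_on (\<lambda>m :: 'n \<Rightarrow> nat. m \<circ> ?q) ?S"
    by (rule inj_on_inverseI[where g = "\<lambda>m. m \<circ> p"]) (simp add: o_assoc[symmetric] pq)
  have "f (\<chi> i. x $ p i) = (\<Sum>m\<in>(\<lambda>m. m \<circ> ?q) ` ?S. coefficient f (m \<circ> p) * monomial m x)" for x
  proof -
    have "monomial m (\<chi> i. x $ p i) = monomial (m \<circ> ?q) x" for m
      using monomial_permute[OF p, of "m \<circ> ?q" x] by (simp add: o_assoc[symmetric] pq)
    then show ?thesis
      by (subst polynomial_expansion(2)[OF f]) (simp add: sum.reindex[OF inj] o_assoc[symmetric] pq)
  qed
  moreover have "b \<in> (\<lambda>m. m \<circ> ?q) ` ?S \<longleftrightarrow> coefficient f (b \<circ> p) \<noteq> 0"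
  proof
    assume "coefficient f (b \<circ> p) \<noteq> 0"
    then show "b \<in> (\<lambda>m. m \<circ> ?q) ` ?S"
      by (intro image_eqI[of _ _ "b \<circ> p"]) (simp_all add: o_assoc[symmetric] pq)
  qed (auto simp: o_assoc[symmetric] pq)
  ultimately show ?thesis
    using coefficient_monomial_sum[OF finite_imageI[OF polynomial_expansion(1)[OF f]],
        of "\<lambda>m. coefficient f (m \<circ> p)" "\<lambda>m. m \<circ> ?q" b] by auto
qed

section \<open>The Milnor ring of a Fermat polynomial\<close>

text \<open>The exponents $b_i \le d_i - 2$ of the standard basis of the Milnor ring.\<close>

definition milnor_box :: "('n \<Rightarrow> nat) \<Rightarrow> ('n \<Rightarrow> nat) set" where
  "milnor_box d = {b. \<forall>i. b i + 2 \<le> d i}"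

lemma finite_milnor_box: "finite (milnor_box (d :: 'n::finite \<Rightarrow> nat))"
proof -
  have "milnor_box d \<subseteq> Pi\<^sub>E UNIV (\<lambda>i. {..d i})" by (auto simp: milnor_box_def PiE_UNIV_domain) (meson Suc_leD)
  then show ?thesis by (rule finite_subset) (simp add: finite_PiE)
qed

lemma derivative_along_fermat:
  "derivative_along (polynomial_of (fermat_exponents d)) e x
    = (\<Sum>i\<in>UNIV. of_nat (d i) * e $ i * x $ i ^ (d i - 1))"
proof -
  have "((\<lambda>t. \<Sum>i\<in>UNIV. (x $ i + t * e $ i) ^ d i) has_field_derivative
      (\<Sum>i\<in>UNIV. of_nat (d i) * e $ i * x $ i ^ (d i - 1))) (at 0)"
    by (auto intro!: derivative_eq_intros sum.cong)
  then show ?thesis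
    unfolding derivative_along_def polynomial_of_fermat by (simp add: DERIV_imp_deriv)
qed

lemma coefficient_coordinate_multiple:
  assumes f: "f \<in> polynomial_functions" and b: "b i < n"
  shows "coefficient (\<lambda>x. f x * x $ i ^ n) b = 0"
proof -
  let ?S = "{b. coefficient f b \<noteq> 0}"
  let ?s = "\<lambda>j. if j = i then n else 0"
  have "(\<lambda>x. f x * x $ i ^ n) = (\<lambda>x. \<Sum>m\<in>?S. coefficient f m * monomial (\<lambda>j. m j + ?s j) x)"
    by (subst polynomial_expansion(2)[OF f])
      (simp add: sum_distrib_right monomial_add coordinate_power_eq_monomial[symmetric] mult.assoc)
  moreover have "(\<lambda>j. m j + ?s j) \<noteq> b" for m using b by (auto simp: fun_eq_iff)
  ultimately show ?thesis
    by (simp add: coefficient_sum polynomial_functions_scale monomial_polynomial coefficient_scale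
        coefficient_monomial)
qed

lemma derivative_along_in_jacobian_ideal: "e \<in> E \<Longrightarrow> derivative_along V e \<in> jacobian_ideal V E"
  unfolding jacobian_ideal_def
  by (intro CollectI exI[of _ "{e}"] exI[of _ "\<lambda>e x. 1"]) (auto intro: polynomial_functions.const)

text \<open>The derivative along the \<open>i\<close>-th axis is a nonzero multiple of $x_i^{d_i - 1}$, so the ideal is spanned by
  the monomials with exponents outside of \<open>milnor_box d\<close>.\<close>

theorem jacobian_ideal_fermat:
  fixes d :: "'n::finite \<Rightarrow> nat"
  assumes d: "\<And>i. d i \<ge> 2"
  shows "f \<in> jacobian_ideal (polynomial_of (fermat_exponents d)) UNIV \<longleftrightarrow>
    f \<in> polynomial_functions \<and> (\<forall>b\<in>milnor_box d. coefficient f b = 0)"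
proof
  let ?V = "polynomial_of (fermat_exponents d)"
  assume "f \<in> jacobian_ideal ?V UNIV"
  then obtain S a where S: "finite S" "\<forall>e\<in>S. a e \<in> polynomial_functions"
    and f: "f = (\<lambda>x. \<Sum>e\<in>S. a e x * derivative_along ?V e x)"
    unfolding jacobian_ideal_def by blast
  let ?t = "\<lambda>e i x. (of_nat (d i) * e $ i) * (a e x * x $ i ^ (d i - 1))"
  have f': "f = (\<lambda>x. \<Sum>e\<in>S. \<Sum>i\<in>UNIV. ?t e i x)"
    unfolding f derivative_along_fermat by (simp add: sum_distrib_left mult_ac)
  have poly: "(\<lambda>x. a e x * x $ i ^ (d i - 1)) \<in> polynomial_functions" if "e \<in> S" for e i
    unfolding coordinate_power_eq_monomial
    using S(2) that by (intro polynomial_functions.mult monomial_polynomial) auto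
  have poly': "(\<lambda>x. \<Sum>i\<in>UNIV. ?t e i x) \<in> polynomial_functions" if "e \<in> S" for e
    using poly[OF that] by (intro polynomial_functions_sum polynomial_functions_scale)
  have "coefficient f b = 0" if b: "b \<in> milnor_box d" for b
  proof -
    have "coefficient f b = (\<Sum>e\<in>S. coefficient (\<lambda>x. \<Sum>i\<in>UNIV. ?t e i x) b)"
      unfolding f' by (rule coefficient_sum) (rule poly')
    also have "\<dots> = (\<Sum>e\<in>S. \<Sum>i\<in>UNIV. coefficient (?t e i) b)"
      by (intro sum.cong refl coefficient_sum polynomial_functions_scale poly)
    also have "\<dots> = 0"
    proof (intro sum.neutral ballI)
      fix e i assume e: "e \<in> S"
      have "b i + 2 \<le> d i" using b by (simp add: milnor_box_def)
      then have "b i < d i - 1" by linarith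
      then show "coefficient (?t e i) b = 0"
        using S(2) e by (subst coefficient_scale[OF poly[OF e]]) (simp add: coefficient_coordinate_multiple)
    qed
    finally show ?thesis .
  qed
  moreover have "f \<in> polynomial_functions"
    unfolding f' by (intro polynomial_functions_sum poly')
  ultimately show "f \<in> polynomial_functions \<and> (\<forall>b\<in>milnor_box d. coefficient f b = 0)" by blast
next
  let ?V = "polynomial_of (fermat_exponents d)"
  assume f: "f \<in> polynomial_functions \<and> (\<forall>b\<in>milnor_box d. coefficient f b = 0)"
  have "monomial b \<in> jacobian_ideal ?V UNIV" if notin: "b \<notin> milnor_box d" for b
  proof -
    obtain i where "\<not> b i + 2 \<le> d i" using notin unfolding milnor_box_def by blast
    then have i: "d i - 1 \<le> b i" by linarith
    have deriv: "derivative_along ?V (axis i 1) x = of_nat (d i) * x $ i ^ (d i - 1)" for x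
    proof -
      have "derivative_along ?V (axis i 1) x
          = (\<Sum>j\<in>UNIV. if j = i then of_nat (d i) * x $ i ^ (d i - 1) else 0)"
        unfolding derivative_along_fermat by (intro sum.cong) (auto simp: axis_def)
      then show ?thesis by simp
    qed
    let ?b = "b(i := b i - (d i - 1))"
    have eq: "(\<lambda>j. ?b j + (if j = i then d i - 1 else 0)) = b"
      using i by (auto simp: fun_eq_iff)
    have mono: "monomial b x = monomial ?b x * x $ i ^ (d i - 1)" for x
      unfolding coordinate_power_eq_monomial monomial_add[symmetric] eq ..
    have deriv_mem: "derivative_along ?V (axis i 1) \<in> jacobian_ideal ?V UNIV"
      by (simp add: derivative_along_in_jacobian_ideal)
    have poly_mem: "(\<lambda>x. (1 / of_nat (d i)) * monomial ?b x) \<in> polynomial_functions"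
      by (rule polynomial_functions_scale[OF monomial_polynomial])
    have "monomial b = (\<lambda>x. ((1 / of_nat (d i)) * monomial ?b x) * derivative_along ?V (axis i 1) x)"
      using d[of i] mono by (auto simp: fun_eq_iff deriv)
    also have "\<dots> \<in> jacobian_ideal ?V UNIV"
      by (rule jacobian_ideal_mult[OF deriv_mem poly_mem])
    finally show ?thesis .
  qed
  then have "(\<lambda>x. \<Sum>b | coefficient f b \<noteq> 0. coefficient f b * monomial b x) \<in> jacobian_ideal ?V UNIV"
    using f by (intro jacobian_ideal_sum jacobian_ideal_scale) auto
  then show "f \<in> jacobian_ideal ?V UNIV"
    by (subst polynomial_expansion(2)[OF conjunct1[OF f]])
qed

section \<open>Diagonal symmetries and permutation matrices\<close>

definition diagonal :: "('n::finite \<Rightarrow> complex) \<Rightarrow> complex^'n^'n" where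
  "diagonal u = (\<chi> i j. if i = j then u i else 0)"

definition root_diagonal :: "('n::finite \<Rightarrow> nat) \<Rightarrow> ('n \<Rightarrow> nat) \<Rightarrow> complex^'n^'n" where
  "root_diagonal d k = diagonal (\<lambda>i. cis (2 * pi * of_nat (k i) / of_nat (d i)))"

definition permutation_matrix :: "('n::finite \<Rightarrow> 'n) \<Rightarrow> complex^'n^'n" where
  "permutation_matrix p = (\<chi> i j. if j = p i then 1 else 0)"

lemma diagonal_vector: "diagonal u *v x = (\<chi> i. u i * x $ i)"
  by (simp add: diagonal_def matrix_vector_mult_def vec_eq_iff if_distrib[of "\<lambda>y. y * _"] cong: if_cong)

lemma permutation_matrix_vector: "permutation_matrix p *v x = (\<chi> i. x $ p i)"
  by (simp add: permutation_matrix_def matrix_vector_mult_def vec_eq_iff if_distrib[of "\<lambda>y. y * _"] cong: if_cong)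

lemma diagonal_nth [simp]: "diagonal u $ i $ i = u i"
  by (simp add: diagonal_def)

lemma diagonal_mult: "diagonal u ** diagonal v = diagonal (\<lambda>i. u i * v i)"
  by (simp add: matrix_eq matrix_vector_mul_assoc[symmetric] diagonal_vector vec_eq_iff mult.assoc)

lemma diagonal_one: "diagonal (\<lambda>i. 1) = mat 1"
  by (simp add: diagonal_def mat_def vec_eq_iff)

lemma permutation_matrix_mult:
  "permutation_matrix p ** permutation_matrix q = permutation_matrix (q \<circ> p)"
  by (simp add: matrix_eq matrix_vector_mul_assoc[symmetric] permutation_matrix_vector vec_eq_iff)

lemma permutation_matrix_id: "permutation_matrix id = mat 1"
  by (simp add: permutation_matrix_def mat_def vec_eq_iff eq_commute)

text \<open>Conjugation by a permutation matrix permutes the diagonal entries.\<close>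

lemma diagonal_permutation_matrix:
  "diagonal (\<lambda>i. u (p i)) ** permutation_matrix p = permutation_matrix p ** diagonal u"
  by (simp add: matrix_eq matrix_vector_mul_assoc[symmetric] permutation_matrix_vector
      diagonal_vector vec_eq_iff)

lemma det_diagonal_matrix: "det (diagonal u) = (\<Prod>i\<in>UNIV. u i)"
  by (subst det_diagonal) (auto simp: diagonal_def)

lemma det_permutation_matrix:
  assumes "p permutes UNIV"
  shows "det (permutation_matrix p) = of_int (sign p)"
proof -
  have "permutation_matrix p = (\<chi> i. mat 1 $ p i)"
    by (auto simp: permutation_matrix_def mat_def vec_eq_iff)
  then show ?thesis using det_permute_rows[OF assms, of "mat 1"] by simp
qed

lemma even_permutations_eq:
  "even_permutations = {permutation_matrix p | p. p permutes UNIV \<and> evenperm p}"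
  by (simp add: even_permutations_def permutation_matrix_def)

text \<open>Consequently the two factors of a product of a diagonal matrix and a permutation matrix are
  determined by the product.\<close>

lemma permutation_matrix_eq_diagonal:
  assumes "permutation_matrix p = diagonal u"
  shows "permutation_matrix p = mat 1"
proof -
  have "p i = i" for i
    using arg_cong[OF assms, of "\<lambda>g. g $ i $ p i"]
    by (auto simp: permutation_matrix_def diagonal_def split: if_splits)
  then have "p = id" by auto
  then show ?thesis by (simp add: permutation_matrix_id)
qed

lemma additive_eq: "additive a = diagonal (\<lambda>i. cis (2 * pi * of_rat (a i)))"
proof -
  have "of_rat r = complex_of_real (of_rat r)" for r
    by (cases r) (simp add: of_rat_rat)
  then show ?thesis
    by (simp add: additive_def diagonal_def cis_conv_exp vec_eq_iff mult_ac)
qed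

lemma root_diagonal_eq_additive:
  "root_diagonal d k = additive (\<lambda>i. of_nat (k i) / of_nat (d i))"
  by (simp add: root_diagonal_def additive_eq of_rat_divide)

text \<open>Evaluating \<open>V\<close> on the \<open>i\<close>-th axis shows that the \<open>i\<close>-th diagonal entry is a root of unity of
  order dividing \<open>d i\<close>.\<close>

lemma diagonal_symmetries_fermat:
  assumes d: "\<And>i. d i > 0"
  shows "diagonal_symmetries (polynomial_of (fermat_exponents d))
    = {root_diagonal d k | k. \<forall>i. k i < d i}" (is "?L = ?R")
proof
  let ?V = "polynomial_of (fermat_exponents d)"
  show "?L \<subseteq> ?R"
  proof
    fix g assume "g \<in> ?L"
    then have V: "\<And>x. ?V (g *v x) = ?V x" and g: "\<And>i j. i \<noteq> j \<Longrightarrow> g $ i $ j = 0"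
      by (auto simp: diagonal_symmetries_def max_symmetries_def)
    have g_eq: "g = diagonal (\<lambda>i. g $ i $ i)"
      using g by (simp add: diagonal_def vec_eq_iff)
    have "\<exists>k<d i. g $ i $ i = cis (2 * pi * of_nat k / of_nat (d i))" for i
    proof -
      have axis: "?V (axis i c) = c ^ d i" for c
      proof -
        have "?V (axis i c) = (\<Sum>j\<in>UNIV. if j = i then c ^ d i else 0)"
          unfolding polynomial_of_fermat using d by (intro sum.cong) (auto simp: axis_def)
        then show ?thesis by simp
      qed
      have "g *v axis i 1 = axis i (g $ i $ i)"
        by (subst g_eq) (auto simp: diagonal_vector axis_def vec_eq_iff)
      then have "(g $ i $ i) ^ d i = 1"
        using V[of "axis i 1"] by (simp add: axis)
      then have "g $ i $ i \<in> (\<lambda>k. cis (2 * pi * real k / real (d i))) ` {..<d i}"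
        using bij_betw_imp_surj_on[OF Complex.bij_betw_roots_unity[OF d[of i]]] by simp
      then show ?thesis by auto
    qed
    then obtain k where "\<And>i. k i < d i" "\<And>i. g $ i $ i = cis (2 * pi * of_nat (k i) / of_nat (d i))"
      by metis
    then show "g \<in> ?R"
      using g_eq by (auto simp: root_diagonal_def)
  qed
  show "?R \<subseteq> ?L"
  proof
    fix g assume "g \<in> ?R"
    then obtain k where g: "g = root_diagonal d k" by blast
    have "(cis (2 * pi * of_nat (k i) / of_nat (d i))) ^ d i = 1" for i
      using d[of i] cis_multiple_2pi[of "of_nat (k i)"] by (simp add: Complex.DeMoivre)
    then have "?V (g *v x) = ?V x" for x
      by (simp add: g root_diagonal_def polynomial_of_fermat diagonal_vector power_mult_distrib)
    moreover have "invertible g"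
      unfolding invertible_det_nz g root_diagonal_def det_diagonal_matrix by simp
    moreover have "g $ i $ j = 0" if "i \<noteq> j" for i j
      using that by (simp add: g root_diagonal_def diagonal_def)
    ultimately show "g \<in> ?L"
      by (auto simp: diagonal_symmetries_def max_symmetries_def) metis
  qed
qed

lemma finite_diagonal_symmetries_fermat:
  fixes d :: "'n::finite \<Rightarrow> nat"
  assumes "\<And>i. d i > 0"
  shows "finite (diagonal_symmetries (polynomial_of (fermat_exponents d)))"
proof -
  have "{k :: 'n \<Rightarrow> nat. \<forall>i. k i < d i} = Pi\<^sub>E UNIV (\<lambda>i. {..<d i})"
    by (auto simp: PiE_UNIV_domain)
  then have "finite {k :: 'n \<Rightarrow> nat. \<forall>i. k i < d i}"
    by (simp add: finite_PiE)
  then show ?thesis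
    unfolding diagonal_symmetries_fermat[OF assms] by simp
qed

lemma root_diagonal_add: "root_diagonal d k ** root_diagonal d l = root_diagonal d (\<lambda>i. k i + l i)"
  by (simp add: root_diagonal_def diagonal_mult cis_mult distrib_left add_divide_distrib)

lemma root_diagonal_eq_one_iff:
  assumes "\<And>i. d i > 0"
  shows "root_diagonal d k = mat 1 \<longleftrightarrow> (\<forall>i. d i dvd k i)"
proof -
  have "root_diagonal d k = mat 1 \<longleftrightarrow> (\<forall>i. cis (2 * pi * of_int (int (k i)) / of_nat (d i)) = 1)"
    by (auto simp: root_diagonal_def diagonal_def mat_def vec_eq_iff)
  then show ?thesis
    by (simp only: cis_two_pi_div_eq_one_iff[OF assms] int_dvd_int_iff)
qed

lemma inj_root_diagonal:
  assumes k: "\<And>i. k i < d i" and l: "\<And>i. l i < d i" and eq: "root_diagonal d k = root_diagonal d l"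
  shows "k = l"
proof
  fix i
  have "cis (2 * pi * of_nat (k i) / of_nat (d i)) = cis (2 * pi * of_nat (l i) / of_nat (d i))"
    using arg_cong[OF eq, of "\<lambda>g. g $ i $ i"] by (simp add: root_diagonal_def)
  moreover have "inj_on (\<lambda>k. cis (2 * pi * of_nat k / of_nat (d i))) {..<d i}"
    using bij_betw_imp_inj_on[OF Complex.bij_betw_roots_unity[of "d i"]] k[of i] by simp
  ultimately show "k i = l i"
    using k[of i] l[of i] by (auto dest: inj_onD)
qed

lemma root_diagonal_permutation_matrix:
  assumes "\<And>i. d (p i) = d i"
  shows "root_diagonal d (k \<circ> p) ** permutation_matrix p = permutation_matrix p ** root_diagonal d k"
  using diagonal_permutation_matrix[of "\<lambda>i. cis (2 * pi * of_nat (k i) / of_nat (d i))" p] assms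
  by (simp add: root_diagonal_def)

lemma matrix_inv_eqI:
  fixes g h :: "complex^'n^'n"
  assumes "g ** h = mat 1"
  shows "matrix_inv g = h"
proof -
  have "invertible g" using assms matrix_left_right_inverse[of g h] by (auto simp: invertible_def)
  then have "matrix_inv g ** g = mat 1" by (rule matrix_inv)
  then have "matrix_inv g ** (g ** h) = h" by (simp add: matrix_mul_assoc)
  then show ?thesis by (simp add: assms)
qed

lemma matrix_inv_root_diagonal:
  assumes "\<And>i. k i < d i"
  shows "matrix_inv (root_diagonal d k) = root_diagonal d (\<lambda>i. d i - k i)"
proof (rule matrix_inv_eqI)
  have "d i > 0" "k i + (d i - k i) = d i" for i using assms[of i] by simp_all
  then show "root_diagonal d k ** root_diagonal d (\<lambda>i. d i - k i) = mat 1"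
    by (simp add: root_diagonal_add root_diagonal_eq_one_iff)
qed

section \<open>The dual group\<close>

text \<open>On \<open>root_diagonal d k\<close> this is $e^{2 \pi i \sum_j l_j k_j / d_j}$, the exponential of the pairing
  $g A_W h^T$ of $g = (l_j/d_j)_j$ and $h = (k_j/d_j)_j$.\<close>

definition diagonal_character :: "('n::finite \<Rightarrow> nat) \<Rightarrow> complex^'n^'n \<Rightarrow> complex" where
  "diagonal_character l g = (\<Prod>i\<in>UNIV. (g $ i $ i) ^ l i)"

lemma diagonal_character_mult:
  "diagonal_character l (diagonal u ** diagonal v)
    = diagonal_character l (diagonal u) * diagonal_character l (diagonal v)"
  by (simp add: diagonal_character_def diagonal_mult power_mult_distrib prod.distrib)

lemma diagonal_character_root_diagonal:
  "diagonal_character l (root_diagonal d k)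
    = (\<Prod>i\<in>UNIV. cis (2 * pi * of_int (int (l i) * int (k i)) / of_nat (d i)))"
  by (simp add: diagonal_character_def root_diagonal_def Complex.DeMoivre mult_ac)

lemma diagonal_character_sym:
  "diagonal_character l (root_diagonal d k) = diagonal_character k (root_diagonal d l)"
  by (simp add: diagonal_character_root_diagonal mult_ac)

lemma cis_sum: "finite I \<Longrightarrow> cis (\<Sum>i\<in>I. a i) = (\<Prod>i\<in>I. cis (a i))"
  by (induction I rule: finite_induct) (simp_all add: cis_mult[symmetric])

lemma diagonal_character_additive_eq_one_iff:
  "diagonal_character l (additive a) = 1 \<longleftrightarrow> (\<Sum>i\<in>UNIV. of_nat (l i) * a i) \<in> \<int>"
proof -
  let ?s = "\<Sum>i\<in>UNIV. of_nat (l i) * a i"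
  have "diagonal_character l (additive a) = cis (2 * pi * of_rat ?s)"
    by (simp add: diagonal_character_def additive_eq Complex.DeMoivre of_rat_sum of_rat_mult
        sum_distrib_left cis_sum mult_ac)
  also have "\<dots> = 1 \<longleftrightarrow> (\<exists>m::int. (of_rat ?s :: real) = of_rat (of_int m))"
    unfolding cis_eq_one_iff by simp
  also have "\<dots> \<longleftrightarrow> ?s \<in> \<int>"
    by (auto simp only: of_rat_eq_iff Ints_def)
  finally show ?thesis .
qed

lemma dual_group_fermat:
  fixes d :: "'n::finite \<Rightarrow> nat"
  assumes d: "\<And>i. d i > 0" and H: "H \<subseteq> diagonal_symmetries (polynomial_of (fermat_exponents d))"
  shows "dual_group (fermat_exponents d) H
    = {g \<in> diagonal_symmetries (polynomial_of (fermat_exponents d)).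
        \<forall>l. root_diagonal d l \<in> H \<longrightarrow> diagonal_character l g = 1}" (is "?L = ?R")
proof
  have pairing: "(\<Sum>i\<in>UNIV. \<Sum>j\<in>UNIV. a i * of_nat (fermat_exponents d $ i $ j) * b j)
      = (\<Sum>i\<in>UNIV. a i * of_nat (d i) * b i)" for a b :: "'n \<Rightarrow> rat"
  proof (intro sum.cong refl)
    fix i
    have "(\<Sum>j\<in>UNIV. a i * of_nat (fermat_exponents d $ i $ j) * b j)
        = (\<Sum>j\<in>UNIV. if j = i then a i * of_nat (d i) * b i else 0)"
      by (intro sum.cong) (auto simp: fermat_exponents_def)
    then show "(\<Sum>j\<in>UNIV. a i * of_nat (fermat_exponents d $ i $ j) * b j) = a i * of_nat (d i) * b i"
      by simp
  qed
  show "?L \<subseteq> ?R"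
  proof
    fix g assume "g \<in> ?L"
    then obtain a where a: "g = additive a" "g \<in> diagonal_symmetries (polynomial_of (fermat_exponents d))"
      "\<And>b. additive b \<in> H \<Longrightarrow> (\<Sum>i\<in>UNIV. a i * of_nat (d i) * b i) \<in> \<int>"
      unfolding dual_group_def pairing transpose_fermat by blast
    have "diagonal_character l g = 1" if "root_diagonal d l \<in> H" for l
    proof -
      have "(\<Sum>i\<in>UNIV. of_nat (l i) * a i)
          = (\<Sum>i\<in>UNIV. a i * of_nat (d i) * (of_nat (l i) / of_nat (d i)))"
      proof (intro sum.cong refl)
        fix i
        show "of_nat (l i) * a i = a i * of_nat (d i) * (of_nat (l i) / of_nat (d i))"
          using d[of i] by simp
      qed
      also have "\<dots> \<in> \<int>"
        using that by (intro a(3)) (simp add: root_diagonal_eq_additive)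
      finally show ?thesis
        unfolding a(1) diagonal_character_additive_eq_one_iff .
    qed
    with a show "g \<in> ?R" by blast
  qed
  show "?R \<subseteq> ?L"
  proof
    fix g assume g: "g \<in> ?R"
    then obtain k where k: "g = root_diagonal d k"
      by (auto simp: diagonal_symmetries_fermat[OF d])
    let ?a = "\<lambda>i. of_nat (k i) / of_nat (d i) :: rat"
    have "(\<Sum>i\<in>UNIV. ?a i * of_nat (d i) * b i) \<in> \<int>" if b: "additive b \<in> H" for b
    proof -
      obtain l where l: "additive b = root_diagonal d l"
        using H b by (auto simp: diagonal_symmetries_fermat[OF d])
      then have "diagonal_character l g = 1" using g b by auto
      then have "diagonal_character k (additive b) = 1"
        unfolding k l by (simp add: diagonal_character_sym)
      then have "(\<Sum>i\<in>UNIV. of_nat (k i) * b i) \<in> \<int>"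
        by (simp add: diagonal_character_additive_eq_one_iff)
      moreover have "d i \<noteq> 0" for i using d[of i] by simp
      ultimately show ?thesis by simp
    qed
    then show "g \<in> ?L"
      unfolding dual_group_def pairing transpose_fermat
      using g by (intro CollectI exI[of _ ?a]) (simp add: k root_diagonal_eq_additive)
  qed
qed

text \<open>Translation by \<open>h\<close> multiplies the sum by \<open>diagonal_character l h\<close> and also permutes its terms.\<close>

lemma sum_diagonal_character_group:
  assumes H: "finite H" "\<And>g h. g \<in> H \<Longrightarrow> h \<in> H \<Longrightarrow> g ** h \<in> H"
    and diag: "H \<subseteq> range diagonal" and inv: "\<And>g. g \<in> H \<Longrightarrow> invertible g"
    and h: "h \<in> H" "diagonal_character l h \<noteq> 1"
  shows "(\<Sum>g\<in>H. diagonal_character l g) = 0"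
proof -
  have inj: "inj_on ((**) h) H"
  proof
    fix a b assume "h ** a = h ** b"
    then have "matrix_inv h ** (h ** a) = matrix_inv h ** (h ** b)" by simp
    then show "a = b" by (simp add: matrix_mul_assoc matrix_inv[OF inv[OF h(1)]])
  qed
  have "(**) h ` H = H"
    using H h inj by (intro card_subset_eq) (auto simp: card_image)
  then have "(\<Sum>g\<in>H. diagonal_character l g) = (\<Sum>g\<in>H. diagonal_character l (h ** g))"
    using sum.reindex[OF inj, of "diagonal_character l"] by simp
  also have "\<dots> = (\<Sum>g\<in>H. diagonal_character l h * diagonal_character l g)"
  proof (intro sum.cong refl)
    fix g assume "g \<in> H"
    then obtain u v where "h = diagonal u" "g = diagonal v" using diag h(1) by blast
    then show "diagonal_character l (h ** g) = diagonal_character l h * diagonal_character l g"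
      by (simp add: diagonal_character_mult)
  qed
  also have "\<dots> = diagonal_character l h * (\<Sum>g\<in>H. diagonal_character l g)"
    by (simp add: sum_distrib_left)
  finally show ?thesis using h(2) by simp
qed

text \<open>The sum of \<open>diagonal_character l (g ** h)\<close> over all \<open>h \<in> H\<close> and all \<open>l\<close> is evaluated in two ways.
  Summing over \<open>h\<close> first leaves a positive number, namely the product of the orders of the dual group
  and of \<open>H\<close>, because \<open>g\<close> is annihilated by the dual group. Summing over \<open>l\<close> first leaves only terms
  with \<open>g ** h = mat 1\<close>. So there is such a term, and \<open>g\<close> is the inverse of an element of \<open>H\<close>.\<close>

theorem double_dual:
  fixes d :: "'n::finite \<Rightarrow> nat"
  assumes d: "\<And>i. d i > 0" and H: "H \<subseteq> diagonal_symmetries (polynomial_of (fermat_exponents d))"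
    and one: "mat 1 \<in> H" and mult: "\<And>g h. g \<in> H \<Longrightarrow> h \<in> H \<Longrightarrow> g ** h \<in> H"
    and inv: "\<And>g. g \<in> H \<Longrightarrow> matrix_inv g \<in> H"
    and g: "g \<in> diagonal_symmetries (polynomial_of (fermat_exponents d))"
    and char: "\<And>l. root_diagonal d l \<in> dual_group (fermat_exponents d) H \<Longrightarrow> diagonal_character l g = 1"
  shows "g \<in> H"
proof -
  let ?K = "{l. \<forall>i. l i < d i}"
  let ?V = "polynomial_of (fermat_exponents d)"
  let ?dual = "{l \<in> ?K. root_diagonal d l \<in> dual_group (fermat_exponents d) H}"
  have finH: "finite H" by (rule finite_subset[OF H finite_diagonal_symmetries_fermat[OF d]])
  have "?K = Pi\<^sub>E UNIV (\<lambda>i. {..<d i})" by (auto simp: PiE_UNIV_domain)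
  then have finK: "finite ?K" by (simp add: finite_PiE)
  have diag: "H \<subseteq> range diagonal"
    using H by (auto simp: diagonal_symmetries_fermat[OF d] root_diagonal_def)
  have inv_H: "invertible h" if "h \<in> H" for h
    using H that by (auto simp: diagonal_symmetries_def max_symmetries_def)
  have dual: "l \<in> ?dual \<longleftrightarrow> (\<forall>h\<in>H. diagonal_character l h = 1)" if l: "l \<in> ?K" for l
  proof -
    have "root_diagonal d l \<in> dual_group (fermat_exponents d) H
        \<longleftrightarrow> (\<forall>k. root_diagonal d k \<in> H \<longrightarrow> diagonal_character l (root_diagonal d k) = 1)"
      using l unfolding dual_group_fermat[OF d H] diagonal_symmetries_fermat[OF d]
      by (auto simp: diagonal_character_sym[of _ d l])
    also have "\<dots> \<longleftrightarrow> (\<forall>h\<in>H. diagonal_character l h = 1)"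
      using H by (fastforce simp: diagonal_symmetries_fermat[OF d])
    finally show ?thesis using l by simp
  qed
  have "(\<Sum>h\<in>H. \<Sum>l\<in>?K. diagonal_character l (g ** h))
      = (\<Sum>l\<in>?K. diagonal_character l g * (\<Sum>h\<in>H. diagonal_character l h))"
  proof -
    obtain k where k: "g = root_diagonal d k" using g by (auto simp: diagonal_symmetries_fermat[OF d])
    have "diagonal_character l (g ** h) = diagonal_character l g * diagonal_character l h"
      if "h \<in> H" for l h
      using subsetD[OF diag that] by (auto simp: k root_diagonal_def diagonal_character_mult)
    then show ?thesis
      unfolding sum_distrib_left by (subst sum.swap) (intro sum.cong refl, simp)
  qed
  also have "\<dots> = (\<Sum>l\<in>?K. if l \<in> ?dual then of_nat (card H) else 0)"
  proof (intro sum.cong refl)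
    fix l assume l: "l \<in> ?K"
    show "diagonal_character l g * (\<Sum>h\<in>H. diagonal_character l h)
      = (if l \<in> ?dual then of_nat (card H) else 0)"
    proof (cases "l \<in> ?dual")
      case True
      then have "diagonal_character l g = 1" using char by simp
      moreover have "(\<Sum>h\<in>H. diagonal_character l h) = (\<Sum>h\<in>H. 1)"
        using True dual[OF l] by (intro sum.cong) auto
      ultimately show ?thesis using True by simp
    next
      case False
      then obtain h where "h \<in> H" "diagonal_character l h \<noteq> 1" using dual[OF l] by blast
      then have "(\<Sum>h\<in>H. diagonal_character l h) = 0"
        using sum_diagonal_character_group[OF finH mult diag inv_H] by blast
      then show ?thesis by (simp only: if_not_P[OF False]) simp
    qed
  qed
  also have "\<dots> = of_nat (card ?dual * card H)"
    using finK by (simp add: sum.If_cases Int_def conj_commute)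
  finally have eq: "(\<Sum>h\<in>H. \<Sum>l\<in>?K. diagonal_character l (g ** h)) = of_nat (card ?dual * card H)" .
  have "diagonal_character (\<lambda>i. 0) h = 1" for h :: "complex^'n^'n"
    by (simp add: diagonal_character_def)
  then have mem: "(\<lambda>i. 0) \<in> ?dual" using dual[of "\<lambda>i. 0"] d by auto
  have "finite ?dual" using finK by simp
  with mem have "card ?dual \<noteq> 0" by (metis (lifting) card_0_eq empty_iff)
  moreover have "card H \<noteq> 0" using card_0_eq[OF finH] one by blast
  ultimately have "(\<Sum>h\<in>H. \<Sum>l\<in>?K. diagonal_character l (g ** h)) \<noteq> 0"
    unfolding eq by simp
  then obtain h where h: "h \<in> H" "(\<Sum>l\<in>?K. diagonal_character l (g ** h)) \<noteq> 0"
    by (metis (no_types, lifting) sum.neutral)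
  obtain k k' where k: "g = root_diagonal d k" "h = root_diagonal d k'"
    using g h(1) H by (auto simp: diagonal_symmetries_fermat[OF d] subset_iff)
  have "\<forall>i. int (d i) dvd int (k i + k' i)"
    using h(2) sum_characters[of d "\<lambda>i. int (k i + k' i)"] d
    unfolding k root_diagonal_add diagonal_character_root_diagonal
    by (metis (no_types, lifting))
  then have "g ** h = mat 1"
    unfolding k root_diagonal_add root_diagonal_eq_one_iff[OF d] by (simp only: int_dvd_int_iff) simp
  then have "g ** (h ** matrix_inv h) = matrix_inv h"
    by (simp add: matrix_mul_assoc)
  then have "g = matrix_inv h" using matrix_inv(1)[OF inv_H[OF h(1)]] by simp
  then show ?thesis using inv[OF h(1)] by simp
qed

section \<open>Age and fixed space of a diagonal symmetry\<close>

lemma age_diagonal: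
  assumes a: "\<And>i. 0 \<le> a i" "\<And>i. a i < 1"
  shows "age (diagonal (\<lambda>i. cis (2 * pi * a i))) = (\<Sum>i\<in>UNIV. a i)"
proof -
  let ?u = "\<lambda>i. cis (2 * pi * a i)"
  have "characteristic_polynomial (diagonal ?u) = (\<Prod>i\<in>UNIV. [:- ?u i, 1:])"
    unfolding characteristic_polynomial_def
    by (subst det_diagonal) (auto simp: diagonal_def mat_def map_matrix_def)
  then have "proots (characteristic_polynomial (diagonal ?u)) = (\<Sum>i\<in>UNIV. {# ?u i #})"
    by (simp add: proots_prod)
  then have "age (diagonal ?u) = (\<Sum>i\<in>UNIV. Arg2pi (?u i) / (2 * pi))"
    unfolding age_def
    by (simp add: sum_unfold_sum_mset image_mset.compositionality o_def)
  also have "\<dots> = (\<Sum>i\<in>UNIV. a i)"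
  proof (intro sum.cong refl)
    fix i
    have "Arg2pi (?u i) = 2 * pi * a i"
      using a[of i] by (intro Arg2pi_unique[of 1]) (auto simp: cis_conv_exp)
    then show "Arg2pi (?u i) / (2 * pi) = a i" by simp
  qed
  finally show ?thesis .
qed

lemma age_root_diagonal:
  assumes "\<And>i. k i < d i"
  shows "age (root_diagonal d k) = (\<Sum>i\<in>UNIV. of_nat (k i) / of_nat (d i))"
proof -
  have "of_nat (k i) / of_nat (d i) < (1::real)" for i using assms[of i] by simp
  then show ?thesis
    using age_diagonal[of "\<lambda>i. of_nat (k i) / of_nat (d i)"] by (simp add: root_diagonal_def)
qed

lemma age_one: "age (mat 1 :: complex^'n^'n) = 0"
  using age_diagonal[of "\<lambda>i :: 'n. 0"] by (simp add: diagonal_one)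

lemma age_inverse_root_diagonal:
  fixes d :: "'n::finite \<Rightarrow> nat"
  assumes k: "\<And>i. 0 < k i" "\<And>i. k i < d i"
  shows "age (matrix_inv (root_diagonal d k)) = of_nat CARD('n) - age (root_diagonal d k)"
proof -
  have d: "d i > 0" for i using k(2)[of i] by simp
  have "age (matrix_inv (root_diagonal d k)) = age (root_diagonal d (\<lambda>i. d i - k i))"
    by (simp add: matrix_inv_root_diagonal k(2))
  also have "\<dots> = (\<Sum>i\<in>UNIV. 1 - of_nat (k i) / of_nat (d i))"
    using k d by (subst age_root_diagonal)
      (auto intro!: sum.cong simp: of_nat_diff less_imp_le diff_divide_distrib)
  also have "\<dots> = of_nat CARD('n) - age (root_diagonal d k)"
    using k by (simp add: age_root_diagonal sum_subtractf)
  finally show ?thesis .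
qed

lemma fixed_space_one: "fixed_space (mat 1 :: complex^'n^'n) = UNIV"
  by (simp add: fixed_space_def)

lemma fixed_space_diagonal_zero_iff:
  "fixed_space (diagonal u) = {0} \<longleftrightarrow> (\<forall>i. u i \<noteq> 1)"
proof
  assume trivial: "fixed_space (diagonal u) = {0}"
  show "\<forall>i. u i \<noteq> 1"
  proof (intro allI notI)
    fix i assume "u i = 1"
    then have "axis i 1 \<in> fixed_space (diagonal u)"
      by (auto simp: fixed_space_def diagonal_vector axis_def vec_eq_iff)
    then show False by (simp add: trivial axis_eq_0_iff)
  qed
next
  assume "\<forall>i. u i \<noteq> 1"
  then show "fixed_space (diagonal u) = {0}"
    by (auto simp: fixed_space_def diagonal_vector vec_eq_iff)
qed

section \<open>Bigraded spaces of coefficients\<close>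

text \<open>The common model of all state spaces of the theorem: the functions on the exponents in \<open>S\<close> that are
  invariant under the permutations in \<open>P\<close>, where \<open>\<beta> b\<close> is the bidegree of the exponent \<open>b\<close>.\<close>

definition coefficient_space ::
    "('n \<Rightarrow> nat) set \<Rightarrow> ('n \<Rightarrow> 'n) set \<Rightarrow> (('n \<Rightarrow> nat) \<Rightarrow> real \<times> real) \<Rightarrow>
     (('n \<Rightarrow> nat) \<Rightarrow> complex) bigraded_space" where
  "coefficient_space S P \<beta> =
     (let C = {c. (\<forall>b. c b \<noteq> 0 \<longrightarrow> b \<in> S) \<and> (\<forall>p\<in>P. \<forall>b. c (b \<circ> p) = c b)}
      in \<lparr>carrier = C, vadd = (\<lambda>c c'. c + c'), vscale = (\<lambda>k c b. k * c b),
          component = (\<lambda>ab. {c \<in> C. \<forall>b. c b \<noteq> 0 \<longrightarrow> \<beta> b = ab})\<rparr>)"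

lemma bigraded_isoI:
  assumes inj: "inj_on \<phi> (carrier M)" and im: "\<phi> ` carrier M = carrier N"
    and add: "\<And>s t. s \<in> carrier M \<Longrightarrow> t \<in> carrier M \<Longrightarrow> \<phi> (vadd M s t) = vadd N (\<phi> s) (\<phi> t)"
    and scale: "\<And>c s. s \<in> carrier M \<Longrightarrow> \<phi> (vscale M c s) = vscale N c (\<phi> s)"
    and sub: "\<And>ab. component M ab \<subseteq> carrier M" "\<And>ab. component N ab \<subseteq> carrier N"
    and comp: "\<And>ab s. s \<in> carrier M \<Longrightarrow> \<phi> s \<in> component N ab \<longleftrightarrow> s \<in> component M ab"
  shows "bigraded_iso \<phi> M N"
proof -
  have "\<phi> ` component M ab = component N ab" for ab
  proof (intro subset_antisym subsetI)
    fix t assume "t \<in> \<phi> ` component M ab"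
    then show "t \<in> component N ab" using subsetD[OF sub(1)] comp by blast
  next
    fix t assume t: "t \<in> component N ab"
    then obtain s where "s \<in> carrier M" "t = \<phi> s" using subsetD[OF sub(2)] im by blast
    then show "t \<in> \<phi> ` component M ab" using comp t by blast
  qed
  then show ?thesis
    unfolding bigraded_iso_def bij_betw_def using inj im add scale by blast
qed

lemma bigraded_iso_comp:
  assumes "bigraded_iso \<phi> M N" "bigraded_iso \<psi> N L"
  shows "bigraded_iso (\<psi> \<circ> \<phi>) M L"
  unfolding bigraded_iso_def
proof (intro conjI ballI allI)
  have mem: "\<phi> s \<in> carrier N" if "s \<in> carrier M" for s
    using assms(1) that by (auto simp: bigraded_iso_def bij_betw_def)
  show "bij_betw (\<psi> \<circ> \<phi>) (carrier M) (carrier L)"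
    using assms by (auto simp: bigraded_iso_def intro: bij_betw_trans)
  show "(\<psi> \<circ> \<phi>) (vadd M s t) = vadd L ((\<psi> \<circ> \<phi>) s) ((\<psi> \<circ> \<phi>) t)"
    if "s \<in> carrier M" "t \<in> carrier M" for s t
    using assms that mem by (simp add: bigraded_iso_def)
  show "(\<psi> \<circ> \<phi>) (vscale M c s) = vscale L c ((\<psi> \<circ> \<phi>) s)" if "s \<in> carrier M" for c s
    using assms that mem by (simp add: bigraded_iso_def)
  show "(\<psi> \<circ> \<phi>) ` component M ab = component L ab" for ab
  proof -
    have "\<phi> ` component M ab = component N ab" "\<psi> ` component N ab = component L ab"
      using assms unfolding bigraded_iso_def by blast+
    then show ?thesis unfolding image_comp[symmetric] by simp
  qed
qed

lemma bigraded_iso_inv_into: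
  assumes iso: "bigraded_iso \<phi> M N"
    and add: "\<And>s t. s \<in> carrier M \<Longrightarrow> t \<in> carrier M \<Longrightarrow> vadd M s t \<in> carrier M"
    and scale: "\<And>c s. s \<in> carrier M \<Longrightarrow> vscale M c s \<in> carrier M"
    and component: "\<And>ab. component M ab \<subseteq> carrier M"
  shows "bigraded_iso (inv_into (carrier M) \<phi>) N M"
proof -
  let ?\<psi> = "inv_into (carrier M) \<phi>"
  have bij: "bij_betw \<phi> (carrier M) (carrier N)" using iso by (simp add: bigraded_iso_def)
  have mem: "?\<psi> s \<in> carrier M" "\<phi> (?\<psi> s) = s" if "s \<in> carrier N" for s
    using bij that by (auto simp: bij_betw_def inv_into_into f_inv_into_f)
  have left: "?\<psi> (\<phi> s) = s" if "s \<in> carrier M" for s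
    using bij that by (rule bij_betw_inv_into_left)
  have "?\<psi> (vadd N s t) = vadd M (?\<psi> s) (?\<psi> t)" if "s \<in> carrier N" "t \<in> carrier N" for s t
  proof -
    have "vadd N s t = \<phi> (vadd M (?\<psi> s) (?\<psi> t))"
      using iso that mem by (simp add: bigraded_iso_def)
    then show ?thesis using that mem add left by simp
  qed
  moreover have "?\<psi> (vscale N c s) = vscale M c (?\<psi> s)" if "s \<in> carrier N" for c s
  proof -
    have "vscale N c s = \<phi> (vscale M c (?\<psi> s))"
      using iso that mem by (simp add: bigraded_iso_def)
    then show ?thesis using that mem scale left by simp
  qed
  moreover have "?\<psi> ` component N ab = component M ab" for ab
  proof -
    have "\<phi> ` component M ab = component N ab"
      using iso unfolding bigraded_iso_def by blast
    then have "?\<psi> ` component N ab = ?\<psi> ` \<phi> ` component M ab" by simp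
    also have "\<dots> = (\<lambda>s. s) ` component M ab"
      unfolding image_image using subsetD[OF component] left by (intro image_cong refl) blast
    finally show ?thesis by simp
  qed
  ultimately show ?thesis
    unfolding bigraded_iso_def using bij_betw_inv_into[OF bij] by blast
qed

lemma bigraded_iso_via_coefficients:
  assumes "bigraded_iso \<phi> (coefficient_space S P \<beta>) M" "bigraded_iso \<psi> (coefficient_space S P \<beta>) N"
  shows "\<exists>\<theta>. bigraded_iso \<theta> M N"
proof -
  have "bigraded_iso (inv_into (carrier (coefficient_space S P \<beta>)) \<phi>) M (coefficient_space S P \<beta>)"
    using assms(1) by (rule bigraded_iso_inv_into)
      (auto simp: coefficient_space_def Let_def, metis add.right_neutral)
  from bigraded_iso_comp[OF this assms(2)] show ?thesis by blast
qed

lemma coefficient_space_cong: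
  assumes "S = S'" "P = P'" "\<And>b. b \<in> S \<Longrightarrow> \<beta> b = \<beta>' b"
  shows "coefficient_space S P \<beta> = coefficient_space S' P' \<beta>'"
proof -
  have "(\<forall>b. c b \<noteq> 0 \<longrightarrow> \<beta> b = ab) \<longleftrightarrow> (\<forall>b. c b \<noteq> 0 \<longrightarrow> \<beta>' b = ab)"
    if "\<forall>b. c b \<noteq> 0 \<longrightarrow> b \<in> S" for c :: "('a \<Rightarrow> nat) \<Rightarrow> complex" and ab
    using that assms(3) by auto
  then show ?thesis
    unfolding coefficient_space_def Let_def assms(1,2)[symmetric] by (auto simp: fun_eq_iff)
qed

section \<open>Milnor classes\<close>

definition milnor_class :: "('n::finite \<Rightarrow> nat) \<Rightarrow> (complex^'n \<Rightarrow> complex) \<Rightarrow> 'n form set" where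
  "milnor_class d f = volume f +o jacobian_forms (polynomial_of (fermat_exponents d)) UNIV"

definition box_polynomial :: "('n::finite \<Rightarrow> nat) \<Rightarrow> (('n \<Rightarrow> nat) \<Rightarrow> complex) \<Rightarrow> complex^'n \<Rightarrow> complex" where
  "box_polynomial d c x = (\<Sum>b\<in>milnor_box d. c b * monomial b x)"

lemma box_polynomial_polynomial: "box_polynomial d c \<in> polynomial_functions"
  unfolding box_polynomial_def[abs_def]
  by (intro polynomial_functions_sum polynomial_functions_scale monomial_polynomial)

lemma coefficient_box_polynomial:
  "coefficient (box_polynomial d c) b = (if b \<in> milnor_box d then c b else 0)"
  unfolding box_polynomial_def[abs_def] by (rule coefficient_monomial_sum[OF finite_milnor_box])

lemma polynomial_functions_diff:
  assumes "f \<in> polynomial_functions" "h \<in> polynomial_functions"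
  shows "(\<lambda>x. f x - h x) \<in> polynomial_functions"
  using polynomial_functions.add[OF assms(1) polynomial_functions_scale[OF assms(2), of "-1"]] by simp

lemma volume_in_jacobian_forms_iff:
  "volume f \<in> jacobian_forms V UNIV \<longleftrightarrow> f \<in> jacobian_ideal V UNIV"
  unfolding jacobian_forms_UNIV by (auto simp: volume_eq_iff)

lemma milnor_class_eq_iff:
  fixes d :: "'n::finite \<Rightarrow> nat"
  assumes d: "\<And>i. d i \<ge> 2" and f: "f \<in> polynomial_functions" and h: "h \<in> polynomial_functions"
  shows "milnor_class d f = milnor_class d h
    \<longleftrightarrow> (\<forall>b\<in>milnor_box d. coefficient f b = coefficient h b)"
  unfolding milnor_class_def coset_eq_iff[OF vec.subspace_UNIV] volume_diff
    volume_in_jacobian_forms_iff jacobian_ideal_fermat[OF d]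
  using polynomial_functions_diff[OF f h] by (simp add: coefficient_diff[OF f h])

lemma milnor_class_box_polynomial:
  assumes d: "\<And>i. d i \<ge> 2" and f: "f \<in> polynomial_functions"
  shows "milnor_class d (box_polynomial d (coefficient f)) = milnor_class d f"
  using milnor_class_eq_iff[OF d box_polynomial_polynomial f]
  by (simp add: coefficient_box_polynomial)

lemma milnor_class_zero: "milnor_class d (\<lambda>x. 0) = jacobian_forms (polynomial_of (fermat_exponents d)) UNIV"
  by (simp add: milnor_class_def volume_def form_on_zero)

lemma sector_one:
  "sector (polynomial_of (fermat_exponents d)) (mat 1) = milnor_class d ` polynomial_functions"
  unfolding sector_def fixed_space_one top_forms_UNIV milnor_class_def by auto

lemma pullback_milnor_class:
  fixes m :: "complex^'n^'n"
  assumes m: "invertible m"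
    and V: "\<And>x. polynomial_of (fermat_exponents d) (m *v x) = polynomial_of (fermat_exponents d) x"
  shows "pullback m ` milnor_class d f = milnor_class d (\<lambda>x. det m * f (m *v x))"
proof -
  let ?J = "jacobian_forms (polynomial_of (fermat_exponents d)) (UNIV :: (complex^'n) set)"
  have "range ((*v) m) = UNIV"
    using matrix_inv(1)[OF m] by (metis matrix_vector_mul_assoc matrix_vector_mul_lid surjI)
  then have J: "pullback m ` ?J = ?J"
    using pullback_jacobian_forms[of m "polynomial_of (fermat_exponents d)" UNIV] m V by simp
  have add: "pullback m (\<eta> + \<theta>) = pullback m \<eta> + pullback m \<theta>" for \<eta> \<theta> :: "'n form"
    by (simp add: pullback_def fun_eq_iff)
  have "pullback m ` (volume f +o ?J) = (\<lambda>\<theta>. pullback m (volume f + \<theta>)) ` ?J"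
    by (auto simp: elt_set_plus_def image_iff)
  also have "\<dots> = pullback m (volume f) +o pullback m ` ?J"
    by (auto simp: elt_set_plus_def image_iff add)
  finally show ?thesis
    unfolding milnor_class_def by (simp only: J pullback_volume)
qed

text \<open>The determinant, which is the factor for the volume form, raises every exponent by one.\<close>

lemma pullback_milnor_class_diagonal:
  assumes d: "\<And>i. d i \<ge> 2" and h: "diagonal u \<in> diagonal_symmetries (polynomial_of (fermat_exponents d))"
    and f: "f \<in> polynomial_functions"
  shows "pullback (diagonal u) ` milnor_class d f = milnor_class d f
    \<longleftrightarrow> (\<forall>b\<in>milnor_box d. coefficient f b \<noteq> 0 \<longrightarrow> diagonal_character (Suc \<circ> b) (diagonal u) = 1)"
proof -
  have h': "invertible (diagonal u)"
    "\<And>x. polynomial_of (fermat_exponents d) (diagonal u *v x) = polynomial_of (fermat_exponents d) x"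
    using h by (auto simp: diagonal_symmetries_def max_symmetries_def)
  have poly: "(\<lambda>x. f (diagonal u *v x)) \<in> polynomial_functions"
    by (rule polynomial_functions_matrix[OF f])
  have "coefficient (\<lambda>x. det (diagonal u) * f (diagonal u *v x)) b
      = diagonal_character (Suc \<circ> b) (diagonal u) * coefficient f b" for b
    unfolding coefficient_scale[OF poly] unfolding diagonal_vector coefficient_scale_variables[OF f]
    by (simp add: det_diagonal_matrix diagonal_character_def prod.distrib)
  then show ?thesis
    unfolding pullback_milnor_class[OF h']
    by (subst milnor_class_eq_iff[OF d polynomial_functions_scale[OF poly] f]) auto
qed

text \<open>Since \<open>p\<close> is even, its matrix has determinant \<open>1\<close> and does not change the volume form.\<close>

lemma pullback_milnor_class_permutation:
  assumes d: "\<And>i. d i \<ge> 2" and p: "p permutes UNIV" "evenperm p"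
    and sym: "permutation_matrix p \<in> max_symmetries (polynomial_of (fermat_exponents d))"
    and f: "f \<in> polynomial_functions"
  shows "pullback (permutation_matrix p) ` milnor_class d f = milnor_class d f
    \<longleftrightarrow> (\<forall>b\<in>milnor_box d. coefficient f (b \<circ> p) = coefficient f b)"
proof -
  have sym': "invertible (permutation_matrix p)"
    "\<And>x. polynomial_of (fermat_exponents d) (permutation_matrix p *v x) = polynomial_of (fermat_exponents d) x"
    using sym by (auto simp: max_symmetries_def)
  have poly: "(\<lambda>x. f (permutation_matrix p *v x)) \<in> polynomial_functions"
    by (rule polynomial_functions_matrix[OF f])
  have "det (permutation_matrix p) = 1"
    using det_permutation_matrix[OF p(1)] p(2) by (simp add: sign_def)
  then have "coefficient (\<lambda>x. det (permutation_matrix p) * f (permutation_matrix p *v x)) b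
      = coefficient f (b \<circ> p)" for b
    unfolding coefficient_scale[OF poly] unfolding permutation_matrix_vector coefficient_permute[OF f p(1)]
    by simp
  then show ?thesis
    unfolding pullback_milnor_class[OF sym']
    by (subst milnor_class_eq_iff[OF d polynomial_functions_scale[OF poly] f]) auto
qed

section \<open>Weighted degree\<close>

text \<open>The weighted degree of $x^b\,dx_1 \wedge \dots \wedge dx_N$.\<close>

definition shifted_degree :: "('n::finite \<Rightarrow> nat) \<Rightarrow> ('n \<Rightarrow> nat) \<Rightarrow> real" where
  "shifted_degree d b = (\<Sum>i\<in>UNIV. of_nat (Suc (b i)) / of_nat (d i))"

lemma dilation_eq: "dilation q t x = diagonal (\<lambda>i. exp (of_rat (q i) * t)) *v x"
  by (simp add: dilation_def diagonal_vector)

lemma weighted_degree_iff: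
  "weighted_degree q \<eta> r \<longleftrightarrow>
    (\<forall>t. pullback (diagonal (\<lambda>i. exp (of_rat (q i) * t))) \<eta> = (\<lambda>x vs. exp (of_real r * t) * \<eta> x vs))"
  by (auto simp: weighted_degree_def pullback_def dilation_eq[abs_def] fun_eq_iff)

lemma weighted_degree_volume_iff:
  "weighted_degree q (volume f) r \<longleftrightarrow>
    (\<forall>t x. (\<Prod>i\<in>UNIV. exp (of_rat (q i) * t)) * f (\<chi> i. exp (of_rat (q i) * t) * x $ i)
      = exp (of_real r * t) * f x)"
  unfolding weighted_degree_iff pullback_volume volume_scale volume_eq_iff det_diagonal_matrix
    diagonal_vector by (auto simp: fun_eq_iff)

lemma prod_exp_weights:
  fixes d :: "'n::finite \<Rightarrow> nat"
  shows "(\<Prod>i\<in>UNIV. exp (of_rat (1 / of_nat (d i)) * t)) * (\<Prod>i\<in>UNIV. exp (of_rat (1 / of_nat (d i)) * t) ^ b i)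
    = exp (of_real (shifted_degree d b) * t :: complex)"
proof -
  have "(\<Prod>i\<in>UNIV. exp (of_rat (1 / of_nat (d i)) * t)) * (\<Prod>i\<in>UNIV. exp (of_rat (1 / of_nat (d i)) * t) ^ b i)
      = (\<Prod>i\<in>UNIV. exp (of_rat (1 / of_nat (d i)) * t) ^ Suc (b i))"
    by (simp add: prod.distrib)
  also have "\<dots> = (\<Prod>i\<in>UNIV. exp (of_nat (Suc (b i)) / of_nat (d i) * t))"
    by (intro prod.cong refl) (simp only: exp_of_nat_mult[symmetric], simp add: of_rat_divide)
  also have "\<dots> = exp (of_real (shifted_degree d b) * t)"
    by (simp add: shifted_degree_def exp_sum sum_distrib_right)
  finally show ?thesis .
qed

text \<open>Comparing coefficients for the dilation with parameter \<open>t = 1\<close> suffices, because the real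
  exponential function is injective.\<close>

lemma weighted_degree_coefficient:
  fixes d :: "'n::finite \<Rightarrow> nat"
  assumes f: "f \<in> polynomial_functions" and deg: "weighted_degree (\<lambda>i. 1 / of_nat (d i)) (volume f) r"
    and b: "coefficient f b \<noteq> 0"
  shows "shifted_degree d b = r"
proof -
  let ?u = "\<lambda>i. exp (of_rat (1 / of_nat (d i)) * 1) :: complex"
  have poly: "(\<lambda>x. f (\<chi> i. ?u i * x $ i)) \<in> polynomial_functions"
    using polynomial_functions_matrix[OF f, of "diagonal ?u"] by (simp add: diagonal_vector)
  have "(\<lambda>x. (\<Prod>i\<in>UNIV. ?u i) * f (\<chi> i. ?u i * x $ i)) = (\<lambda>x. exp (of_real r * 1) * f x)"
    using deg unfolding weighted_degree_volume_iff by blast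
  then have "coefficient (\<lambda>x. (\<Prod>i\<in>UNIV. ?u i) * f (\<chi> i. ?u i * x $ i)) b
      = coefficient (\<lambda>x. exp (of_real r * 1) * f x) b" by (rule arg_cong)
  then have "exp (of_real (shifted_degree d b) * 1 :: complex) = exp (of_real r * 1)"
    unfolding coefficient_scale[OF poly] coefficient_scale[OF f] coefficient_scale_variables[OF f]
    unfolding mult.assoc[symmetric] prod_exp_weights using b by simp
  then have "complex_of_real (exp (shifted_degree d b)) = of_real (exp r)"
    by (simp add: exp_of_real)
  then show ?thesis by (simp only: of_real_eq_iff exp_inj_iff)
qed

lemma weighted_degree_box_polynomial:
  fixes d :: "'n::finite \<Rightarrow> nat"
  assumes "\<And>b. b \<in> milnor_box d \<Longrightarrow> c b \<noteq> 0 \<Longrightarrow> shifted_degree d b = r"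
  shows "weighted_degree (\<lambda>i. 1 / of_nat (d i)) (volume (box_polynomial d c)) r"
  unfolding weighted_degree_volume_iff
proof (intro allI)
  fix t :: complex and x :: "complex^'n"
  let ?u = "\<lambda>i. exp (of_rat (1 / of_nat (d i)) * t) :: complex"
  have "(\<Prod>i\<in>UNIV. ?u i) * (c b * monomial b (\<chi> i. ?u i * x $ i)) = exp (of_real r * t) * (c b * monomial b x)"
    if b: "b \<in> milnor_box d" for b
  proof (cases "c b = 0")
    case False
    have "monomial b (\<chi> i. ?u i * x $ i) = (\<Prod>i\<in>UNIV. ?u i ^ b i) * monomial b x"
      by (simp add: monomial_def power_mult_distrib prod.distrib)
    then have "(\<Prod>i\<in>UNIV. ?u i) * (c b * monomial b (\<chi> i. ?u i * x $ i))
        = ((\<Prod>i\<in>UNIV. ?u i) * (\<Prod>i\<in>UNIV. ?u i ^ b i)) * (c b * monomial b x)"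
      by (simp only: mult_ac)
    then show ?thesis
      unfolding prod_exp_weights using assms[OF b False] by simp
  qed simp
  then show "(\<Prod>i\<in>UNIV. ?u i) * box_polynomial d c (\<chi> i. ?u i * x $ i)
      = exp (of_real r * t) * box_polynomial d c x"
    unfolding box_polynomial_def sum_distrib_left by (intro sum.cong) auto
qed

section \<open>Forms on a point\<close>

text \<open>The forms of degree \<open>0\<close> on the space \<open>{0}\<close>, extended by zero.\<close>

definition point_form :: "complex \<Rightarrow> ('n::finite) form" where
  "point_form c = (\<lambda>x vs. if x = 0 \<and> vs = [] then c else 0)"

lemma point_form_eq_iff: "point_form c = point_form c' \<longleftrightarrow> c = c'"
  by (auto simp: point_form_def fun_eq_iff)

lemma point_form_zero: "point_form 0 = 0"
  by (auto simp: point_form_def fun_eq_iff)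

lemma linear_coordinates_point: "linear_coordinates {0 :: complex^'n} []"
  by (auto simp: linear_coordinates_def bij_betw_def)

lemma wedge_Nil: "wedge [] vs = 1"
proof -
  have "{p. p permutes ({} :: nat set)} = {id}" by (auto simp: fun_eq_iff)
  then show ?thesis unfolding wedge_def by simp
qed

lemma form_on_point: "form_on {0 :: complex^'n} f (wedge []) = point_form (f 0)"
  by (auto simp: form_on_def point_form_def wedge_Nil fun_eq_iff)

lemma top_forms_point: "top_forms {0 :: complex^'n} = range point_form"
proof -
  have "\<exists>f\<in>polynomial_functions. point_form c = point_form (f (0 :: complex^'n))" for c
    by (rule bexI[OF _ polynomial_functions.const[of c]]) simp
  then show ?thesis
    unfolding top_forms_eq[OF vec.subspace_single_0 linear_coordinates_point] form_on_point by auto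
qed

lemma jacobian_forms_point: "jacobian_forms V {0 :: complex^'n} = {0}"
proof -
  have "f 0 = 0" if "f \<in> jacobian_ideal V {0 :: complex^'n}" for f
  proof -
    have "derivative_along V 0 x = 0" for x by (simp add: derivative_along_def)
    moreover obtain S a where "S \<subseteq> {0}" "f = (\<lambda>x. \<Sum>e\<in>S. a e x * derivative_along V e x)"
      using \<open>f \<in> jacobian_ideal V {0}\<close> unfolding jacobian_ideal_def by blast
    ultimately show ?thesis by (auto intro!: sum.neutral)
  qed
  note vanish = this
  have "point_form (f 0) = (0 :: 'n form)" if "f \<in> jacobian_ideal V {0 :: complex^'n}" for f
    using vanish[OF that] by (simp only: point_form_zero)
  then have "jacobian_forms V {0 :: complex^'n} \<subseteq> {0}"
    unfolding jacobian_forms_eq[OF vec.subspace_single_0 linear_coordinates_point] form_on_point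
    by blast
  then show ?thesis
    using zero_jacobian_form[OF vec.subspace_single_0] by blast
qed

lemma coset_point: "\<eta> +o {0} = {\<eta> :: ('n::finite) form}"
  by (auto simp: elt_set_plus_def)

lemma sector_point:
  "fixed_space g = {0} \<Longrightarrow> sector V g = range (\<lambda>c. {point_form c})"
  unfolding sector_def by (auto simp: jacobian_forms_point top_forms_point coset_point)

lemma pullback_point_form:
  assumes "invertible m"
  shows "pullback m (point_form c) = point_form c"
proof -
  have "m *v x = 0 \<longleftrightarrow> x = 0" for x
    using inj_invertible[OF assms, of UNIV] by (metis injD matrix_vector_mult_0_right)
  then show ?thesis by (auto simp: pullback_def point_form_def fun_eq_iff)
qed

lemma weighted_degree_point_form:
  fixes q :: "'n::finite \<Rightarrow> rat"
  assumes "weighted_degree q (point_form c) r" "c \<noteq> 0"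
  shows "r = 0"
proof -
  have "point_form c (dilation q 1 (0 :: complex^'n)) (map (dilation q 1) []) = exp (of_real r * 1) * point_form c (0 :: complex^'n) []"
    using assms(1)[unfolded weighted_degree_def, rule_format, of 1 0 "[]"] .
  then have "complex_of_real (exp r) = of_real (exp 0)"
    using assms(2) by (simp add: point_form_def dilation_eq exp_of_real)
  then show ?thesis by (simp only: of_real_eq_iff exp_inj_iff)
qed

lemma weighted_degree_point_form_zero: "weighted_degree q (point_form c) 0"
proof -
  have "invertible (diagonal (\<lambda>i. exp (of_rat (q i) * t)))" for t
    by (simp add: invertible_det_nz det_diagonal_matrix)
  then show ?thesis by (simp add: weighted_degree_iff pullback_point_form)
qed

section \<open>States of a group that splits into diagonal matrices and permutations\<close>

lemma inv_general_linear:
  assumes "invertible g"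
  shows "inv\<^bsub>general_linear\<^esub> g = matrix_inv g"
  unfolding m_inv_def
proof (rule the_equality)
  show "matrix_inv g \<in> carrier general_linear \<and> g \<otimes>\<^bsub>general_linear\<^esub> matrix_inv g = \<one>\<^bsub>general_linear\<^esub>
      \<and> matrix_inv g \<otimes>\<^bsub>general_linear\<^esub> g = \<one>\<^bsub>general_linear\<^esub>"
    using assms by (simp add: general_linear_def matrix_inv invertible_matrix_inv)
qed (auto simp: general_linear_def matrix_inv_eqI)

lemma set_mult_general_linear: "A <#>\<^bsub>general_linear\<^esub> B = {a ** b | a b. a \<in> A \<and> b \<in> B}"
  by (auto simp: set_mult_def general_linear_def)

text \<open>The dual group $G^\star$ inherits these properties from $G$, so that every fact proved here holds for both
  groups.\<close>

locale split_symmetry_group =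
  fixes d :: "'n::finite \<Rightarrow> nat" and \<Gamma> :: "(complex^'n^'n) set"
  assumes d: "\<And>i. d i \<ge> 2"
    and subgroup: "subgroup \<Gamma> general_linear"
    and symmetries: "\<Gamma> \<subseteq> max_symmetries (polynomial_of (fermat_exponents d))"
    and split: "\<Gamma> = (\<Gamma> \<inter> diagonal_symmetries (polynomial_of (fermat_exponents d)))
      <#>\<^bsub>general_linear\<^esub> (\<Gamma> \<inter> even_permutations)"
begin

abbreviation "V \<equiv> polynomial_of (fermat_exponents d)"

definition "\<Delta> = \<Gamma> \<inter> diagonal_symmetries V"

definition "permutations = {p. p permutes UNIV \<and> evenperm p \<and> permutation_matrix p \<in> \<Gamma>}"

abbreviation "null_class g \<equiv> jacobian_forms V (fixed_space g)"

lemma d_pos: "d i > 0"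
  using d[of i] by simp

lemma invertible: "g \<in> \<Gamma> \<Longrightarrow> invertible g"
  using symmetries by (auto simp: max_symmetries_def)

lemma preserves: "g \<in> \<Gamma> \<Longrightarrow> V (g *v x) = V x"
  using symmetries by (auto simp: max_symmetries_def)

lemma one_mem: "mat 1 \<in> \<Gamma>"
  using subgroup.one_closed[OF subgroup] by (simp add: general_linear_def)

lemma mult_mem: "g \<in> \<Gamma> \<Longrightarrow> h \<in> \<Gamma> \<Longrightarrow> g ** h \<in> \<Gamma>"
  using subgroup.m_closed[OF subgroup] by (simp add: general_linear_def)

lemma inv_mem: "g \<in> \<Gamma> \<Longrightarrow> matrix_inv g \<in> \<Gamma>"
  using subgroup.m_inv_closed[OF subgroup] by (simp add: inv_general_linear invertible)

lemma matrix_inv_inv: "g \<in> \<Gamma> \<Longrightarrow> matrix_inv (matrix_inv g) = g"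
  by (simp add: matrix_inv_eqI matrix_inv invertible)

lemma conjugate_mem_iff:
  assumes "g \<in> \<Gamma>"
  shows "matrix_inv g ** h ** g \<in> \<Gamma> \<longleftrightarrow> h \<in> \<Gamma>"
proof
  assume "matrix_inv g ** h ** g \<in> \<Gamma>"
  then have "g ** (matrix_inv g ** h ** g) ** matrix_inv g \<in> \<Gamma>"
    using assms by (blast intro: mult_mem inv_mem)
  moreover have "g ** (matrix_inv g ** h ** g) ** matrix_inv g
      = (g ** matrix_inv g) ** h ** (g ** matrix_inv g)"
    by (simp add: matrix_mul_assoc)
  ultimately show "h \<in> \<Gamma>"
    by (simp add: matrix_inv invertible[OF assms])
qed (use assms in \<open>intro mult_mem inv_mem\<close>)

lemma conjugate_eq_one_iff:
  assumes "g \<in> \<Gamma>"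
  shows "matrix_inv g ** h ** g = mat 1 \<longleftrightarrow> h = mat 1"
proof
  assume *: "matrix_inv g ** h ** g = mat 1"
  have "h = (g ** matrix_inv g) ** h ** (g ** matrix_inv g)"
    by (simp add: matrix_inv invertible[OF assms])
  also have "\<dots> = g ** (matrix_inv g ** h ** g) ** matrix_inv g"
    by (simp add: matrix_mul_assoc)
  finally show "h = mat 1"
    by (simp add: * matrix_inv invertible[OF assms])
qed (simp add: matrix_inv invertible[OF assms])

lemma mem_iff: "g \<in> \<Gamma> \<longleftrightarrow> (\<exists>h\<in>\<Delta>. \<exists>p\<in>permutations. g = h ** permutation_matrix p)"
proof -
  have "g \<in> \<Gamma> \<longleftrightarrow> g \<in> \<Delta> <#>\<^bsub>general_linear\<^esub> (\<Gamma> \<inter> even_permutations)"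
    using split unfolding \<Delta>_def by blast
  then show ?thesis
    unfolding set_mult_general_linear even_permutations_eq permutations_def by blast
qed

lemma permutation_mem: "p \<in> permutations \<Longrightarrow> permutation_matrix p \<in> \<Gamma>"
  by (simp add: permutations_def)

lemma permutation_preserves_exponents: 
  assumes "p \<in> permutations"
  shows "d (p i) = d i"
proof -
  have "permutation_matrix p \<in> max_symmetries V"
    using permutation_mem[OF assms] symmetries by blast
  moreover have "permutation_matrix p $ i $ p i \<noteq> (0 :: complex)"
    by (simp add: permutation_matrix_def)
  ultimately have "weights V i = weights V (p i)"
    by (auto simp: max_symmetries_def)
  then show ?thesis
    using d_pos[of i] d_pos[of "p i"] by (simp add: weights_fermat d_pos)
qed

lemma permutation_inv:
  assumes "p \<in> permutations"
  shows "inv_into UNIV p \<in> permutations" "p \<circ> inv_into UNIV p = id" "inv_into UNIV p \<circ> p = id"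
    "matrix_inv (permutation_matrix p) = permutation_matrix (inv_into UNIV p)"
proof -
  have p: "p permutes UNIV" "evenperm p" using assms by (auto simp: permutations_def)
  show comp: "p \<circ> inv_into UNIV p = id" "inv_into UNIV p \<circ> p = id"
    using permutes_inv_o[OF p(1)] by auto
  show inv: "matrix_inv (permutation_matrix p) = permutation_matrix (inv_into UNIV p)"
    by (rule matrix_inv_eqI) (simp add: permutation_matrix_mult comp permutation_matrix_id)
  have "permutation_matrix (inv_into UNIV p) \<in> \<Gamma>"
    using inv_mem[OF permutation_mem[OF assms]] by (simp add: inv)
  then show "inv_into UNIV p \<in> permutations"
    using p permutes_inv[OF p(1)] evenperm_inv[of p] permutes_imp_permutation[of UNIV p]
    by (simp add: permutations_def)
qed

text \<open>The two matrices are conjugate by the permutation matrix of \<open>p\<close>, which lies in \<open>\<Gamma>\<close>.\<close>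

lemma root_diagonal_permute_mem_iff:
  assumes p: "p \<in> permutations"
  shows "root_diagonal d (k \<circ> p) \<in> \<Gamma> \<longleftrightarrow> root_diagonal d k \<in> \<Gamma>"
proof -
  let ?P = "permutation_matrix p :: complex^'n^'n"
  have "matrix_inv ?P ** root_diagonal d (k \<circ> p) ** ?P = matrix_inv ?P ** (?P ** root_diagonal d k)"
    by (simp add: matrix_mul_assoc[symmetric] root_diagonal_permutation_matrix
        permutation_preserves_exponents[OF p])
  also have "\<dots> = root_diagonal d k"
    by (simp add: matrix_mul_assoc matrix_inv invertible permutation_mem[OF p])
  finally show ?thesis
    using conjugate_mem_iff[OF permutation_mem[OF p], of "root_diagonal d (k \<circ> p)"] by simp
qed

lemma \<Delta>_subset: "\<Delta> \<subseteq> {root_diagonal d k | k. \<forall>i. k i < d i}"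
  unfolding \<Delta>_def diagonal_symmetries_fermat[OF d_pos] by blast

lemma \<Delta>_diagonal_symmetries: "\<Delta> \<subseteq> diagonal_symmetries V"
  by (simp add: \<Delta>_def)

lemma root_diagonal_diagonal_symmetry: "root_diagonal d k \<in> diagonal_symmetries V"
proof -
  have "root_diagonal d (\<lambda>i. d i * (k i div d i)) = mat 1"
    by (simp add: root_diagonal_eq_one_iff[OF d_pos])
  then have "root_diagonal d k = root_diagonal d (\<lambda>i. k i mod d i)"
    using root_diagonal_add[of d "\<lambda>i. k i mod d i" "\<lambda>i. d i * (k i div d i)"] by simp
  then show ?thesis
    unfolding diagonal_symmetries_fermat[OF d_pos]
    using d_pos by (intro CollectI exI[of _ "\<lambda>i. k i mod d i"]) simp
qed

lemma root_diagonal_mem_\<Delta>_iff: "root_diagonal d k \<in> \<Delta> \<longleftrightarrow> root_diagonal d k \<in> \<Gamma>"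
  by (simp add: \<Delta>_def root_diagonal_diagonal_symmetry)

lemma one_\<Delta>: "mat 1 \<in> \<Delta>"
  using root_diagonal_mem_\<Delta>_iff[of "\<lambda>i. 0"] root_diagonal_eq_one_iff[of d "\<lambda>i. 0"] d_pos one_mem
  by simp

lemma mult_\<Delta>:
  assumes "g \<in> \<Delta>" "h \<in> \<Delta>"
  shows "g ** h \<in> \<Delta>"
proof -
  obtain k l where "g = root_diagonal d k" "h = root_diagonal d l"
    using assms \<Delta>_subset by blast
  then show ?thesis
    using assms mult_mem by (simp add: root_diagonal_add root_diagonal_mem_\<Delta>_iff[symmetric])
      (metis root_diagonal_add root_diagonal_mem_\<Delta>_iff)
qed

lemma inv_\<Delta>:
  assumes "g \<in> \<Delta>"
  shows "matrix_inv g \<in> \<Delta>"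
proof -
  obtain k where k: "\<And>i. k i < d i" "g = root_diagonal d k" using assms \<Delta>_subset by blast
  then show ?thesis
    using inv_mem[of g] assms root_diagonal_mem_\<Delta>_iff by (simp add: matrix_inv_root_diagonal)
qed

lemma box_permute_iff:
  assumes p: "p \<in> permutations"
  shows "b \<circ> p \<in> milnor_box d \<longleftrightarrow> b \<in> milnor_box d"
proof -
  have "surj p" using p permutes_surj[of p UNIV] by (simp add: permutations_def)
  have "b \<circ> p \<in> milnor_box d \<longleftrightarrow> (\<forall>i. b (p i) + 2 \<le> d (p i))"
    by (simp add: milnor_box_def permutation_preserves_exponents[OF p])
  also have "\<dots> \<longleftrightarrow> b \<in> milnor_box d"
  proof
    assume *: "\<forall>i. b (p i) + 2 \<le> d (p i)"
    have "b j + 2 \<le> d j" for j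
      using * surjD[OF \<open>surj p\<close>, of j] by blast
    then show "b \<in> milnor_box d" by (simp add: milnor_box_def)
  qed (simp add: milnor_box_def)
  finally show ?thesis .
qed

lemma null_class_in_sector: "null_class g \<in> sector V g"
  unfolding sector_def
  using zero_top_form[OF subspace_fixed_space] by (intro CollectI exI[of _ 0]) simp

lemma null_class_plus: "null_class g + null_class g = null_class g"
  by (rule jacobian_forms_plus[OF subspace_fixed_space])

lemma null_class_scale: "(\<lambda>\<eta> x vs. c * \<eta> x vs) ` null_class g + null_class g = null_class g"
proof -
  have "(\<lambda>x vs. c * (0 :: 'n form) x vs) = 0" by (simp add: fun_eq_iff)
  then show ?thesis using coset_scale[OF subspace_fixed_space, of c 0 V g] by simp
qed

lemma pullback_null_class:
  "g \<in> \<Gamma> \<Longrightarrow> pullback (matrix_inv g) ` null_class (matrix_inv g ** h ** g) = null_class h"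
  by (rule pullback_zero_class) (simp_all add: invertible preserves)

lemma supported_on_simps:
  "carrier (supported_on V \<Gamma> S (state_space bideg V \<Gamma>))
    = {s \<in> invariant_states V \<Gamma>. \<forall>g\<in>\<Gamma> - S. s g = null_class g}"
  "vadd (supported_on V \<Gamma> S (state_space bideg V \<Gamma>)) = (\<lambda>s t. s + t)"
  "vscale (supported_on V \<Gamma> S (state_space bideg V \<Gamma>))
    = (\<lambda>c s g. (\<lambda>\<eta> x vs. c * \<eta> x vs) ` s g + null_class g)"
  "component (supported_on V \<Gamma> S (state_space bideg V \<Gamma>)) ab
    = {s \<in> invariant_states V \<Gamma>. (\<forall>g\<in>\<Gamma>. s g \<in> sector_component bideg V g ab)
        \<and> (\<forall>g\<in>\<Gamma> - S. s g = null_class g)}"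
  by (auto simp: supported_on_def state_space_def Let_def)

section \<open>The untwisted sector\<close>

definition untwisted_state :: "(('n \<Rightarrow> nat) \<Rightarrow> complex) \<Rightarrow> 'n state" where
  "untwisted_state c = (\<lambda>g. if g = mat 1 then milnor_class d (box_polynomial d c)
     else if g \<in> \<Gamma> then null_class g else {})"

text \<open>By \<open>pullback_milnor_class_diagonal\<close> these are the \<open>b\<close> for which the monomial form with exponent \<open>b\<close>
  is invariant under \<open>\<Delta>\<close>.\<close>

definition "invariant_exponents =
  {b \<in> milnor_box d. \<forall>h\<in>\<Delta>. diagonal_character (Suc \<circ> b) h = 1}"

text \<open>Only the component at the identity can change: the others are zero classes, which the action
  preserves.\<close>

lemma act_untwisted_state:
  assumes g: "g \<in> \<Gamma>"
  shows "act g (untwisted_state c) = untwisted_state c \<longleftrightarrow>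
    pullback (matrix_inv g) ` milnor_class d (box_polynomial d c) = milnor_class d (box_polynomial d c)"
proof -
  have "act g (untwisted_state c) h = (if h = mat 1
      then pullback (matrix_inv g) ` milnor_class d (box_polynomial d c) else untwisted_state c h)" for h
    unfolding act_def untwisted_state_def conjugate_eq_one_iff[OF g] conjugate_mem_iff[OF g]
    using pullback_null_class[OF g, of h] by auto
  then show ?thesis
    by (auto simp: fun_eq_iff untwisted_state_def)
qed

lemma untwisted_invariant_iff:
  "(\<forall>g\<in>\<Gamma>. act g (untwisted_state c) = untwisted_state c) \<longleftrightarrow>
    (\<forall>b\<in>milnor_box d. c b \<noteq> 0 \<longrightarrow> b \<in> invariant_exponents) \<and>
    (\<forall>p\<in>permutations. \<forall>b\<in>milnor_box d. c (b \<circ> p) = c b)" (is "?L \<longleftrightarrow> ?R")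
proof -
  let ?C = "milnor_class d (box_polynomial d c)"
  \<comment> \<open>The action of \<open>g\<close> pulls back along its inverse, which also ranges over \<open>\<Gamma>\<close>.\<close>
  have "?L \<longleftrightarrow> (\<forall>g\<in>\<Gamma>. pullback g ` ?C = ?C)"
  proof (intro iffI ballI)
    fix g assume g: "g \<in> \<Gamma>" and ?L
    then have "act (matrix_inv g) (untwisted_state c) = untwisted_state c"
      using inv_mem[OF g] by blast
    then have "pullback (matrix_inv (matrix_inv g)) ` ?C = ?C"
      unfolding act_untwisted_state[OF inv_mem[OF g]] .
    then show "pullback g ` ?C = ?C" by (simp only: matrix_inv_inv[OF g])
  next
    fix g assume g: "g \<in> \<Gamma>" and "\<forall>g\<in>\<Gamma>. pullback g ` ?C = ?C"
    then show "act g (untwisted_state c) = untwisted_state c"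
      using act_untwisted_state[OF g] inv_mem[OF g] by simp
  qed
  also have "\<dots> \<longleftrightarrow> (\<forall>h\<in>\<Delta>. pullback h ` ?C = ?C) \<and>
      (\<forall>p\<in>permutations. pullback (permutation_matrix p) ` ?C = ?C)"
  proof (intro iffI conjI ballI)
    fix g assume *: "(\<forall>h\<in>\<Delta>. pullback h ` ?C = ?C) \<and>
      (\<forall>p\<in>permutations. pullback (permutation_matrix p) ` ?C = ?C)" and "g \<in> \<Gamma>"
    then obtain h p where g: "h \<in> \<Delta>" "p \<in> permutations" "g = h ** permutation_matrix p"
      using mem_iff[of g] by auto
    have "pullback g ` ?C = pullback (permutation_matrix p) ` pullback h ` ?C"
      unfolding g(3) image_image by (simp add: pullback_mult)
    then show "pullback g ` ?C = ?C" using * g by simp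
  qed (auto simp: \<Delta>_def permutation_mem)
  also have "(\<forall>h\<in>\<Delta>. pullback h ` ?C = ?C) \<longleftrightarrow>
      (\<forall>b\<in>milnor_box d. c b \<noteq> 0 \<longrightarrow> b \<in> invariant_exponents)"
  proof -
    have "pullback h ` ?C = ?C \<longleftrightarrow> (\<forall>b\<in>milnor_box d. c b \<noteq> 0 \<longrightarrow> diagonal_character (Suc \<circ> b) h = 1)"
      if h: "h \<in> \<Delta>" for h
    proof -
      obtain k where k: "h = diagonal k"
        using h \<Delta>_subset by (auto simp: root_diagonal_def)
      have "diagonal k \<in> diagonal_symmetries V" using h by (simp add: k \<Delta>_def)
      from pullback_milnor_class_diagonal[OF d this box_polynomial_polynomial]
      show ?thesis
        unfolding k by (simp add: coefficient_box_polynomial)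
    qed
    then show ?thesis unfolding invariant_exponents_def by blast
  qed
  also have "(\<forall>p\<in>permutations. pullback (permutation_matrix p) ` ?C = ?C) \<longleftrightarrow>
      (\<forall>p\<in>permutations. \<forall>b\<in>milnor_box d. c (b \<circ> p) = c b)"
  proof (intro ball_cong refl)
    fix p assume p: "p \<in> permutations"
    then have "p permutes UNIV" "evenperm p" "permutation_matrix p \<in> max_symmetries V"
      using symmetries by (auto simp: permutations_def)
    from pullback_milnor_class_permutation[OF d this box_polynomial_polynomial]
    show "pullback (permutation_matrix p) ` ?C = ?C \<longleftrightarrow> (\<forall>b\<in>milnor_box d. c (b \<circ> p) = c b)"
      by (simp add: coefficient_box_polynomial box_permute_iff[OF p])
  qed
  finally show ?thesis .
qed

lemma untwisted_state_in_sector_sum: "untwisted_state c \<in> sector_sum V \<Gamma>"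
proof -
  have "{g \<in> \<Gamma>. untwisted_state c g \<noteq> null_class g} \<subseteq> {mat 1}"
    by (auto simp: untwisted_state_def)
  then have "finite {g \<in> \<Gamma>. untwisted_state c g \<noteq> null_class g}"
    by (rule finite_subset) simp
  moreover have "untwisted_state c g \<in> sector V g" if "g \<in> \<Gamma>" for g
    using that null_class_in_sector sector_one[of d] box_polynomial_polynomial[of d c]
    by (auto simp: untwisted_state_def)
  ultimately show ?thesis
    using one_mem by (auto simp: sector_sum_def untwisted_state_def)
qed

abbreviation "untwisted_coefficients \<beta> \<equiv> coefficient_space invariant_exponents permutations \<beta>"

lemma carrier_untwisted_coefficients:
  "c \<in> carrier (untwisted_coefficients \<beta>) \<longleftrightarrow>
    (\<forall>b. b \<notin> milnor_box d \<longrightarrow> c b = 0) \<and> (\<forall>g\<in>\<Gamma>. act g (untwisted_state c) = untwisted_state c)"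
proof -
  have "c (b \<circ> p) = c b"
    if "\<forall>b. b \<notin> milnor_box d \<longrightarrow> c b = 0" "\<forall>b\<in>milnor_box d. c (b \<circ> p) = c b" "p \<in> permutations" for b p
    using that box_permute_iff[of p b] by (cases "b \<in> milnor_box d") auto
  moreover have "invariant_exponents \<subseteq> milnor_box d" by (auto simp: invariant_exponents_def)
  ultimately show ?thesis
    unfolding untwisted_invariant_iff by (auto simp: coefficient_space_def Let_def)
qed

lemma untwisted_state_inj:
  assumes "untwisted_state c = untwisted_state c'"
    and "\<And>b. b \<notin> milnor_box d \<Longrightarrow> c b = 0" "\<And>b. b \<notin> milnor_box d \<Longrightarrow> c' b = 0"
  shows "c = c'"
proof
  fix b
  have "milnor_class d (box_polynomial d c) = milnor_class d (box_polynomial d c')"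
    using fun_cong[OF assms(1), of "mat 1"] by (simp add: untwisted_state_def)
  then show "c b = c' b"
    using assms(2,3)[of b]
    unfolding milnor_class_eq_iff[OF d box_polynomial_polynomial box_polynomial_polynomial]
    by (cases "b \<in> milnor_box d") (simp_all add: coefficient_box_polynomial)
qed

lemma untwisted_state_surj:
  assumes s: "s \<in> invariant_states V \<Gamma>" and zero: "\<And>g. g \<in> \<Gamma> - {mat 1} \<Longrightarrow> s g = null_class g"
  obtains c where "s = untwisted_state c" "\<And>b. b \<notin> milnor_box d \<Longrightarrow> c b = 0"
proof -
  have sec: "s g \<in> sector V g" if "g \<in> \<Gamma>" for g
    using s that by (auto simp: invariant_states_def sector_sum_def)
  have empty: "s g = {}" if "g \<notin> \<Gamma>" for g
    using s that by (auto simp: invariant_states_def sector_sum_def)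
  obtain f where f: "f \<in> polynomial_functions" "s (mat 1) = milnor_class d f"
    using sec[OF one_mem] unfolding sector_one by blast
  let ?c = "\<lambda>b. if b \<in> milnor_box d then coefficient f b else 0"
  have "box_polynomial d ?c = box_polynomial d (coefficient f)"
    by (simp add: box_polynomial_def fun_eq_iff)
  then have "s (mat 1) = milnor_class d (box_polynomial d ?c)"
    using milnor_class_box_polynomial[OF d f(1)] f(2) by simp
  then have "s = untwisted_state ?c"
    using zero empty by (auto simp: fun_eq_iff untwisted_state_def)
  then show thesis by (rule that) simp
qed

text \<open>A class is homogeneous of degree \<open>r\<close> if all its monomials are. Different monomials of the same
  bidegree have the same degree \<open>r\<close>, since the bidegree determines the degree.\<close>

lemma milnor_class_in_component_iff:
  assumes bideg: "\<And>r r'. bideg (mat 1) r = bideg (mat 1) r' \<Longrightarrow> r = r'"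
    and c: "\<And>b. b \<notin> milnor_box d \<Longrightarrow> c b = 0"
  shows "milnor_class d (box_polynomial d c) \<in> sector_component bideg V (mat 1) ab
    \<longleftrightarrow> (\<forall>b. c b \<noteq> 0 \<longrightarrow> bideg (mat 1) (shifted_degree d b) = ab)" (is "?C \<in> ?S \<longleftrightarrow> ?R")
proof
  have S: "?S = insert (milnor_class d (\<lambda>x. 0)) {milnor_class d f | f r. f \<in> polynomial_functions \<and>
      weighted_degree (\<lambda>i. 1 / of_nat (d i)) (volume f) r \<and> bideg (mat 1) r = ab}"
    unfolding sector_component_def fixed_space_one top_forms_UNIV milnor_class_zero
      weights_fermat[OF d_pos] milnor_class_def by auto
  {
    assume "?C \<in> ?S"
    then consider "?C = milnor_class d (\<lambda>x. 0)" | f r where "?C = milnor_class d f"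
      "f \<in> polynomial_functions" "weighted_degree (\<lambda>i. 1 / of_nat (d i)) (volume f) r" "bideg (mat 1) r = ab"
      unfolding S by blast
    then show ?R
    proof cases
      case 1
      have "coefficient (\<lambda>x :: complex^'n. 0) b = 0" for b
        using coefficient_scale[OF polynomial_functions.const[of 0], of 0 b] by simp
      then have "c b = 0" for b
        using 1 c[of b]
        unfolding milnor_class_eq_iff[OF d box_polynomial_polynomial polynomial_functions.const]
        by (cases "b \<in> milnor_box d") (simp_all add: coefficient_box_polynomial)
      then show ?R by simp
    next
      case 2
      have "shifted_degree d b = r" if "c b \<noteq> 0" for b
      proof -
        have "b \<in> milnor_box d" using c that by blast
        then have "coefficient f b = c b"
          using 2(1) unfolding milnor_class_eq_iff[OF d box_polynomial_polynomial 2(2)]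
          by (simp add: coefficient_box_polynomial)
        then show ?thesis using weighted_degree_coefficient[OF 2(2,3)] that by simp
      qed
      then show ?R using 2(4) by simp
    qed
  next
    assume R: ?R
    show "?C \<in> ?S"
    proof (cases "\<exists>b. c b \<noteq> 0")
      case True
      then obtain b where b: "c b \<noteq> 0" by blast
      have "shifted_degree d b' = shifted_degree d b" if "c b' \<noteq> 0" for b'
        using R b that bideg by metis
      then have "weighted_degree (\<lambda>i. 1 / of_nat (d i)) (volume (box_polynomial d c)) (shifted_degree d b)"
        by (intro weighted_degree_box_polynomial) blast
      then show ?thesis
        unfolding S using R b box_polynomial_polynomial by blast
    next
      case False
      then have "box_polynomial d c = (\<lambda>x. 0)" by (auto simp: box_polynomial_def fun_eq_iff)
      then show ?thesis unfolding S by simp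
    qed
  }
qed

lemma untwisted_state_add: "untwisted_state (c + c') = untwisted_state c + untwisted_state c'"
proof
  fix g
  have "milnor_class d (box_polynomial d (c + c'))
      = milnor_class d (box_polynomial d c) + milnor_class d (box_polynomial d c')"
    unfolding milnor_class_def coset_plus[OF vec.subspace_UNIV] volume_add
    by (simp add: box_polynomial_def[abs_def] sum.distrib algebra_simps)
  then show "untwisted_state (c + c') g = (untwisted_state c + untwisted_state c') g"
    by (auto simp: untwisted_state_def null_class_plus set_plus_def[of "{}"])
qed

lemma untwisted_state_scale:
  "untwisted_state (\<lambda>b. k * c b) = (\<lambda>g. (\<lambda>\<eta> x vs. k * \<eta> x vs) ` untwisted_state c g + null_class g)"
proof
  fix g
  have "(\<lambda>\<eta> x vs. k * \<eta> x vs) ` milnor_class d (box_polynomial d c) + null_class (mat 1)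
      = milnor_class d (box_polynomial d (\<lambda>b. k * c b))"
    unfolding milnor_class_def fixed_space_one coset_scale[OF vec.subspace_UNIV] volume_scale
    by (simp add: box_polynomial_def[abs_def] sum_distrib_left mult.assoc)
  then show "untwisted_state (\<lambda>b. k * c b) g
      = (\<lambda>\<eta> x vs. k * \<eta> x vs) ` untwisted_state c g + null_class g"
    by (auto simp: untwisted_state_def null_class_scale set_plus_def[of "{}"])
qed

text \<open>The coefficients with respect to the monomial basis identify the untwisted sector with functions on
  the exponents; all conditions on a state become conditions on its coefficients.\<close>

theorem untwisted_iso:
  assumes bideg: "\<And>r r'. bideg (mat 1) r = bideg (mat 1) r' \<Longrightarrow> r = r'"
  shows "bigraded_iso untwisted_state
    (untwisted_coefficients (\<lambda>b. bideg (mat 1) (shifted_degree d b)))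
    (supported_on V \<Gamma> {mat 1} (state_space bideg V \<Gamma>))" (is "bigraded_iso _ ?X ?M")
proof -
  have supp: "c b = 0" if "c \<in> carrier ?X" "b \<notin> milnor_box d" for c b
    using that by (auto simp: carrier_untwisted_coefficients)
  have mem: "untwisted_state c \<in> carrier ?M" if "c \<in> carrier ?X" for c
    using that untwisted_state_in_sector_sum[of c]
    by (auto simp: carrier_untwisted_coefficients supported_on_simps invariant_states_def untwisted_state_def)
  have carrier: "untwisted_state ` carrier ?X = carrier ?M"
  proof
    show "carrier ?M \<subseteq> untwisted_state ` carrier ?X"
    proof
      fix s assume "s \<in> carrier ?M"
      then have s: "s \<in> invariant_states V \<Gamma>" "\<And>g. g \<in> \<Gamma> - {mat 1} \<Longrightarrow> s g = null_class g"
        by (auto simp: supported_on_simps)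
      obtain c where c: "s = untwisted_state c" "\<And>b. b \<notin> milnor_box d \<Longrightarrow> c b = 0"
        using untwisted_state_surj[OF s] by blast
      then have "c \<in> carrier ?X"
        using s(1) by (simp add: carrier_untwisted_coefficients invariant_states_def)
      then show "s \<in> untwisted_state ` carrier ?X" using c(1) by blast
    qed
  qed (use mem in blast)
  have comp: "untwisted_state c \<in> component ?M ab \<longleftrightarrow> c \<in> component ?X ab"
    if c: "c \<in> carrier ?X" for c ab
  proof -
    have "untwisted_state c \<in> component ?M ab
        \<longleftrightarrow> (\<forall>g\<in>\<Gamma>. untwisted_state c g \<in> sector_component bideg V g ab)"
      using mem[OF c] by (auto simp: supported_on_simps)
    also have "\<dots> \<longleftrightarrow> milnor_class d (box_polynomial d c) \<in> sector_component bideg V (mat 1) ab"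
      using one_mem by (auto simp: untwisted_state_def sector_component_def)
    also have "\<dots> \<longleftrightarrow> (\<forall>b. c b \<noteq> 0 \<longrightarrow> bideg (mat 1) (shifted_degree d b) = ab)"
      using bideg supp[OF c] by (rule milnor_class_in_component_iff)
    also have "\<dots> \<longleftrightarrow> c \<in> component ?X ab"
      using c by (simp add: coefficient_space_def Let_def)
    finally show ?thesis .
  qed
  have inj: "inj_on untwisted_state (carrier ?X)"
    using untwisted_state_inj supp by (intro inj_onI) blast
  show ?thesis
    by (rule bigraded_isoI[OF inj carrier _ _ _ _ comp])
      (auto simp: untwisted_state_add untwisted_state_scale supported_on_simps coefficient_space_def Let_def)
qed

end

section \<open>The narrow sectors\<close>

context split_symmetry_group
begin

definition "narrow_exponents = {b \<in> milnor_box d. root_diagonal d (Suc \<circ> b) \<in> \<Gamma>}"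

definition "exponent_of g = (THE b. b \<in> milnor_box d \<and> g = root_diagonal d (Suc \<circ> b))"

definition narrow_state :: "(('n \<Rightarrow> nat) \<Rightarrow> complex) \<Rightarrow> 'n state" where
  "narrow_state c = (\<lambda>g. if g \<in> narrow \<Delta> then {point_form (c (exponent_of g))}
     else if g \<in> \<Gamma> then null_class g else {})"

lemma exponent_of_root_diagonal:
  assumes "b \<in> milnor_box d"
  shows "exponent_of (root_diagonal d (Suc \<circ> b)) = b"
  unfolding exponent_of_def
proof (rule the_equality)
  fix b' assume b': "b' \<in> milnor_box d \<and> root_diagonal d (Suc \<circ> b) = root_diagonal d (Suc \<circ> b')"
  have less: "Suc (b i) < d i" "Suc (b' i) < d i" for i
    using assms b' by (auto simp: milnor_box_def Suc_le_lessD)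
  have "Suc \<circ> b = Suc \<circ> b'"
    using b' less by (intro inj_root_diagonal[of _ d]) auto
  then show "b' = b" by (auto simp: fun_eq_iff)
qed (use assms in simp)

lemma root_diagonal_narrow_iff:
  assumes "\<And>i. k i < d i"
  shows "fixed_space (root_diagonal d k) = {0} \<longleftrightarrow> (\<forall>i. k i \<noteq> 0)"
proof -
  have "cis (2 * pi * of_nat (k i) / of_nat (d i)) = 1 \<longleftrightarrow> k i = 0" for i
    using cis_two_pi_div_eq_one_iff[OF d_pos, of "int (k i)" i] assms[of i]
    by (auto simp: int_dvd_int_iff dest: dvd_imp_le)
  then show ?thesis
    unfolding root_diagonal_def fixed_space_diagonal_zero_iff by simp
qed

text \<open>A diagonal symmetry with entries $e^{2 \pi i k_j/d_j}$, $0 \le k_j < d_j$, is narrow if and only if all $k_j$ are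
  positive, and then $b_j = k_j - 1$ is an exponent of the Milnor basis.\<close>

lemma narrow_eq: "narrow \<Delta> = (\<lambda>b. root_diagonal d (Suc \<circ> b)) ` narrow_exponents"
proof (intro subset_antisym subsetI)
  fix g assume g: "g \<in> narrow \<Delta>"
  then obtain k where k: "\<And>i. k i < d i" "g = root_diagonal d k"
    using \<Delta>_subset by (auto simp: narrow_def)
  have pos: "k i \<noteq> 0" for i
    using g root_diagonal_narrow_iff[OF k(1)] by (simp add: narrow_def k(2))
  let ?b = "\<lambda>i. k i - 1"
  have "Suc \<circ> ?b = k" using pos by (auto simp: fun_eq_iff)
  moreover have "?b \<in> milnor_box d"
    unfolding milnor_box_def
  proof (intro CollectI allI)
    fix i show "k i - 1 + 2 \<le> d i" using k(1)[of i] pos[of i] by simp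
  qed
  moreover have "g \<in> \<Gamma>" using g by (simp add: narrow_def \<Delta>_def)
  ultimately show "g \<in> (\<lambda>b. root_diagonal d (Suc \<circ> b)) ` narrow_exponents"
    by (intro image_eqI[of _ _ ?b]) (simp_all add: narrow_exponents_def k(2))
next
  fix g assume "g \<in> (\<lambda>b. root_diagonal d (Suc \<circ> b)) ` narrow_exponents"
  then obtain b where b: "g = root_diagonal d (Suc \<circ> b)" "b \<in> milnor_box d" "g \<in> \<Gamma>"
    by (auto simp: narrow_exponents_def)
  have less: "(Suc \<circ> b) i < d i" for i using b(2) by (auto simp: milnor_box_def Suc_le_lessD)
  have "g \<in> \<Delta>" using root_diagonal_mem_\<Delta>_iff[of "Suc \<circ> b"] b by blast
  moreover have "fixed_space g = {0}"
    unfolding b(1) using root_diagonal_narrow_iff[of "Suc \<circ> b"] less by auto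
  ultimately show "g \<in> narrow \<Delta>" by (simp add: narrow_def)
qed

lemma narrow_subset: "narrow \<Delta> \<subseteq> \<Gamma>"
  by (auto simp: narrow_def \<Delta>_def)

lemma narrow_fixed_space: "g \<in> narrow \<Delta> \<Longrightarrow> fixed_space g = {0}"
  by (simp add: narrow_def)

text \<open>The diagonal factor of \<open>g\<close> commutes with diagonal matrices, so only its permutation factor acts.\<close>

lemma conjugate_root_diagonal:
  assumes h: "h \<in> \<Delta>" and p: "p \<in> permutations" and g: "g = h ** permutation_matrix p"
  shows "matrix_inv g ** root_diagonal d k ** g = root_diagonal d (k \<circ> inv_into UNIV p)"
proof -
  have gG: "g \<in> \<Gamma>" using h p g mem_iff by blast
  obtain l where l: "h = root_diagonal d l" using h \<Delta>_subset by blast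
  have "g ** root_diagonal d (k \<circ> inv_into UNIV p)
      = h ** (permutation_matrix p ** root_diagonal d (k \<circ> inv_into UNIV p))"
    by (simp add: g matrix_mul_assoc)
  also have "\<dots> = h ** (root_diagonal d k ** permutation_matrix p)"
  proof -
    have "root_diagonal d (k \<circ> inv_into UNIV p \<circ> p) ** permutation_matrix p
        = permutation_matrix p ** root_diagonal d (k \<circ> inv_into UNIV p)"
      by (rule root_diagonal_permutation_matrix) (rule permutation_preserves_exponents[OF p])
    moreover have "k \<circ> inv_into UNIV p \<circ> p = k"
      by (simp only: comp_assoc permutation_inv(3)[OF p] comp_id)
    ultimately show ?thesis by simp
  qed
  also have "\<dots> = root_diagonal d k ** g"
    by (simp add: g l matrix_mul_assoc root_diagonal_add add.commute)
  finally have "matrix_inv g ** (root_diagonal d k ** g)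
      = matrix_inv g ** g ** root_diagonal d (k \<circ> inv_into UNIV p)"
    by (simp add: matrix_mul_assoc[symmetric])
  then show ?thesis
    by (simp add: matrix_mul_assoc matrix_inv invertible[OF gG])
qed

lemma narrow_exponents_permute_iff:
  assumes "p \<in> permutations"
  shows "b \<circ> p \<in> narrow_exponents \<longleftrightarrow> b \<in> narrow_exponents"
  using root_diagonal_permute_mem_iff[OF assms, of "Suc \<circ> b"] box_permute_iff[OF assms, of b]
  by (simp add: narrow_exponents_def o_assoc)

lemma conjugate_narrow:
  assumes "h \<in> \<Delta>" "p \<in> permutations" "g = h ** permutation_matrix p" and b: "b \<in> narrow_exponents"
  shows "matrix_inv g ** root_diagonal d (Suc \<circ> b) ** g \<in> narrow \<Delta>"
    and "exponent_of (matrix_inv g ** root_diagonal d (Suc \<circ> b) ** g) = b \<circ> inv_into UNIV p"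
proof -
  have mem: "b \<circ> inv_into UNIV p \<in> narrow_exponents"
    using narrow_exponents_permute_iff[OF permutation_inv(1)[OF assms(2)]] b by blast
  have eq: "matrix_inv g ** root_diagonal d (Suc \<circ> b) ** g
      = root_diagonal d (Suc \<circ> (b \<circ> inv_into UNIV p))"
    using conjugate_root_diagonal[OF assms(1-3), of "Suc \<circ> b"] by (simp add: o_assoc)
  show "matrix_inv g ** root_diagonal d (Suc \<circ> b) ** g \<in> narrow \<Delta>"
    unfolding eq narrow_eq using mem by blast
  show "exponent_of (matrix_inv g ** root_diagonal d (Suc \<circ> b) ** g) = b \<circ> inv_into UNIV p"
    unfolding eq using mem by (intro exponent_of_root_diagonal) (simp add: narrow_exponents_def)
qed

lemma conjugate_narrow_iff:
  assumes g: "g \<in> \<Gamma>"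
  shows "matrix_inv g ** h ** g \<in> narrow \<Delta> \<longleftrightarrow> h \<in> narrow \<Delta>"
proof -
  have *: "matrix_inv g ** h ** g \<in> narrow \<Delta>" if g: "g \<in> \<Gamma>" and h: "h \<in> narrow \<Delta>" for g h
  proof -
    obtain a p where "a \<in> \<Delta>" "p \<in> permutations" "g = a ** permutation_matrix p"
      using g mem_iff[of g] by auto
    moreover obtain b where "b \<in> narrow_exponents" "h = root_diagonal d (Suc \<circ> b)"
      using h narrow_eq by auto
    ultimately show ?thesis using conjugate_narrow(1) by blast
  qed
  have "matrix_inv (matrix_inv g) ** (matrix_inv g ** h ** g) ** matrix_inv g
      = (g ** matrix_inv g) ** h ** (g ** matrix_inv g)"
    by (simp add: matrix_inv_inv[OF g] matrix_mul_assoc)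
  also have "\<dots> = h" by (simp add: matrix_inv invertible[OF g])
  finally show ?thesis
    using *[OF g, of h] *[OF inv_mem[OF g], of "matrix_inv g ** h ** g"] by auto
qed

text \<open>The pullback is trivial on forms on \<open>{0}\<close>, so the action merely permutes the narrow sectors.\<close>

lemma act_narrow_state:
  assumes h: "h \<in> \<Delta>" and p: "p \<in> permutations" and g: "g = h ** permutation_matrix p"
  shows "act g (narrow_state c) = narrow_state c
    \<longleftrightarrow> (\<forall>b\<in>narrow_exponents. c (b \<circ> inv_into UNIV p) = c b)"
proof -
  have gG: "g \<in> \<Gamma>" using h p g mem_iff by blast
  have act: "act g (narrow_state c) a = (if a \<in> narrow \<Delta>
      then {point_form (c (exponent_of (matrix_inv g ** a ** g)))} else narrow_state c a)" for a
    unfolding act_def narrow_state_def conjugate_narrow_iff[OF gG] conjugate_mem_iff[OF gG]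
    using pullback_null_class[OF gG, of a] pullback_point_form[OF invertible[OF inv_mem[OF gG]]]
    by auto
  have "act g (narrow_state c) = narrow_state c \<longleftrightarrow>
      (\<forall>a\<in>narrow \<Delta>. c (exponent_of (matrix_inv g ** a ** g)) = c (exponent_of a))"
    by (auto simp: fun_eq_iff act) (auto simp: narrow_state_def point_form_eq_iff)
  also have "\<dots> \<longleftrightarrow> (\<forall>b\<in>narrow_exponents. c (b \<circ> inv_into UNIV p) = c b)"
    unfolding narrow_eq using conjugate_narrow(2)[OF h p g] exponent_of_root_diagonal
    by (auto simp: narrow_exponents_def)
  finally show ?thesis .
qed

lemma narrow_invariant_iff:
  "(\<forall>g\<in>\<Gamma>. act g (narrow_state c) = narrow_state c)
    \<longleftrightarrow> (\<forall>p\<in>permutations. \<forall>b\<in>narrow_exponents. c (b \<circ> p) = c b)"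
proof (intro iffI ballI)
  fix p b assume inv: "\<forall>g\<in>\<Gamma>. act g (narrow_state c) = narrow_state c"
    and p: "p \<in> permutations" and b: "b \<in> narrow_exponents"
  \<comment> \<open>The matrix of a permutation acts on exponents by the inverse permutation.\<close>
  let ?q = "inv_into UNIV p"
  have q: "?q \<in> permutations" by (rule permutation_inv[OF p])
  have "act (permutation_matrix ?q) (narrow_state c) = narrow_state c"
    using inv permutation_mem[OF q] by blast
  then have "\<forall>b\<in>narrow_exponents. c (b \<circ> inv_into UNIV ?q) = c b"
    using act_narrow_state[OF one_\<Delta> q] by simp
  moreover have "inv_into UNIV ?q = p"
    using p permutes_inv_inv[of p UNIV] by (simp add: permutations_def)
  ultimately show "c (b \<circ> p) = c b" using b by simp
next
  fix g assume *: "\<forall>p\<in>permutations. \<forall>b\<in>narrow_exponents. c (b \<circ> p) = c b" and g: "g \<in> \<Gamma>"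
  obtain h p where hp: "h \<in> \<Delta>" "p \<in> permutations" "g = h ** permutation_matrix p"
    using g mem_iff[of g] by auto
  then show "act g (narrow_state c) = narrow_state c"
    unfolding act_narrow_state[OF hp] using * permutation_inv(1)[OF hp(2)] by blast
qed

lemma narrow_state_in_sector_sum: "narrow_state c \<in> sector_sum V \<Gamma>"
proof -
  have "{g \<in> \<Gamma>. narrow_state c g \<noteq> null_class g} \<subseteq> narrow \<Delta>"
    by (auto simp: narrow_state_def)
  moreover have "finite (narrow \<Delta>)"
    unfolding narrow_eq narrow_exponents_def using finite_milnor_box[of d] by simp
  ultimately have "finite {g \<in> \<Gamma>. narrow_state c g \<noteq> null_class g}"
    by (rule finite_subset)
  moreover have "narrow_state c g \<in> sector V g" if "g \<in> \<Gamma>" for g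
    using that null_class_in_sector[of g] sector_point[OF narrow_fixed_space, of g V]
    by (auto simp: narrow_state_def)
  ultimately show ?thesis
    using narrow_subset by (auto simp: sector_sum_def narrow_state_def)
qed

abbreviation "narrow_coefficients \<beta> \<equiv> coefficient_space narrow_exponents permutations \<beta>"

lemma carrier_narrow_coefficients:
  "c \<in> carrier (narrow_coefficients \<beta>) \<longleftrightarrow>
    (\<forall>b. b \<notin> narrow_exponents \<longrightarrow> c b = 0) \<and> (\<forall>g\<in>\<Gamma>. act g (narrow_state c) = narrow_state c)"
proof -
  have "c (b \<circ> p) = c b"
    if "\<forall>b. b \<notin> narrow_exponents \<longrightarrow> c b = 0" "\<forall>b\<in>narrow_exponents. c (b \<circ> p) = c b"
      "p \<in> permutations" for b p
    using that narrow_exponents_permute_iff[of p b] by (cases "b \<in> narrow_exponents") auto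
  then show ?thesis
    unfolding narrow_invariant_iff by (auto simp: coefficient_space_def Let_def)
qed

lemma narrow_state_root_diagonal:
  assumes "b \<in> narrow_exponents"
  shows "narrow_state c (root_diagonal d (Suc \<circ> b)) = {point_form (c b)}"
proof -
  have "root_diagonal d (Suc \<circ> b) \<in> narrow \<Delta>" unfolding narrow_eq using assms by blast
  then show ?thesis
    using assms by (simp add: narrow_state_def exponent_of_root_diagonal narrow_exponents_def)
qed

lemma narrow_state_inj:
  assumes eq: "narrow_state c = narrow_state c'"
    and supp: "\<And>b. b \<notin> narrow_exponents \<Longrightarrow> c b = 0" "\<And>b. b \<notin> narrow_exponents \<Longrightarrow> c' b = 0"
  shows "c = c'"
proof
  fix b
  show "c b = c' b"
  proof (cases "b \<in> narrow_exponents")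
    case True
    then have "{point_form (c b)} = {point_form (c' b) :: 'n form}"
      using narrow_state_root_diagonal[OF True] eq by metis
    then show ?thesis by (simp add: point_form_eq_iff)
  qed (simp add: supp)
qed

lemma narrow_state_surj:
  assumes s: "s \<in> invariant_states V \<Gamma>" and null: "\<And>g. g \<in> \<Gamma> - narrow \<Delta> \<Longrightarrow> s g = null_class g"
  obtains c where "s = narrow_state c" "\<And>b. b \<notin> narrow_exponents \<Longrightarrow> c b = 0"
proof -
  have sec: "s g \<in> sector V g" if "g \<in> \<Gamma>" for g
    using s that by (auto simp: invariant_states_def sector_sum_def)
  have empty: "s g = {}" if "g \<notin> \<Gamma>" for g
    using s that by (auto simp: invariant_states_def sector_sum_def)
  have "\<exists>c. s g = {point_form c}" if "g \<in> narrow \<Delta>" for g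
    using sec[of g] that narrow_subset sector_point[OF narrow_fixed_space[OF that]] by auto
  then obtain a where a: "\<And>g. g \<in> narrow \<Delta> \<Longrightarrow> s g = {point_form (a g)}" by metis
  let ?c = "\<lambda>b. if b \<in> narrow_exponents then a (root_diagonal d (Suc \<circ> b)) else 0"
  have "s g = narrow_state ?c g" for g
  proof (cases "g \<in> narrow \<Delta>")
    case True
    then obtain b where b: "b \<in> narrow_exponents" "g = root_diagonal d (Suc \<circ> b)"
      using narrow_eq by auto
    then show ?thesis using a[OF True] narrow_state_root_diagonal[OF b(1), of ?c] by simp
  next
    case False
    then show ?thesis using null[of g] empty[of g] by (auto simp: narrow_state_def)
  qed
  then have "s = narrow_state ?c" by blast
  then show thesis by (rule that) simp
qed

lemma point_form_in_component_iff:
  assumes g: "fixed_space g = {0}"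
  shows "{point_form c} \<in> sector_component bideg V g ab \<longleftrightarrow> c = 0 \<or> bideg g 0 = ab"
proof -
  have S: "sector_component bideg V g ab = insert {0}
      {{point_form c} | c r. weighted_degree (weights V) (point_form c) r \<and> bideg g r = ab}"
    unfolding sector_component_def g jacobian_forms_point top_forms_point coset_point by auto
  show ?thesis
  proof
    assume "{point_form c} \<in> sector_component bideg V g ab"
    then consider "point_form c = (0 :: 'n form)" | r where "weighted_degree (weights V) (point_form c) r" "bideg g r = ab"
      unfolding S by auto
    then show "c = 0 \<or> bideg g 0 = ab"
    proof cases
      case 1
      then have "point_form c = (point_form 0 :: 'n form)" by (simp add: point_form_zero)
      then show ?thesis by (simp add: point_form_eq_iff)
    next
      case 2
      then show ?thesis using weighted_degree_point_form[OF 2(1)] by auto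
    qed
  next
    assume "c = 0 \<or> bideg g 0 = ab"
    then show "{point_form c} \<in> sector_component bideg V g ab"
      unfolding S using weighted_degree_point_form_zero by (auto simp: point_form_zero)
  qed
qed

lemma narrow_state_add: "narrow_state (c + c') = narrow_state c + narrow_state c'"
proof
  fix g
  have "{point_form a} + {point_form b} = {point_form (a + b) :: 'n form}" for a b
  proof -
    have "point_form a + point_form b = (point_form (a + b) :: 'n form)"
      by (auto simp: point_form_def fun_eq_iff)
    then show ?thesis by (simp add: set_plus_def)
  qed
  then show "narrow_state (c + c') g = (narrow_state c + narrow_state c') g"
    by (auto simp: narrow_state_def null_class_plus set_plus_def[of "{}"])
qed

lemma narrow_state_scale:
  "narrow_state (\<lambda>b. k * c b) = (\<lambda>g. (\<lambda>\<eta> x vs. k * \<eta> x vs) ` narrow_state c g + null_class g)"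
proof
  fix g
  have "(\<lambda>\<eta> x vs. k * \<eta> x vs) ` {point_form a} + {0} = {point_form (k * a) :: 'n form}" for a
  proof -
    have "(\<lambda>x vs. k * point_form a x vs) = (point_form (k * a) :: 'n form)"
      by (auto simp: point_form_def fun_eq_iff)
    then show ?thesis by (simp add: set_plus_def)
  qed
  then show "narrow_state (\<lambda>b. k * c b) g
      = (\<lambda>\<eta> x vs. k * \<eta> x vs) ` narrow_state c g + null_class g"
    by (auto simp: narrow_state_def null_class_scale set_plus_def[of "{}"] narrow_fixed_space
        jacobian_forms_point)
qed

text \<open>Every narrow sector is one-dimensional and the forms in it have degree \<open>0\<close>, so that a state is a
  function on \<open>narrow_exponents\<close> and its bidegree is determined by the symmetries in its support.\<close>

theorem narrow_iso:
  "bigraded_iso narrow_state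
    (narrow_coefficients (\<lambda>b. bideg (root_diagonal d (Suc \<circ> b)) 0))
    (supported_on V \<Gamma> (narrow \<Delta>) (state_space bideg V \<Gamma>))" (is "bigraded_iso _ ?X ?M")
proof -
  have supp: "c b = 0" if "c \<in> carrier ?X" "b \<notin> narrow_exponents" for c b
    using that by (auto simp: carrier_narrow_coefficients)
  have mem: "narrow_state c \<in> carrier ?M" if "c \<in> carrier ?X" for c
    using that narrow_state_in_sector_sum[of c]
    by (auto simp: carrier_narrow_coefficients supported_on_simps invariant_states_def narrow_state_def)
  have carrier: "narrow_state ` carrier ?X = carrier ?M"
  proof
    show "carrier ?M \<subseteq> narrow_state ` carrier ?X"
    proof
      fix s assume "s \<in> carrier ?M"
      then have s: "s \<in> invariant_states V \<Gamma>" "\<And>g. g \<in> \<Gamma> - narrow \<Delta> \<Longrightarrow> s g = null_class g"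
        by (auto simp: supported_on_simps)
      obtain c where c: "s = narrow_state c" "\<And>b. b \<notin> narrow_exponents \<Longrightarrow> c b = 0"
        using narrow_state_surj[OF s] by blast
      then have "c \<in> carrier ?X"
        using s(1) by (simp add: carrier_narrow_coefficients invariant_states_def)
      then show "s \<in> narrow_state ` carrier ?X" using c(1) by blast
    qed
  qed (use mem in blast)
  have comp: "narrow_state c \<in> component ?M ab \<longleftrightarrow> c \<in> component ?X ab"
    if c: "c \<in> carrier ?X" for c ab
  proof -
    have "narrow_state c \<in> component ?M ab
        \<longleftrightarrow> (\<forall>g\<in>\<Gamma>. narrow_state c g \<in> sector_component bideg V g ab)"
      using mem[OF c] by (auto simp: supported_on_simps)
    also have "\<dots> \<longleftrightarrow> (\<forall>g\<in>narrow \<Delta>. narrow_state c g \<in> sector_component bideg V g ab)"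
      using narrow_subset by (auto simp: narrow_state_def sector_component_def)
    also have "\<dots> \<longleftrightarrow> (\<forall>b\<in>narrow_exponents. c b = 0 \<or> bideg (root_diagonal d (Suc \<circ> b)) 0 = ab)"
    proof -
      have "narrow_state c (root_diagonal d (Suc \<circ> b))
          \<in> sector_component bideg V (root_diagonal d (Suc \<circ> b)) ab
          \<longleftrightarrow> c b = 0 \<or> bideg (root_diagonal d (Suc \<circ> b)) 0 = ab" if "b \<in> narrow_exponents" for b
        unfolding narrow_state_root_diagonal[OF that]
        using that by (intro point_form_in_component_iff narrow_fixed_space) (simp add: narrow_eq)
      then show ?thesis unfolding narrow_eq by blast
    qed
    also have "\<dots> \<longleftrightarrow> c \<in> component ?X ab"
      using c supp[OF c] by (auto simp: coefficient_space_def Let_def)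
    finally show ?thesis .
  qed
  have inj: "inj_on narrow_state (carrier ?X)"
    using narrow_state_inj supp by (intro inj_onI) blast
  show ?thesis
    by (rule bigraded_isoI[OF inj carrier _ _ _ _ comp])
      (auto simp: narrow_state_add narrow_state_scale supported_on_simps coefficient_space_def Let_def)
qed

section \<open>Bidegrees\<close>

lemma shifted_degree_eq_age:
  assumes "b \<in> milnor_box d"
  shows "age (root_diagonal d (Suc \<circ> b)) = shifted_degree d b"
    and "age (matrix_inv (root_diagonal d (Suc \<circ> b))) = of_nat CARD('n) - shifted_degree d b"
proof -
  have less: "(Suc \<circ> b) i < d i" for i using assms by (auto simp: milnor_box_def Suc_le_lessD)
  show "age (root_diagonal d (Suc \<circ> b)) = shifted_degree d b"
    using age_root_diagonal[of "Suc \<circ> b" d] less by (simp add: shifted_degree_def)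
  then show "age (matrix_inv (root_diagonal d (Suc \<circ> b))) = of_nat CARD('n) - shifted_degree d b"
    using age_inverse_root_diagonal[of "Suc \<circ> b" d] less by simp
qed

text \<open>The degree of a monomial form is the age of the narrow symmetry with the same exponent, and the
  ages of this symmetry and of its inverse add up to the number of variables.\<close>

lemma mirror_bidegree:
  assumes "b \<in> milnor_box d"
  shows "A_bidegree V (mat 1) (shifted_degree d b) = B_bidegree V (root_diagonal d (Suc \<circ> b)) 0"
    and "fixed_space (root_diagonal d (Suc \<circ> b)) = {0} \<Longrightarrow>
      A_bidegree V (root_diagonal d (Suc \<circ> b)) 0 = B_bidegree V (mat 1) (shifted_degree d b)"
proof -
  have "matrix_inv (mat 1) = (mat 1 :: complex^'n^'n)" by (rule matrix_inv_eqI) simp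
  then show "A_bidegree V (mat 1) (shifted_degree d b) = B_bidegree V (root_diagonal d (Suc \<circ> b)) 0"
    and "fixed_space (root_diagonal d (Suc \<circ> b)) = {0} \<Longrightarrow>
      A_bidegree V (root_diagonal d (Suc \<circ> b)) 0 = B_bidegree V (mat 1) (shifted_degree d b)"
    by (simp_all add: A_bidegree_def B_bidegree_def shifted_degree_eq_age[OF assms] age_one
        fixed_space_one vec_dim_card del: vec.dim_UNIV)
qed

section \<open>The dual of a split group\<close>

definition "dual_\<Delta> = dual_group (fermat_exponents d) \<Delta>"

definition "dual_\<Gamma> = dual_\<Delta> <#>\<^bsub>general_linear\<^esub> (\<Gamma> \<inter> even_permutations)"

lemma dual_\<Delta>_eq: "dual_\<Delta> = {g \<in> diagonal_symmetries V.
    \<forall>l. root_diagonal d l \<in> \<Delta> \<longrightarrow> diagonal_character l g = 1}"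
  unfolding dual_\<Delta>_def by (rule dual_group_fermat[OF d_pos \<Delta>_diagonal_symmetries])

lemma root_diagonal_in_dual_\<Delta>_iff:
  "root_diagonal d k \<in> dual_\<Delta> \<longleftrightarrow> (\<forall>h\<in>\<Delta>. diagonal_character k h = 1)"
proof -
  have "root_diagonal d k \<in> dual_\<Delta> \<longleftrightarrow>
      (\<forall>l. root_diagonal d l \<in> \<Delta> \<longrightarrow> diagonal_character k (root_diagonal d l) = 1)"
    by (simp add: dual_\<Delta>_eq root_diagonal_diagonal_symmetry diagonal_character_sym[of _ d k])
  also have "\<dots> \<longleftrightarrow> (\<forall>h\<in>\<Delta>. diagonal_character k h = 1)"
    using \<Delta>_subset by fastforce
  finally show ?thesis .
qed

lemma dual_\<Delta>E:
  assumes "g \<in> dual_\<Delta>"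
  obtains k where "\<And>i. k i < d i" "g = root_diagonal d k"
  using assms unfolding dual_\<Delta>_eq diagonal_symmetries_fermat[OF d_pos] by blast

lemma diagonal_character_zero: "diagonal_character (\<lambda>i. 0) h = 1"
  by (simp add: diagonal_character_def)

lemma diagonal_character_one: "diagonal_character l (mat 1) = 1"
  by (simp add: diagonal_character_def mat_def)

lemma one_dual_\<Delta>: "mat 1 \<in> dual_\<Delta>"
  using root_diagonal_in_dual_\<Delta>_iff[of "\<lambda>i. 0"] root_diagonal_eq_one_iff[of d "\<lambda>i. 0"] d_pos
    by (simp add: diagonal_character_zero)

lemma mult_dual_\<Delta>:
  assumes "g \<in> dual_\<Delta>" "h \<in> dual_\<Delta>"
  shows "g ** h \<in> dual_\<Delta>"
proof -
  obtain k l where "g = root_diagonal d k" "h = root_diagonal d l"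
    using assms by (meson dual_\<Delta>E)
  moreover have "diagonal_character (\<lambda>i. k i + l i) a = diagonal_character k a * diagonal_character l a" for a
    by (simp add: diagonal_character_def power_add prod.distrib)
  ultimately show ?thesis
    using assms by (simp add: root_diagonal_add root_diagonal_in_dual_\<Delta>_iff)
qed

lemma inv_dual_\<Delta>:
  assumes "g \<in> dual_\<Delta>"
  shows "matrix_inv g \<in> dual_\<Delta>"
proof -
  obtain k where k: "\<And>i. k i < d i" "g = root_diagonal d k" using dual_\<Delta>E[OF assms] by blast
  let ?l = "\<lambda>i. d i - k i"
  have add: "k i + ?l i = d i" for i using k(1)[of i] by simp
  have inv: "matrix_inv g = root_diagonal d ?l" by (simp add: k matrix_inv_root_diagonal)
  have "diagonal_character ?l h = 1" if h: "h \<in> \<Delta>" for h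
  proof -
    obtain m where m: "h = root_diagonal d m" using h \<Delta>_subset by blast
    have "diagonal_character k h * diagonal_character ?l h = diagonal_character (\<lambda>i. k i + ?l i) h"
      by (simp only: diagonal_character_def power_add prod.distrib)
    also have "\<dots> = 1"
    proof -
      have "root_diagonal d d = mat 1" by (simp add: root_diagonal_eq_one_iff[OF d_pos])
      then show ?thesis
        by (simp add: add m diagonal_character_sym[of _ d m] diagonal_character_one)
    qed
    finally show ?thesis
      using assms h by (simp add: k(2) root_diagonal_in_dual_\<Delta>_iff)
  qed
  then show ?thesis unfolding inv root_diagonal_in_dual_\<Delta>_iff by blast
qed

text \<open>The permutations in \<open>\<Gamma>\<close> normalize \<open>\<Delta>\<close> and respect the pairing, hence normalize the dual.\<close>

lemma permute_dual_\<Delta>: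
  assumes p: "p \<in> permutations" and k: "root_diagonal d k \<in> dual_\<Delta>"
  shows "root_diagonal d (k \<circ> p) \<in> dual_\<Delta>"
  unfolding root_diagonal_in_dual_\<Delta>_iff
proof
  let ?q = "inv_into UNIV p"
  fix h assume h: "h \<in> \<Delta>"
  then obtain l where l: "\<And>i. l i < d i" "h = root_diagonal d l" using \<Delta>_subset by blast
  have "root_diagonal d (l \<circ> ?q) \<in> \<Gamma>"
    using h root_diagonal_permute_mem_iff[OF permutation_inv(1)[OF p], of l] by (simp add: l \<Delta>_def)
  then have "root_diagonal d (l \<circ> ?q) \<in> \<Delta>" by (simp only: root_diagonal_mem_\<Delta>_iff)
  then have "diagonal_character k (root_diagonal d (l \<circ> ?q)) = 1"
    using k unfolding root_diagonal_in_dual_\<Delta>_iff by blast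
  moreover have "diagonal_character k (root_diagonal d (l \<circ> ?q)) = diagonal_character (k \<circ> p) h"
  proof -
    have pUNIV: "p permutes UNIV" using p by (simp add: permutations_def)
    have qp: "?q (p i) = i" for i using permutation_inv(3)[OF p] by (simp add: fun_eq_iff)
    show ?thesis
      unfolding diagonal_character_def root_diagonal_def l(2) diagonal_nth
      by (subst prod.permute[OF pUNIV]) (simp add: o_def qp permutation_preserves_exponents[OF p])
  qed
  ultimately show "diagonal_character (k \<circ> p) h = 1" by simp
qed

lemma dual_\<Gamma>_iff: "g \<in> dual_\<Gamma> \<longleftrightarrow> (\<exists>h\<in>dual_\<Delta>. \<exists>p\<in>permutations. g = h ** permutation_matrix p)"
  unfolding dual_\<Gamma>_def set_mult_general_linear even_permutations_eq permutations_def by blast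

lemma permutations_comp:
  assumes "p \<in> permutations" "q \<in> permutations"
  shows "q \<circ> p \<in> permutations"
proof -
  have "permutation_matrix p ** permutation_matrix q \<in> \<Gamma>"
    using assms by (intro mult_mem permutation_mem)
  then show ?thesis
    using assms permutes_compose[of p UNIV q] evenperm_comp[of q p]
    by (auto simp: permutations_def permutation_matrix_mult permutes_imp_permutation)
qed

lemma permutation_matrix_dual_\<Delta>:
  assumes p: "p \<in> permutations" and h: "h \<in> dual_\<Delta>"
  obtains h' where "h' \<in> dual_\<Delta>" "permutation_matrix p ** h = h' ** permutation_matrix p"
proof -
  obtain k where k: "h = root_diagonal d k" using dual_\<Delta>E[OF h] by blast
  show thesis
  proof
    show "root_diagonal d (k \<circ> p) \<in> dual_\<Delta>" using permute_dual_\<Delta>[OF p] h k by simp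
    show "permutation_matrix p ** h = root_diagonal d (k \<circ> p) ** permutation_matrix p"
      using root_diagonal_permutation_matrix[of d p k] permutation_preserves_exponents[OF p] k by simp
  qed
qed

lemma dual_\<Gamma>_mult:
  assumes "g \<in> dual_\<Gamma>" "g' \<in> dual_\<Gamma>"
  shows "g ** g' \<in> dual_\<Gamma>"
proof -
  obtain h p where g: "h \<in> dual_\<Delta>" "p \<in> permutations" "g = h ** permutation_matrix p"
    using assms(1) dual_\<Gamma>_iff by auto
  obtain h' p' where g': "h' \<in> dual_\<Delta>" "p' \<in> permutations" "g' = h' ** permutation_matrix p'"
    using assms(2) dual_\<Gamma>_iff by auto
  obtain h'' where h'': "h'' \<in> dual_\<Delta>" "permutation_matrix p ** h' = h'' ** permutation_matrix p"
    using permutation_matrix_dual_\<Delta>[OF g(2) g'(1)] by blast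
  have "g ** g' = h ** (permutation_matrix p ** h') ** permutation_matrix p'"
    by (simp add: g g' matrix_mul_assoc)
  also have "\<dots> = (h ** h'') ** (permutation_matrix p ** permutation_matrix p')"
    by (simp add: h'' matrix_mul_assoc)
  finally show ?thesis
    unfolding dual_\<Gamma>_iff permutation_matrix_mult
    using mult_dual_\<Delta>[OF g(1) h''(1)] permutations_comp[OF g(2) g'(2)] by blast
qed

lemma identity_permutation: "id \<in> permutations"
  using one_mem by (simp add: permutations_def permutation_matrix_id permutes_id evenperm_id)

lemma dual_\<Delta>_subset: "dual_\<Delta> \<subseteq> dual_\<Gamma>"
proof
  fix g assume "g \<in> dual_\<Delta>"
  then show "g \<in> dual_\<Gamma>"
    unfolding dual_\<Gamma>_iff using identity_permutation
    by (intro bexI[of _ g] bexI[of _ id]) (simp_all add: permutation_matrix_id)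
qed

lemma permutation_in_dual_\<Gamma>: "p \<in> permutations \<Longrightarrow> permutation_matrix p \<in> dual_\<Gamma>"
  unfolding dual_\<Gamma>_iff using one_dual_\<Delta> by (intro bexI[of _ "mat 1"] bexI[of _ p]) simp_all

lemma invertible_dual_\<Delta>: "g \<in> dual_\<Delta> \<Longrightarrow> invertible g"
  by (auto simp: dual_\<Delta>_eq diagonal_symmetries_def max_symmetries_def)

lemma dual_\<Gamma>_inv:
  assumes "g \<in> dual_\<Gamma>"
  shows "matrix_inv g \<in> dual_\<Gamma>"
proof -
  obtain h p where g: "h \<in> dual_\<Delta>" "p \<in> permutations" "g = h ** permutation_matrix p"
    using assms dual_\<Gamma>_iff by auto
  let ?q = "inv_into UNIV p"
  have "g ** (permutation_matrix ?q ** matrix_inv h)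
      = h ** (permutation_matrix p ** permutation_matrix ?q) ** matrix_inv h"
    by (simp add: g matrix_mul_assoc)
  also have "\<dots> = mat 1"
    by (simp add: permutation_matrix_mult permutation_inv[OF g(2)] permutation_matrix_id
        matrix_inv invertible_dual_\<Delta>[OF g(1)])
  finally have "matrix_inv g = permutation_matrix ?q ** matrix_inv h" by (rule matrix_inv_eqI)
  then show ?thesis
    using dual_\<Gamma>_mult[OF permutation_in_dual_\<Gamma>[OF permutation_inv(1)[OF g(2)]]]
      subsetD[OF dual_\<Delta>_subset inv_dual_\<Delta>[OF g(1)]] by simp
qed

lemma max_symmetries_mult:
  assumes "g \<in> max_symmetries V" "h \<in> max_symmetries V"
  shows "g ** h \<in> max_symmetries V"
proof -
  have "(g ** h) $ i $ j = 0" if "weights V i \<noteq> weights V j" for i j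
  proof -
    have "g $ i $ k * h $ k $ j = 0" for k
      using assms that by (cases "weights V i = weights V k") (auto simp: max_symmetries_def)
    then have "(\<Sum>k\<in>UNIV. g $ i $ k * h $ k $ j) = 0" by (intro sum.neutral) blast
    then show ?thesis by (simp add: matrix_matrix_mult_def)
  qed
  then show ?thesis
    using assms by (auto simp: max_symmetries_def matrix_vector_mul_assoc[symmetric] invertible_mult)
qed

lemma dual_\<Gamma>_symmetries: "dual_\<Gamma> \<subseteq> max_symmetries V"
proof
  fix g assume "g \<in> dual_\<Gamma>"
  then obtain h p where g: "h \<in> dual_\<Delta>" "p \<in> permutations" "g = h ** permutation_matrix p"
    using dual_\<Gamma>_iff by auto
  have "h \<in> max_symmetries V" using g(1) by (simp add: dual_\<Delta>_eq diagonal_symmetries_def)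
  then show "g \<in> max_symmetries V"
    unfolding g(3) using subsetD[OF symmetries permutation_mem[OF g(2)]] by (rule max_symmetries_mult)
qed

text \<open>If a product of a diagonal matrix and a permutation matrix is diagonal, then the permutation is
  trivial. The same argument with the roles exchanged gives \<open>dual_\<Gamma>_permutations\<close>.\<close>

lemma dual_\<Gamma>_diagonal: "dual_\<Gamma> \<inter> diagonal_symmetries V = dual_\<Delta>"
proof
  show "dual_\<Gamma> \<inter> diagonal_symmetries V \<subseteq> dual_\<Delta>"
  proof
    fix g assume "g \<in> dual_\<Gamma> \<inter> diagonal_symmetries V"
    then obtain h p where g: "h \<in> dual_\<Delta>" "p \<in> permutations" "g = h ** permutation_matrix p"
      and "g \<in> diagonal_symmetries V"
      using dual_\<Gamma>_iff by auto
    then obtain k where k: "g = root_diagonal d k" by (auto simp: diagonal_symmetries_fermat[OF d_pos])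
    obtain l where l: "matrix_inv h = root_diagonal d l" using dual_\<Delta>E[OF inv_dual_\<Delta>[OF g(1)]] by blast
    have "permutation_matrix p = matrix_inv h ** g"
      by (simp add: g(3) matrix_mul_assoc matrix_inv invertible_dual_\<Delta>[OF g(1)])
    also have "\<dots> = root_diagonal d (\<lambda>i. l i + k i)" by (simp add: k l root_diagonal_add)
    finally have "permutation_matrix p = (mat 1 :: complex^'n^'n)"
      unfolding root_diagonal_def by (rule permutation_matrix_eq_diagonal)
    then show "g \<in> dual_\<Delta>" using g by simp
  qed
  show "dual_\<Delta> \<subseteq> dual_\<Gamma> \<inter> diagonal_symmetries V"
    using dual_\<Delta>_subset by (auto simp: dual_\<Delta>_eq)
qed

lemma dual_\<Gamma>_permutations: "dual_\<Gamma> \<inter> even_permutations = \<Gamma> \<inter> even_permutations"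
proof
  show "dual_\<Gamma> \<inter> even_permutations \<subseteq> \<Gamma> \<inter> even_permutations"
  proof
    fix g assume g: "g \<in> dual_\<Gamma> \<inter> even_permutations"
    then obtain h p where h: "h \<in> dual_\<Delta>" "p \<in> permutations" "g = h ** permutation_matrix p"
      using dual_\<Gamma>_iff by auto
    obtain q where q: "g = permutation_matrix q" using g by (auto simp: even_permutations_eq)
    obtain k where k: "h = root_diagonal d k" using dual_\<Delta>E[OF h(1)] by blast
    have "h = g ** permutation_matrix (inv_into UNIV p)"
      by (simp add: h(3) matrix_mul_assoc[symmetric] permutation_matrix_mult permutation_inv[OF h(2)]
          permutation_matrix_id)
    then have eq: "h = permutation_matrix (inv_into UNIV p \<circ> q)" by (simp add: q permutation_matrix_mult)
    then have "permutation_matrix (inv_into UNIV p \<circ> q)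
        = diagonal (\<lambda>i. cis (2 * pi * of_nat (k i) / of_nat (d i)))"
      by (simp only: k root_diagonal_def)
    then have "permutation_matrix (inv_into UNIV p \<circ> q) = (mat 1 :: complex^'n^'n)"
      by (rule permutation_matrix_eq_diagonal)
    then have "g = permutation_matrix p" using h(3) eq by simp
    then show "g \<in> \<Gamma> \<inter> even_permutations" using g permutation_mem[OF h(2)] by simp
  qed
  show "\<Gamma> \<inter> even_permutations \<subseteq> dual_\<Gamma> \<inter> even_permutations"
    using permutation_in_dual_\<Gamma> by (auto simp: even_permutations_eq permutations_def)
qed

lemma dual_split_symmetry_group: "split_symmetry_group d dual_\<Gamma>"
proof (rule split_symmetry_group.intro)
  have inv: "invertible g" if "g \<in> dual_\<Gamma>" for g
    using that dual_\<Gamma>_symmetries by (auto simp: max_symmetries_def)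
  show "subgroup dual_\<Gamma> general_linear"
  proof (rule subgroup.intro)
    show "dual_\<Gamma> \<subseteq> carrier general_linear" using inv by (auto simp: general_linear_def)
    show "g \<otimes>\<^bsub>general_linear\<^esub> h \<in> dual_\<Gamma>" if "g \<in> dual_\<Gamma>" "h \<in> dual_\<Gamma>" for g h
      using dual_\<Gamma>_mult[OF that] by (simp add: general_linear_def)
    show "\<one>\<^bsub>general_linear\<^esub> \<in> dual_\<Gamma>"
      using subsetD[OF dual_\<Delta>_subset one_dual_\<Delta>] by (simp add: general_linear_def)
    show "inv\<^bsub>general_linear\<^esub> g \<in> dual_\<Gamma>" if "g \<in> dual_\<Gamma>" for g
      using dual_\<Gamma>_inv[OF that] by (simp add: inv_general_linear inv[OF that])
  qed
  show "dual_\<Gamma> = (dual_\<Gamma> \<inter> diagonal_symmetries V) <#>\<^bsub>general_linear\<^esub> (dual_\<Gamma> \<inter> even_permutations)"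
    unfolding dual_\<Gamma>_diagonal dual_\<Gamma>_permutations by (rule dual_\<Gamma>_def)
qed (use d dual_\<Gamma>_symmetries in auto)

interpretation dual: split_symmetry_group d dual_\<Gamma>
  by (rule dual_split_symmetry_group)

lemma dual_permutations: "dual.permutations = permutations"
proof -
  have "permutation_matrix p \<in> dual_\<Gamma> \<longleftrightarrow> permutation_matrix p \<in> \<Gamma>"
    if "p permutes UNIV" "evenperm p" for p :: "'n \<Rightarrow> 'n"
    using that dual_\<Gamma>_permutations unfolding even_permutations_eq by blast
  then show ?thesis by (auto simp: dual.permutations_def permutations_def)
qed

lemma dual_dual_\<Delta>: "dual.\<Delta> = dual_\<Delta>"
  by (simp add: dual.\<Delta>_def dual_\<Gamma>_diagonal)

lemma dual_narrow_exponents: "dual.narrow_exponents = invariant_exponents"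
  using dual.root_diagonal_mem_\<Delta>_iff root_diagonal_in_dual_\<Delta>_iff
  by (auto simp: dual.narrow_exponents_def invariant_exponents_def dual_dual_\<Delta>[symmetric])

text \<open>This is where double duality enters: \<open>b\<close> is invariant under the dual of \<open>\<Delta>\<close> if and only if the
  symmetry with exponent \<open>b\<close> lies in \<open>\<Delta>\<close>.\<close>

lemma dual_invariant_exponents: "dual.invariant_exponents = narrow_exponents"
proof -
  have "(\<forall>h\<in>dual_\<Delta>. diagonal_character (Suc \<circ> b) h = 1) \<longleftrightarrow> root_diagonal d (Suc \<circ> b) \<in> \<Gamma>" for b
  proof
    assume *: "\<forall>h\<in>dual_\<Delta>. diagonal_character (Suc \<circ> b) h = 1"
    have "root_diagonal d (Suc \<circ> b) \<in> \<Delta>"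
    proof (rule double_dual[OF d_pos \<Delta>_diagonal_symmetries one_\<Delta> mult_\<Delta> inv_\<Delta>])
      show "root_diagonal d (Suc \<circ> b) \<in> diagonal_symmetries V"
        by (rule root_diagonal_diagonal_symmetry)
      show "diagonal_character l (root_diagonal d (Suc \<circ> b)) = 1"
        if "root_diagonal d l \<in> dual_group (fermat_exponents d) \<Delta>" for l
        using * that by (simp add: diagonal_character_sym[of l] dual_\<Delta>_def)
    qed
    then show "root_diagonal d (Suc \<circ> b) \<in> \<Gamma>" by (simp add: \<Delta>_def)
  next
    assume "root_diagonal d (Suc \<circ> b) \<in> \<Gamma>"
    then have "root_diagonal d (Suc \<circ> b) \<in> \<Delta>" by (simp add: root_diagonal_mem_\<Delta>_iff)
    then have "diagonal_character l (root_diagonal d (Suc \<circ> b)) = 1" if "root_diagonal d l \<in> dual_\<Delta>" for l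
      using that unfolding root_diagonal_in_dual_\<Delta>_iff by blast
    then show "\<forall>h\<in>dual_\<Delta>. diagonal_character (Suc \<circ> b) h = 1"
      by (metis diagonal_character_sym dual_\<Delta>E)
  qed
  then show ?thesis
    by (simp add: dual.invariant_exponents_def narrow_exponents_def dual_dual_\<Delta>)
qed

lemma A_bidegree_inj: "A_bidegree U g r = A_bidegree U g r' \<Longrightarrow> r = r'"
  by (simp add: A_bidegree_def)

lemma B_bidegree_inj: "B_bidegree U g r = B_bidegree U g r' \<Longrightarrow> r = r'"
  by (simp add: B_bidegree_def)

theorem mirror_untwisted_narrow:
  "\<exists>\<phi>. bigraded_iso \<phi> (A_untwisted V \<Gamma>) (B_narrow V dual_\<Gamma> dual_\<Delta>)"
proof -
  have eq: "untwisted_coefficients (\<lambda>b. A_bidegree V (mat 1) (shifted_degree d b))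
      = dual.narrow_coefficients (\<lambda>b. B_bidegree V (root_diagonal d (Suc \<circ> b)) 0)"
    by (rule coefficient_space_cong)
      (simp_all add: dual_narrow_exponents dual_permutations mirror_bidegree(1) invariant_exponents_def)
  have A: "bigraded_iso untwisted_state
      (untwisted_coefficients (\<lambda>b. A_bidegree V (mat 1) (shifted_degree d b)))
      (supported_on V \<Gamma> {mat 1} (state_space (A_bidegree V) V \<Gamma>))"
    by (rule untwisted_iso) (rule A_bidegree_inj)
  show ?thesis
    unfolding A_untwisted_def B_narrow_def A_model_def B_model_def
    using bigraded_iso_via_coefficients[OF A[unfolded eq] dual.narrow_iso[of "B_bidegree V"]] unfolding dual_dual_\<Delta> .
qed

theorem mirror_narrow_untwisted:
  "\<exists>\<psi>. bigraded_iso \<psi> (A_narrow V \<Gamma> \<Delta>) (B_untwisted V dual_\<Gamma>)"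
proof -
  have "fixed_space (root_diagonal d (Suc \<circ> b)) = {0}" if "b \<in> narrow_exponents" for b
    using that narrow_eq narrow_fixed_space by blast
  then have eq: "narrow_coefficients (\<lambda>b. A_bidegree V (root_diagonal d (Suc \<circ> b)) 0)
      = dual.untwisted_coefficients (\<lambda>b. B_bidegree V (mat 1) (shifted_degree d b))"
    by (intro coefficient_space_cong)
      (simp_all add: dual_invariant_exponents dual_permutations mirror_bidegree(2) narrow_exponents_def)
  have B: "bigraded_iso dual.untwisted_state
      (dual.untwisted_coefficients (\<lambda>b. B_bidegree V (mat 1) (shifted_degree d b)))
      (supported_on V dual_\<Gamma> {mat 1} (state_space (B_bidegree V) V dual_\<Gamma>))"
    by (rule dual.untwisted_iso) (rule B_bidegree_inj)
  show ?thesis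
    unfolding A_narrow_def B_untwisted_def A_model_def B_model_def
    using bigraded_iso_via_coefficients[OF narrow_iso[of "A_bidegree V", unfolded eq] B] .
qed

end

theorem theorem5p2:
  fixes d :: "'n::finite \<Rightarrow> nat"
    and A :: "nat^'n^'n"
    and W WT :: "complex^'n \<Rightarrow> complex"
    and G H K Gstar :: "(complex^'n^'n) set"
  assumes d: "\<forall>i. d i \<ge> 2"
    and A: "A = fermat_exponents d"
    and W: "W = polynomial_of A"
    and WT: "WT = polynomial_of (Finite_Cartesian_Product.transpose A)"
    and G: "subgroup G general_linear" "G \<subseteq> max_symmetries W"
    and admissible: "grading_operator W \<in> G"
    and H: "H = G \<inter> diagonal_symmetries W"
    and K: "K = G \<inter> even_permutations"
    and G_eq: "G = H <#>\<^bsub>general_linear\<^esub> K"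
    and Gstar: "Gstar = dual_group A H <#>\<^bsub>general_linear\<^esub> K"
  shows "(\<exists>\<phi>. bigraded_iso \<phi> (A_untwisted W G) (B_narrow WT Gstar (dual_group A H))) \<and>
         (\<exists>\<psi>. bigraded_iso \<psi> (A_narrow W G H) (B_untwisted WT Gstar))"
proof -
  have W': "W = polynomial_of (fermat_exponents d)" and WT': "WT = polynomial_of (fermat_exponents d)"
    using A W WT by (simp_all add: transpose_fermat)
  interpret split_symmetry_group d G
  proof (rule split_symmetry_group.intro)
    show "G = (G \<inter> diagonal_symmetries (polynomial_of (fermat_exponents d)))
        <#>\<^bsub>general_linear\<^esub> (G \<inter> even_permutations)"
      using G_eq unfolding H K W' .
    show "subgroup G general_linear" "G \<subseteq> max_symmetries (polynomial_of (fermat_exponents d))"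
      using G unfolding W' .
    show "d i \<ge> 2" for i using d by blast
  qed
  have H': "H = \<Delta>" by (simp add: H W' \<Delta>_def)
  have dual: "dual_group A \<Delta> = dual_\<Delta>" by (simp add: A dual_\<Delta>_def)
  have Gstar': "Gstar = dual_\<Gamma>" by (simp add: Gstar K dual_\<Gamma>_def H' dual)
  show ?thesis
    unfolding W' WT' H' dual Gstar'
    using mirror_untwisted_narrow mirror_narrow_untwisted by (rule conjI)
qed

end
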